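(* Let $Q(n)=c_kn^k+\ldots+c_1n+c_0$ be a polynomial with real coefficients. Then the sequence $Q(\Omega(n))$, $n\in\mathbb{N}$, is uniformly distributed mod $1$ if and only if at least one of the coefficients $c_1,\ldots,c_k$ is irrational.
   Context: $\mathbb{N}=\{1,2,3,\ldots\}$. $\Omega(n)$ denotes the number of prime factors of $n$ counted with multiplicities. *)

theory Defs
  imports "HOL-Analysis.Analysis" "HOL-Computational_Algebra.Computational_Algebra"
begin

definition big_omega :: "nat \<Rightarrow> nat" where
  "big_omega n = size (prime_factorization n)"

(* The sequence is indexed by the positive integers; the value x 0 plays no role. *)
definition uniformly_distributed_mod_1 :: "(nat \<Rightarrow> real) \<Rightarrow> bool" where
  "uniformly_distributed_mod_1 x \<longleftrightarrow>
     (\<forall>a b. 0 \<le> a \<and> a < b \<and> b \<le> 1 \<longrightarrow>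
        (\<lambda>N. real (card {n \<in> {1..N}. frac (x n) \<in> {a..<b}}) / real N) \<longlonglongrightarrow> b - a)"

end

theory Submission
  imports Defs
begin

text \<open>
  Write \<open>F s x\<close> for the mean of \<open>a (\<Omega>(n) + s)\<close> over \<open>n \<le> x\<close>, where \<open>a\<close> is bounded by 1.
  A Bessel inequality for the almost orthogonal functions \<open>n \<mapsto> p [p dvd n] - 1\<close> (the dual of the
  Turan--Kubilius inequality) shows that \<open>F s x\<close> is close to \<open>F (s + 1) (x / p)\<close> for all primes
  \<open>p\<close> outside a set with bounded reciprocal sum. Hence \<open>F s x\<close> is close to
  \<open>F (s + i + 1) (x / (m\<^sub>i p))\<close> for each \<open>i \<le> K\<close>, a suitable product \<open>m\<^sub>i\<close> of \<open>i\<close> small primes,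
  and most primes \<open>p\<close> of some block \<open>exp V < p \<le> exp (8 V)\<close>.
  Cut the logarithmic scale into short cells. Since a short interval contains at most a constant
  times the expected number of primes (an elementary sieve), each \<open>i\<close> occupies a positive proportion
  of the cells, the proportion not depending on the precision. For \<open>K\<close> large two indices \<open>i < j\<close>
  share a cell, and \<open>F\<close> varies slowly in \<open>x\<close>, so \<open>F s x\<close> is close to \<open>F (s + (j - i)) x\<close>. As
  \<open>j - i \<le> K\<close>, the shift by \<open>K!\<close> leaves the means asymptotically unchanged, for every bounded
  \<open>a\<close>. Averaging over such shifts reduces Weyl's criterion for \<open>Q(\<Omega>(n))\<close> to uniform bounds for
  Weyl sums of \<open>Q\<close> along arithmetic progressions. The prime number theorem is not needed.
\<close>

section \<open>Sieve bounds for primes in short intervals\<close>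

text \<open>The difference \<open>j - i\<close> found by pigeonhole depends on \<open>x\<close> and
  on the precision, so a bound for it that grew with the precision would give no single period. The
  bound stays fixed because both sides of the count scale alike in the cell length \<delta>: at most
  about \<open>10 * V / \<delta>\<close> cells are available, and each index occupies at least
  \<open>V / (1920 * \<delta>)\<close> of them, whence 19200. The two kinds of primes have different
  roles. The product \<open>m\<^sub>i\<close> of small primes sets the shift to \<open>i\<close> and
  is bounded independently of \<open>x\<close>. The prime \<open>p\<close> of the long block gives
  the freedom to move the argument into a common cell; each path uses exactly one such prime, so its
  own shift by 1 cancels. A shift by 1 in place of \<open>K!\<close> would be as deep as the prime
  number theorem: for \<open>a k = (-1) ^ k\<close> it says that the Liouville function has mean 0.
  An even shift says nothing about that sequence, yet it serves here because irrationality of a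
  coefficient survives restriction to every arithmetic progression.\<close>

definition moebius :: "nat \<Rightarrow> real" where
  "moebius n = (if squarefree n then (-1) ^ card (prime_factors n) else 0)"

lemma abs_moebius_le: "\<bar>moebius n\<bar> \<le> 1"
  by (simp add: moebius_def power_abs)

lemma moebius_1: "moebius (Suc 0) = 1"
  by (simp add: moebius_def)

lemma moebius_prime_mult:
  assumes "prime p" "\<not> p dvd d"
  shows "moebius (p * d) = - moebius d"
proof -
  have c: "coprime p d" using assms by (simp add: prime_imp_coprime)
  have "d \<noteq> 0" using assms(2) by (metis dvd_0_right)
  have "squarefree (p * d) \<longleftrightarrow> squarefree d"
    using c squarefree_mult_coprime[of p d] squarefree_prime[of p] assms squarefree_multD(2) by blast
  moreover have "prime_factors (p * d) = insert p (prime_factors d)"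
    using assms \<open>d \<noteq> 0\<close> by (subst prime_factors_product) (auto simp: prime_factorization_prime)
  moreover have "p \<notin> prime_factors d" using assms by auto
  ultimately show ?thesis by (simp add: moebius_def)
qed

lemma moebius_prime_square:
  assumes "prime p" "p\<^sup>2 dvd d"
  shows "moebius d = 0"
proof -
  have "\<not> squarefree d" using assms by (meson not_prime_unit squarefreeD)
  then show ?thesis by (simp add: moebius_def)
qed

text \<open>Divisors of \<open>p ^ e * m\<close> not divisible by the square of \<open>p\<close>
  come in pairs \<open>d\<close>, \<open>p * d\<close> with \<open>d dvd m\<close>, and the two
  Moebius values are opposite. Each prime peeled off thus costs one difference of
  \<open>f\<close>.\<close>

lemma sum_divisors_moebius_split:
  fixes f :: "nat \<Rightarrow> real"
  assumes "prime p" "\<not> p dvd m" "e > 0"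
  shows "(\<Sum>d | d dvd p ^ e * m. moebius d * f d) = (\<Sum>d | d dvd m. moebius d * (f d - f (p * d)))"
proof -
  have m0: "m \<noteq> 0" "p > 0" using assms(2) prime_gt_0_nat[OF assms(1)] by (metis dvd_0_right, simp)
  have fin: "finite {d. d dvd m}" "finite {d. d dvd p ^ e * m}" using m0 by auto
  let ?A = "{d. d dvd m}"
  have sub: "?A \<union> (*) p ` ?A \<subseteq> {d. d dvd p ^ e * m}"
    using assms by (auto intro!: mult_dvd_mono dvd_power)
  have zero: "moebius d * f d = 0" if d: "d \<in> {d. d dvd p ^ e * m} - (?A \<union> (*) p ` ?A)" for d
  proof -
    have "p dvd d"
    proof (rule ccontr)
      assume "\<not> p dvd d"
      then have "coprime d (p ^ e)"
        using prime_imp_coprime[OF assms(1)] by (simp add: coprime_commute)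
      then have "d dvd m" using d by (simp add: coprime_dvd_mult_right_iff)
      then show False using d by auto
    qed
    then obtain d' where d': "d = p * d'" by auto
    have "p dvd d'"
    proof (rule ccontr)
      assume n: "\<not> p dvd d'"
      then have "coprime d' (p ^ e)"
        using prime_imp_coprime[OF assms(1)] by (simp add: coprime_commute)
      moreover have "d' dvd p ^ e * m" using d d' by (auto intro: dvd_trans[of _ "p * d'"])
      ultimately have "d' dvd m" by (simp add: coprime_dvd_mult_right_iff)
      then show False using d d' by auto
    qed
    then have "p\<^sup>2 dvd d" using d' by (simp add: power2_eq_square)
    then show ?thesis using moebius_prime_square assms(1) by simp
  qed
  have inj: "inj_on ((*) p) ?A" using m0 by (auto intro: inj_onI)
  have disj: "?A \<inter> (*) p ` ?A = {}" using assms by (auto dest: dvd_mult_left)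
  have "(\<Sum>d | d dvd p ^ e * m. moebius d * f d) = (\<Sum>d\<in>?A \<union> (*) p ` ?A. moebius d * f d)"
    by (rule sum.mono_neutral_right) (use fin sub zero in auto)
  also have "\<dots> = (\<Sum>d\<in>?A. moebius d * f d) + (\<Sum>d\<in>(*) p ` ?A. moebius d * f d)"
    using fin disj by (intro sum.union_disjoint) auto
  also have "(\<Sum>d\<in>(*) p ` ?A. moebius d * f d) = (\<Sum>d\<in>?A. moebius (p * d) * f (p * d))"
    using inj by (simp add: sum.reindex)
  also have "\<dots> = (\<Sum>d\<in>?A. - moebius d * f (p * d))"
  proof (rule sum.cong[OF refl])
    fix d assume "d \<in> ?A"
    then have "\<not> p dvd d" using assms(2) dvd_trans by blast
    then show "moebius (p * d) * f (p * d) = - moebius d * f (p * d)"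
      by (simp add: moebius_prime_mult[OF assms(1)])
  qed
  finally show ?thesis by (simp add: sum.distrib[symmetric] algebra_simps sum_subtractf sum_negf)
qed

lemma prime_power_split:
  fixes n :: nat
  assumes "n > 1"
  obtains p e m where "prime p" "\<not> p dvd m" "e > 0" "n = p ^ e * m"
proof -
  obtain p where p: "prime p" "p dvd n" using assms prime_factor_nat[of n] by auto
  have n: "n \<noteq> 0" "\<not> is_unit p" using assms p by auto
  obtain m where m: "n = p ^ multiplicity p n * m" "\<not> p dvd m"
    using multiplicity_decompose'[OF n] by metis
  moreover have "multiplicity p n > 0" using p n by (simp add: prime_multiplicity_gt_zero_iff)
  ultimately show ?thesis using p that by blast
qed

lemma sum_divisors_moebius:
  assumes "n > 1"
  shows "(\<Sum>d | d dvd n. moebius d) = 0"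
proof -
  obtain p e m where *: "prime p" "\<not> p dvd m" "e > 0" "n = p ^ e * m"
    using prime_power_split[OF assms] .
  show ?thesis using sum_divisors_moebius_split[OF *(1-3), of "\<lambda>_. 1"] *(4) by simp
qed

text \<open>The difference of \<open>L - ln d\<close> under \<open>d \<mapsto> p * d\<close> is the
  constant \<open>ln p\<close>, so the sum is \<open>ln p\<close> when \<open>n\<close> is a power
  of \<open>p\<close> and 0 otherwise: it is the von Mangoldt function.\<close>

lemma sum_divisors_moebius_ln_nonneg:
  assumes "n > 1"
  shows "(\<Sum>d | d dvd n. moebius d * (L - ln (real d))) \<ge> 0"
proof -
  obtain p e m where *: "prime p" "\<not> p dvd m" "e > 0" "n = p ^ e * m"
    using prime_power_split[OF assms] .
  have m0: "m > 0" "p > 0" using *(2) prime_gt_0_nat[OF *(1)] by (metis dvd_0_right gr0I, simp)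
  have "(\<Sum>d | d dvd n. moebius d * (L - ln (real d))) =
      (\<Sum>d | d dvd m. moebius d * ((L - ln (real d)) - (L - ln (real (p * d)))))"
    unfolding *(4) by (rule sum_divisors_moebius_split[OF *(1-3)])
  also have "\<dots> = (\<Sum>d | d dvd m. moebius d * ln p)"
    using m0 by (intro sum.cong) (auto simp: ln_mult dvd_pos_nat)
  also have "\<dots> = ln p * (\<Sum>d | d dvd m. moebius d)"
    by (simp add: sum_distrib_left mult.commute)
  finally show ?thesis
    using sum_divisors_moebius[of m] m0 by (cases "m = 1") (auto simp: moebius_1)
qed

text \<open>With three or more distinct prime factors the weight vanishes, being a third difference of a
  quadratic polynomial.\<close>

definition sieve_weight :: "real \<Rightarrow> nat \<Rightarrow> real" where
  "sieve_weight L n = (\<Sum>d | d dvd n. moebius d * (L - ln (real d))\<^sup>2)"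

text \<open>The difference of a square is linear in \<open>ln d\<close>, so the weight reduces to
  the two divisor sums already evaluated, now taken over \<open>m\<close>.\<close>

lemma sieve_weight_prime_power_mult:
  fixes p m n :: nat
  assumes *: "prime p" "\<not> p dvd m" "e > 0" "n = p ^ e * m"
  shows "sieve_weight L n = 2 * ln p * (\<Sum>d | d dvd m. moebius d * (L - ln (real d)))
     - (ln p)\<^sup>2 * (\<Sum>d | d dvd m. moebius d)"
proof -
  have m0: "m > 0" "p > 0" using *(2) prime_gt_0_nat[OF *(1)] by (metis dvd_0_right gr0I, simp)
  have "sieve_weight L n =
      (\<Sum>d | d dvd m. moebius d * ((L - ln (real d))\<^sup>2 - (L - ln (real (p * d)))\<^sup>2))"
    unfolding *(4) sieve_weight_def by (rule sum_divisors_moebius_split[OF *(1-3)])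
  also have "\<dots> = (\<Sum>d | d dvd m. 2 * ln p * (moebius d * (L - ln (real d))) - (ln p)\<^sup>2 * moebius d)"
    using m0 by (intro sum.cong) (auto simp: ln_mult dvd_pos_nat power2_eq_square algebra_simps)
  finally show ?thesis by (simp add: sum_subtractf sum_distrib_left)
qed

text \<open>Together with the next lemma this yields an upper bound sieve. On a power of
  \<open>p\<close> the weight is \<open>ln p * (2 * L - ln p)\<close>, nonnegative because
  \<open>ln p \<le> L\<close>; otherwise the sum of Moebius values over \<open>m\<close> vanishes
  and a nonnegative von Mangoldt term remains.\<close>

lemma sieve_weight_nonneg:
  assumes "n > 0" "ln (real n) \<le> L"
  shows "sieve_weight L n \<ge> 0"
proof (cases "n = 1")
  case True
  then show ?thesis by (simp add: sieve_weight_def moebius_1)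
next
  case False
  then have "n > 1" using assms by auto
  then obtain p e m where *: "prime p" "\<not> p dvd m" "e > 0" "n = p ^ e * m"
    using prime_power_split by blast
  have m0: "m > 0" "p > 0" using *(2) prime_gt_0_nat[OF *(1)] by (metis dvd_0_right gr0I, simp)
  have lp: "ln p \<ge> 0" using m0 by simp
  show ?thesis
  proof (cases "m = 1")
    case True
    have "p \<le> n" using *(3,4) True m0 by (simp add: self_le_power)
    then have "ln p \<le> L" using m0 assms by (meson ln_mono of_nat_0_less_iff of_nat_mono order_trans)
    then have "ln p * ln p \<le> L * ln p" "0 \<le> L * ln p"  using lp by (auto intro: mult_right_mono)
    then show ?thesis
      using sieve_weight_prime_power_mult[OF *, of L] True
      by (simp add: moebius_1 power2_eq_square algebra_simps)
  next
    case False
    then show ?thesis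
      using sieve_weight_prime_power_mult[OF *, of L] m0 sum_divisors_moebius[of m]
        sum_divisors_moebius_ln_nonneg[of m L] lp by auto
  qed
qed

lemma sieve_weight_prime_ge:
  assumes "prime p" "ln (real p) \<le> L"
  shows "sieve_weight L p \<ge> (ln (real p))\<^sup>2"
proof -
  have "ln p \<ge> 0" using assms prime_gt_0_nat[of p] by simp
  then have "ln p * ln p \<le> L * ln p" using assms by (auto intro: mult_right_mono)
  moreover have "\<not> p dvd 1" using assms not_prime_unit by blast
  ultimately show ?thesis
    using sieve_weight_prime_power_mult[of p 1 1 p L] assms
    by (simp add: moebius_1 power2_eq_square algebra_simps)
qed

section \<open>Bounded averages of the Moebius function with weight 1/d\<close>

lemma sum_divisors_swap:
  fixes h :: "nat \<Rightarrow> nat \<Rightarrow> real"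
  shows "(\<Sum>n=1..N. \<Sum>d | d dvd n. h d n) = (\<Sum>d=1..N. \<Sum>m=1..N div d. h d (d * m))"
proof -
  have "(\<Sum>n=1..N. \<Sum>d | d dvd n. h d n) = (\<Sum>(n,d)\<in>(SIGMA n:{1..N}. {d. d dvd n}). h d n)"
    by (rule sum.Sigma) auto
  also have "\<dots> = (\<Sum>(d,m)\<in>(SIGMA d:{1..N}. {1..N div d}). h d (d * m))"
  proof (rule sum.reindex_bij_witness[of _ "\<lambda>(d,m). (d * m, d)" "\<lambda>(n,d). (d, n div d)"], goal_cases)
    case (4 b)
    then show ?case
      by (auto simp: less_eq_div_iff_mult_less_eq mult.commute)
  next
    case (2 a)
    then show ?case
      by (auto simp: div_le_mono dvd_imp_le div_greater_zero_iff Suc_le_eq dvd_pos_nat intro: order_trans[OF dvd_imp_le])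
  qed auto
  also have "\<dots> = (\<Sum>d=1..N. \<Sum>m=1..N div d. h d (d * m))"
    by (rule sum.Sigma[symmetric]) auto
  finally show ?thesis .
qed

lemma nat_div_bounds:
  fixes d N :: nat
  assumes "d > 0"
  shows "real (N div d) \<le> real N / real d" "real N / real d \<le> real (N div d) + 1"
proof -
  have "real N = real (N div d) * real d + real (N mod d)"
    by (metis div_mult_mod_eq of_nat_add of_nat_mult)
  moreover have "real (N mod d) \<le> real d" using assms by (simp add: less_imp_le)
  ultimately show "real (N div d) \<le> real N / real d" "real N / real d \<le> real (N div d) + 1"
    using assms by (simp_all add: field_simps)
qed

text \<open>Summing the divisor sums over \<open>n \<le> N\<close> gives exactly 1, and also the sum
  of \<open>moebius d * (N div d)\<close>. Replacing \<open>N div d\<close> by \<open>N / d\<close>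
  changes each term by at most 1; divide by \<open>N\<close>.\<close>

lemma sum_moebius_div_over:
  assumes "N > 0"
  shows "\<bar>\<Sum>d=1..N. moebius d / d\<bar> \<le> 2"
proof -
  have one: "(\<Sum>n=1..N. \<Sum>d | d dvd n. moebius d) = 1"
  proof -
    have "(\<Sum>n=1..N. \<Sum>d | d dvd n. moebius d) = (\<Sum>n\<in>{1}. \<Sum>d | d dvd n. moebius d)"
      using assms by (intro sum.mono_neutral_right) (auto intro!: sum_divisors_moebius)
    then show ?thesis by (simp add: moebius_1)
  qed
  then have "(\<Sum>d=1..N. moebius d * real (N div d)) = 1"
    unfolding sum_divisors_swap by (simp add: mult.commute)
  then have "N * (\<Sum>d=1..N. moebius d / d) - 1 = (\<Sum>d=1..N. moebius d * (real N / d - real (N div d)))"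
    by (simp add: sum_distrib_left algebra_simps sum_subtractf)
  also have "\<bar>\<dots>\<bar> \<le> (\<Sum>d=1..N. 1)"
  proof (rule order_trans[OF sum_abs], rule sum_mono)
    fix d assume d: "d \<in> {1..N}"
    have "\<bar>real N / d - real (N div d)\<bar> \<le> 1"
      using nat_div_bounds[of d N] d by auto
    then show "\<bar>moebius d * (real N / d - real (N div d))\<bar> \<le> 1"
      unfolding abs_mult using abs_moebius_le[of d] by (metis abs_ge_zero mult_le_one)
  qed
  finally have "\<bar>N * (\<Sum>d=1..N. moebius d / d)\<bar> \<le> N + 1" by simp
  also have "\<dots> \<le> 2 * real N" using assms by simp
  finally show ?thesis using assms by (simp add: abs_mult)
qed

lemma euler_mascheroni_le:
  assumes "m > 0"
  shows "euler_mascheroni \<le> harm m - ln (real m)"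
proof (rule LIMSEQ_le_const2[OF euler_mascheroni_LIMSEQ])
  show "\<exists>K. \<forall>n\<ge>K. harm n - ln (real n) \<le> harm m - ln (real m)"
    using assms euler_mascheroni_sequence_decreasing[of m] by auto
qed

text \<open>Put \<open>m = N div d\<close> and \<open>y = N / d\<close>. Both
  \<open>harm m - euler_mascheroni\<close> and \<open>ln y\<close> lie between \<open>ln m\<close>
  and \<open>ln (m + 1)\<close>, hence differ by at most \<open>1 / m \<le> 2 / y\<close>.\<close>

lemma harm_ln_approx:
  assumes "d > 0" "d \<le> N"
  shows "\<bar>harm (N div d) - ln (real N / real d) - euler_mascheroni\<bar> \<le> 2 * (real d / real N)"
proof -
  define m where "m = N div d"
  define y where "y = real N / real d"
  have m: "m > 0" using assms by (simp add: m_def div_greater_zero_iff)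
  have y: "real m \<le> y" "y \<le> real m + 1"
    using nat_div_bounds[of d N] assms by (auto simp: y_def m_def)
  have "euler_mascheroni \<le> harm m - ln (real m)"
    using m by (rule euler_mascheroni_le)
  moreover have "harm m \<le> euler_mascheroni + ln (real m + 1)"
  proof -
    obtain n where n: "m = Suc n" using m gr0_implies_Suc by blast
    show ?thesis using euler_mascheroni_lower[of n] n
      by (intro order_trans[OF _ add_right_mono[OF euler_mascheroni_lower[of n]]]) (simp add: add.commute)
  qed
  moreover have "ln (real m) \<le> ln y" "ln y \<le> ln (real m + 1)" using m y by auto
  moreover have "ln (real m + 1) - ln (real m) \<le> 1 / m"
    using ln_diff_le[of "real m + 1" "real m"] m by simp
  ultimately have "\<bar>harm m - ln y - euler_mascheroni\<bar> \<le> 1 / m" by linarith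
  also have "\<dots> \<le> 2 / y" using y m by (simp add: field_simps)
  finally show ?thesis by (simp add: y_def m_def)
qed

text \<open>The same double count with weight \<open>1 / n\<close> produces
  \<open>harm (N div d)\<close> in place of \<open>N div d\<close>. Passing from \<open>harm\<close>
  to the logarithm costs 2 in total, Euler's constant times the previous sum costs 2 more, so 5 = 1
  + 2 + 2.\<close>

lemma sum_moebius_ln_div_over_nat:
  assumes "N > 0"
  shows "\<bar>\<Sum>d=1..N. moebius d / d * ln (real N / d)\<bar> \<le> 5"
proof -
  let ?g = "euler_mascheroni :: real"
  have g: "0 \<le> ?g" "?g \<le> 1"
  proof -
    show "?g \<le> 1" using euler_mascheroni_le[of 1] by (simp add: harm_def)
    show "0 \<le> ?g" using euler_mascheroni_pos by simp
  qed
  have "(\<Sum>n=1..N. \<Sum>d | d dvd n. moebius d / real n) = (\<Sum>n\<in>{1}. \<Sum>d | d dvd n. moebius d / real n)"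
    using assms by (intro sum.mono_neutral_right) (auto simp: sum_divisors_moebius sum_divide_distrib[symmetric])
  then have "(\<Sum>d=1..N. \<Sum>m=1..N div d. moebius d / real (d * m)) = 1"
    unfolding sum_divisors_swap by (simp add: moebius_1)
  moreover have "(\<Sum>m=1..N div d. moebius d / real (d * m)) = moebius d / d * harm (N div d)" for d
    by (simp add: harm_def sum_distrib_left divide_inverse mult.assoc)
  ultimately have h: "(\<Sum>d=1..N. moebius d / d * harm (N div d)) = 1" by simp
  have "\<bar>\<Sum>d=1..N. moebius d / d * (harm (N div d) - ln (real N / d) - ?g)\<bar> \<le> (\<Sum>d=1..N. 2 / real N)"
  proof (rule order_trans[OF sum_abs], rule sum_mono)
    fix d assume d: "d \<in> {1..N}"
    have "\<bar>moebius d / d * (harm (N div d) - ln (real N / d) - ?g)\<bar>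
        = \<bar>moebius d\<bar> * (\<bar>harm (N div d) - ln (real N / d) - ?g\<bar> / d)"
      by (simp add: abs_mult)
    also have "\<dots> \<le> 1 * (2 * (real d / N) / d)"
      using d harm_ln_approx[of d N] abs_moebius_le[of d]
      by (intro mult_mono divide_right_mono) auto
    finally show "\<bar>moebius d / d * (harm (N div d) - ln (real N / d) - ?g)\<bar> \<le> 2 / real N"
      using d by simp
  qed
  also have "\<dots> = 2" using assms by simp
  also have "(\<Sum>d=1..N. moebius d / d * (harm (N div d) - ln (real N / d) - ?g)) =
      1 - (\<Sum>d=1..N. moebius d / d * ln (real N / d)) - ?g * (\<Sum>d=1..N. moebius d / d)"
    by (simp add: h[symmetric] algebra_simps sum_subtractf sum_distrib_left sum.distrib)
  finally have "\<bar>1 - (\<Sum>d=1..N. moebius d / d * ln (real N / d)) - ?g * (\<Sum>d=1..N. moebius d / d)\<bar> \<le> 2" .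
  moreover have "\<bar>?g * (\<Sum>d=1..N. moebius d / d)\<bar> \<le> 1 * 2"
    unfolding abs_mult using g sum_moebius_div_over[OF assms] by (intro mult_mono) auto
  ultimately show ?thesis by linarith
qed

text \<open>From the integer part \<open>N\<close> to \<open>t\<close> the logarithm grows by at
  most 1, which multiplies a sum bounded by 2; hence 7 = 5 + 2.\<close>

lemma sum_moebius_ln_div_over:
  assumes "t \<ge> 1"
  shows "\<bar>\<Sum>d=1..nat \<lfloor>t\<rfloor>. moebius d / d * (ln t - ln (real d))\<bar> \<le> 7"
proof -
  define N where "N = nat \<lfloor>t\<rfloor>"
  have N: "N > 0" "real N \<le> t" "t \<le> real N + 1" using assms by (auto simp: N_def; linarith)+
  have "(\<Sum>d=1..N. moebius d / d * (ln t - ln (real d))) =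
      (\<Sum>d=1..N. moebius d / d * ln (real N / d) + (ln t - ln N) * (moebius d / d))"
    using N by (intro sum.cong) (auto simp: ln_div algebra_simps diff_divide_distrib)
  also have "\<dots> = (\<Sum>d=1..N. moebius d / d * ln (real N / d)) + (ln t - ln N) * (\<Sum>d=1..N. moebius d / d)"
    by (simp add: sum.distrib sum_distrib_left)
  also have "\<bar>(ln t - ln N) * (\<Sum>d=1..N. moebius d / d)\<bar> \<le> 1 * 2"
    unfolding abs_mult
  proof (rule mult_mono)
    have "ln t - ln N \<le> (t - N) / N" using N assms by (intro ln_diff_le) auto
    also have "\<dots> \<le> 1" using N by (simp add: field_simps)
    finally show "\<bar>ln t - ln N\<bar> \<le> 1" using N assms by simp
  qed (use sum_moebius_div_over[of N] N in auto)
  ultimately show ?thesis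
    using sum_moebius_ln_div_over_nat[of N] N unfolding N_def by linarith
qed

text \<open>As a function of \<open>ln X\<close>, this sum has as its derivative twice the bounded sum of the previous
  lemma.\<close>

lemma sum_moebius_ln_square_div_over:
  assumes "X \<ge> 1"
  shows "(\<Sum>d=1..nat \<lfloor>X\<rfloor>. moebius d / d * (ln X - ln (real d))\<^sup>2) \<le> 14 * ln X"
proof (cases "X = 1")
  case True
  then show ?thesis by simp
next
  case False
  then have X: "X > 1" using assms by simp
  define N where "N = nat \<lfloor>X\<rfloor>"
  \<comment> \<open>Truncation at 0 lets one sum with the fixed range \<open>{1..N}\<close> serve
    every \<open>u \<le> ln X\<close>, and the truncated square is still differentiable at the
    moment a term enters.\<close>
  define q where "q = (\<lambda>v::real. (max 0 v)\<^sup>2)"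
  have q: "(q has_real_derivative 2 * max 0 v) (at v)" for v
  proof -
    consider "v < 0" | "v > 0" | "v = 0" by linarith
    then show ?thesis
    proof cases
      case 1
      have "((\<lambda>v. 0) has_real_derivative 2 * max 0 v) (at v)" using 1 by simp
      moreover have "eventually (\<lambda>v. q v = 0) (nhds v)"
        using eventually_nhds_in_open[of "{..<0}" v] 1 by (auto simp: q_def elim!: eventually_mono)
      ultimately show ?thesis by (subst DERIV_cong_ev[OF refl _ refl]) auto
    next
      case 2
      have "((\<lambda>v. v\<^sup>2) has_real_derivative 2 * max 0 v) (at v)" using 2 
        by (auto intro!: derivative_eq_intros)
      moreover have "eventually (\<lambda>v. q v = v\<^sup>2) (nhds v)"
        using eventually_nhds_in_open[of "{0<..}" v] 2 by (auto simp: q_def elim!: eventually_mono)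
      ultimately show ?thesis by (subst DERIV_cong_ev[OF refl _ refl]) auto
    next
      case 3
      have "((\<lambda>h. q h / h) \<longlongrightarrow> 0) (at 0)"
      proof (rule Lim_null_comparison[where g = "\<lambda>h. \<bar>h\<bar>"])
        show "\<forall>\<^sub>F h in at 0. norm (q h / h) \<le> \<bar>h\<bar>"
          by (auto simp: q_def max_def power2_eq_square)
      qed (auto intro!: tendsto_eq_intros)
      then show ?thesis using 3 by (simp add: has_field_derivative_iff q_def)
    qed
  qed
  define F where "F = (\<lambda>u. \<Sum>d=1..N. moebius d / d * q (u - ln (real d)))"
  define F' where "F' = (\<lambda>u. \<Sum>d=1..N. moebius d / d * (2 * max 0 (u - ln (real d))))"
  have dF: "(F has_real_derivative F' u) (at u)" for u
    unfolding F_def F'_def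
  proof (intro DERIV_sum DERIV_cmult)
    fix d
    have "((\<lambda>u. u - ln (real d)) has_real_derivative 1) (at u)"
      by (auto intro!: derivative_eq_intros)
    from DERIV_chain2[OF q this]
    show "((\<lambda>u. q (u - ln (real d))) has_real_derivative 2 * max 0 (u - ln (real d))) (at u)"
      by simp
  qed
  have F'le: "F' u \<le> 14" if u: "0 \<le> u" "u \<le> ln X" for u
  proof -
    have eu: "exp u \<le> X" using u X by (metis exp_le_cancel_iff exp_ln order.strict_trans zero_less_one)
    \<comment> \<open>Terms with \<open>d > exp u\<close> are truncated to 0; what is left is twice
      the sum bounded by 7, taken at \<open>t = exp u\<close>.\<close>
    have "F' u = (\<Sum>d=1..nat \<lfloor>exp u\<rfloor>. moebius d / d * (2 * max 0 (u - ln (real d))))"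
      unfolding F'_def
    proof (rule sum.mono_neutral_right)
      show "{1..nat \<lfloor>exp u\<rfloor>} \<subseteq> {1..N}" using eu by (auto simp: N_def intro: order_trans nat_mono floor_mono)
      show "\<forall>d\<in>{1..N} - {1..nat \<lfloor>exp u\<rfloor>}. moebius d / d * (2 * max 0 (u - ln (real d))) = 0"
      proof
        fix d assume d: "d \<in> {1..N} - {1..nat \<lfloor>exp u\<rfloor>}"
        then have "nat \<lfloor>exp u\<rfloor> < d" by auto
        then have "exp u < real d" by linarith
        then have "u < ln (real d)" by (metis exp_gt_zero ln_exp ln_less_cancel_iff order.strict_trans)
        then show "moebius d / d * (2 * max 0 (u - ln (real d))) = 0" by simp
      qed
    qed simp
    also have "\<dots> = (\<Sum>d=1..nat \<lfloor>exp u\<rfloor>. 2 * (moebius d / d * (ln (exp u) - ln (real d))))"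
    proof (rule sum.cong[OF refl])
      fix d assume d: "d \<in> {1..nat \<lfloor>exp u\<rfloor>}"
      then have "real d \<le> exp u" using le_nat_floor[of _ "exp u"] by (auto simp: le_nat_iff le_floor_iff)
      then have "ln (real d) \<le> u" using d by (metis atLeastAtMost_iff ln_exp ln_mono of_nat_0_less_iff zero_less_one less_le_trans)
      then show "moebius d / d * (2 * max 0 (u - ln (real d))) = 2 * (moebius d / d * (ln (exp u) - ln (real d)))"
        by simp
    qed
    also have "\<dots> \<le> 14"
      unfolding sum_distrib_left[symmetric] using sum_moebius_ln_div_over[of "exp u"] u by simp
    finally show ?thesis .
  qed
  have "\<exists>z>0. z < ln X \<and> F (ln X) - F 0 = (ln X - 0) * F' z"
    using X dF by (intro MVT2) auto
  then obtain z where z: "0 < z" "z < ln X" "F (ln X) - F 0 = ln X * F' z" by auto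
  have "F 0 = 0" unfolding F_def q_def by (intro sum.neutral) auto
  moreover have "ln X * F' z \<le> ln X * 14" using z F'le[of z] X by (intro mult_left_mono) auto
  moreover have "F (ln X) = (\<Sum>d=1..N. moebius d / d * (ln X - ln (real d))\<^sup>2)"
    unfolding F_def q_def
  proof (rule sum.cong[OF refl])
    fix d assume d: "d \<in> {1..N}"
    have "real N \<le> X" using X by (simp add: N_def)
    then have "real d \<le> X" using d by simp
    then have "ln (real d) \<le> ln X" using d by auto
    then show "moebius d / d * (max 0 (ln X - ln (real d)))\<^sup>2 = moebius d / d * (ln X - ln (real d))\<^sup>2" by simp
  qed
  ultimately show ?thesis using z by (simp add: N_def)
qed

section \<open>The upper bound sieve for short intervals\<close>

lemma sum_inverse_sqrt_le: "(\<Sum>d=1..N. 1 / sqrt (real d)) \<le> 2 * sqrt (real N)"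
proof (induction N)
  case (Suc N)
  have s: "sqrt (real N) \<le> sqrt (real (Suc N))" by simp
  have "1 = (sqrt (real (Suc N)) - sqrt (real N)) * (sqrt (real (Suc N)) + sqrt (real N))"
    by (simp add: algebra_simps flip: power2_eq_square)
  also have "\<dots> \<le> (sqrt (real (Suc N)) - sqrt (real N)) * (2 * sqrt (real (Suc N)))"
    using s by (intro mult_left_mono) auto
  finally have "1 / sqrt (real (Suc N)) \<le> 2 * (sqrt (real (Suc N)) - sqrt (real N))"
    by (simp add: field_simps)
  then show ?case using Suc by simp
qed simp

lemma ln_square_le_sqrt:
  assumes "y \<ge> (1::real)"
  shows "(ln y)\<^sup>2 \<le> 16 * sqrt y"
proof -
  have "ln (sqrt (sqrt y)) \<le> sqrt (sqrt y)" using assms by (intro less_imp_le ln_bound) auto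
  then have "ln y \<le> 4 * sqrt (sqrt y)" using assms by (simp add: ln_sqrt)
  then have "(ln y)\<^sup>2 \<le> (4 * sqrt (sqrt y))\<^sup>2" using assms by (intro power_mono) auto
  also have "\<dots> = 16 * sqrt y" using assms by (simp add: power_mult_distrib)
  finally show ?thesis .
qed

text \<open>This is the total rounding error of the sieve. Trading the squared logarithm for a
  square root keeps it linear in \<open>X\<close>, without a factor
  \<open>(ln X)\<^sup>2\<close>.\<close>

lemma sum_ln_square_le:
  assumes "X \<ge> 1"
  shows "(\<Sum>d=1..nat \<lfloor>X\<rfloor>. (ln X - ln (real d))\<^sup>2) \<le> 32 * X"
proof -
  define N where "N = nat \<lfloor>X\<rfloor>"
  have N: "real N \<le> X" using assms by (auto simp: N_def)
  have "(\<Sum>d=1..N. (ln X - ln (real d))\<^sup>2) \<le> (\<Sum>d=1..N. 16 * sqrt X * (1 / sqrt (real d)))"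
  proof (rule sum_mono)
    fix d assume d: "d \<in> {1..N}"
    then have dX: "real d \<le> X" "d > 0" using N by auto
    have "ln X - ln (real d) = ln (X / d)" using assms dX by (simp add: ln_div)
    then show "(ln X - ln (real d))\<^sup>2 \<le> 16 * sqrt X * (1 / sqrt (real d))"
      using ln_square_le_sqrt[of "X / d"] dX by (simp add: real_sqrt_divide)
  qed
  also have "\<dots> = 16 * sqrt X * (\<Sum>d=1..N. 1 / sqrt (real d))" by (simp only: sum_distrib_left)
  also have "\<dots> \<le> 16 * sqrt X * (2 * sqrt X)"
    using assms N by (intro mult_left_mono order_trans[OF sum_inverse_sqrt_le]) auto
  also have "\<dots> = 32 * X" using assms by simp
  finally show ?thesis by (simp add: N_def)
qed

lemma card_multiples_le:
  fixes x X :: real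
  assumes "0 \<le> x" "x \<le> X" "d > 0"
  shows "\<bar>real (nat \<lfloor>X\<rfloor> div d) - real (nat \<lfloor>x\<rfloor> div d) - (X - x) / real d\<bar> \<le> 1"
proof -
  have *: "real (nat \<lfloor>y\<rfloor> div d) \<le> y / d \<and> y / d < real (nat \<lfloor>y\<rfloor> div d) + 1" if "y \<ge> 0" for y
  proof -
    have "int (nat \<lfloor>y\<rfloor> div d) = \<lfloor>y / real d\<rfloor>"
      using that floor_divide_real_eq_div[of "int d" y] by (simp add: zdiv_int)
    then have "real (nat \<lfloor>y\<rfloor> div d) = real_of_int (\<lfloor>y / real d\<rfloor>)"
      by (metis of_int_of_nat_eq)
    then show ?thesis by linarith
  qed
  show ?thesis using *[of x] *[of X] assms by (simp add: diff_divide_distrib abs_le_iff)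
qed

text \<open>The weight with \<open>L = ln X\<close> dominates \<open>(ln x)\<^sup>2\<close> on the
  primes of the interval and is nonnegative on its other elements. After exchanging summations, the
  density \<open>(X - x) / d\<close> of the multiples of \<open>d\<close> gives the first term on
  the right and the rounding gives the second. The bound is of the right order once
  \<open>X - x\<close> is at least of order \<open>X / ln X\<close>.\<close>

lemma brun_titchmarsh_count:
  fixes x X :: real
  assumes "1 \<le> x" "x \<le> X"
  shows "real (card {p. prime p \<and> x < real p \<and> real p \<le> X}) * (ln x)\<^sup>2 \<le> (X - x) * (14 * ln X) + 32 * X"
proof -
  define L where "L = ln X"
  define N where "N = nat \<lfloor>X\<rfloor>"
  define M where "M = nat \<lfloor>x\<rfloor>"
  let ?P = "{p. prime p \<and> x < real p \<and> real p \<le> X}"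
  have le: "M \<le> N" using assms by (auto simp: M_def N_def intro: nat_mono floor_mono)
  have P: "?P \<subseteq> {M<..N}"
    using assms by (auto simp: M_def N_def le_nat_iff le_floor_iff nat_less_iff floor_less_iff)
  have "real (card ?P) * (ln x)\<^sup>2 = (\<Sum>p\<in>?P. (ln x)\<^sup>2)" by simp
  also have "\<dots> \<le> (\<Sum>p\<in>?P. sieve_weight L p)"
  proof (rule sum_mono)
    fix p assume p: "p \<in> ?P"
    then have "(ln x)\<^sup>2 \<le> (ln (real p))\<^sup>2" using assms by (intro power_mono) auto
    also have "\<dots> \<le> sieve_weight L p"
      using p assms prime_gt_0_nat[of p] by (intro sieve_weight_prime_ge) (auto simp: L_def)
    finally show "(ln x)\<^sup>2 \<le> sieve_weight L p" .
  qed
  also have "\<dots> \<le> (\<Sum>n\<in>{M<..N}. sieve_weight L n)"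
  proof (rule sum_mono2)
    fix n assume n: "n \<in> {M<..N} - ?P"
    then have "0 < n" "real n \<le> X" using assms by (auto simp: N_def le_nat_iff le_floor_iff)
    then show "sieve_weight L n \<ge> 0" by (intro sieve_weight_nonneg) (auto simp: L_def)
  qed (use P in auto)
  also have "\<dots> = (\<Sum>n=1..N. sieve_weight L n) - (\<Sum>n=1..M. sieve_weight L n)"
  proof -
    have "{1..N} = {1..M} \<union> {M<..N}" using le by auto
    moreover have "(\<Sum>n\<in>{1..M} \<union> {M<..N}. sieve_weight L n) = (\<Sum>n=1..M. sieve_weight L n) + (\<Sum>n\<in>{M<..N}. sieve_weight L n)"
      by (rule sum.union_disjoint) auto
    ultimately show ?thesis by simp
  qed
  also have "(\<Sum>n=1..M. sieve_weight L n) = (\<Sum>d=1..N. real (M div d) * (moebius d * (L - ln (real d))\<^sup>2))"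
  proof -
    have "(\<Sum>n=1..M. sieve_weight L n) = (\<Sum>d=1..M. real (M div d) * (moebius d * (L - ln (real d))\<^sup>2))"
      unfolding sieve_weight_def sum_divisors_swap by simp
    \<comment> \<open>For \<open>d > M\<close> the quotient \<open>M div d\<close> is 0, so both
      sums can run up to \<open>N\<close> and be subtracted termwise.\<close>
    also have "\<dots> = (\<Sum>d=1..N. real (M div d) * (moebius d * (L - ln (real d))\<^sup>2))"
      using le by (intro sum.mono_neutral_left) auto
    finally show ?thesis .
  qed
  also have "(\<Sum>n=1..N. sieve_weight L n) = (\<Sum>d=1..N. real (N div d) * (moebius d * (L - ln (real d))\<^sup>2))"
    unfolding sieve_weight_def sum_divisors_swap by simp
  also have "(\<Sum>d=1..N. real (N div d) * (moebius d * (L - ln (real d))\<^sup>2)) - (\<Sum>d=1..N. real (M div d) * (moebius d * (L - ln (real d))\<^sup>2))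
     = (\<Sum>d=1..N. (real (N div d) - real (M div d)) * (moebius d * (L - ln (real d))\<^sup>2))"
    by (simp add: sum_subtractf algebra_simps)
  also have "\<dots> \<le> (\<Sum>d=1..N. (X - x) * (moebius d / d * (L - ln (real d))\<^sup>2) + (L - ln (real d))\<^sup>2)"
  proof (rule sum_mono)
    fix d assume d: "d \<in> {1..N}"
    define e where "e = real (N div d) - real (M div d) - (X - x) / real d"
    have "\<bar>e\<bar> \<le> 1" using card_multiples_le[of x X d] d assms by (simp add: e_def N_def M_def)
    then have "\<bar>e\<bar> * \<bar>moebius d\<bar> \<le> 1"
      using abs_moebius_le[of d] by (intro mult_le_one) auto
    then have "e * moebius d \<le> 1" by (simp flip: abs_mult)
    then have "e * moebius d * (L - ln (real d))\<^sup>2 \<le> 1 * (L - ln (real d))\<^sup>2"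
      by (intro mult_right_mono) auto
    moreover have "real (N div d) - real (M div d) = (X - x) / real d + e" by (simp add: e_def)
    ultimately show "(real (N div d) - real (M div d)) * (moebius d * (L - ln (real d))\<^sup>2)
      \<le> (X - x) * (moebius d / d * (L - ln (real d))\<^sup>2) + (L - ln (real d))\<^sup>2"
      by (simp add: algebra_simps)
  qed
  also have "\<dots> = (X - x) * (\<Sum>d=1..N. moebius d / d * (L - ln (real d))\<^sup>2) + (\<Sum>d=1..N. (L - ln (real d))\<^sup>2)"
    by (simp only: sum.distrib sum_distrib_left)
  also have "\<dots> \<le> (X - x) * (14 * ln X) + 32 * X"
    using assms sum_moebius_ln_square_div_over[of X] sum_ln_square_le[of X]
    unfolding L_def N_def by (intro add_mono mult_left_mono) auto
  finally show ?thesis .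
qed

lemma finite_primes_between: "finite {p::nat. prime p \<and> P p \<and> real p \<le> X}"
  by (rule finite_subset[of _ "{..nat \<lfloor>X\<rfloor>}"]) (auto simp: le_nat_iff le_floor_iff nat_le_real_less intro: le_nat_floor)

text \<open>With \<open>exp \<delta> - 1 \<le> 2 * \<delta>\<close> and
  \<open>w + \<delta> \<le> 2 * w\<close> the main term is \<open>56 * \<delta> * w\<close>. The
  lower bound on \<open>w\<close> makes the interval long enough for the rounding error 96 to be
  absorbed into the remaining \<open>4 * \<delta> * w\<close>. It is essential later that 60 does
  not depend on \<delta>.\<close>

lemma brun_titchmarsh:
  fixes \<delta> w :: real
  assumes "0 < \<delta>" "\<delta> \<le> 1" "w \<ge> 96 / \<delta>"
  shows "(\<Sum>p\<in>{p::nat. prime p \<and> exp w < real p \<and> real p \<le> exp (w + \<delta>)}. 1 / real p) \<le> 60 * \<delta> / w"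
proof -
  let ?P = "{p::nat. prime p \<and> exp w < real p \<and> real p \<le> exp (w + \<delta>)}"
  have "96 / \<delta> \<ge> 96" using assms by (simp add: field_simps)
  then have w: "w \<ge> 96" using assms by linarith
  have wd: "w * \<delta> \<ge> 96" using assms by (simp add: field_simps)
  have ed: "exp \<delta> \<le> 1 + 2 * \<delta>"
  proof -
    have "\<delta>\<^sup>2 \<le> \<delta>" using assms by (simp add: power2_eq_square mult_left_le)
    then show ?thesis using exp_bound[of \<delta>] assms by simp
  qed
  have "(\<Sum>p\<in>?P. 1 / real p) \<le> (\<Sum>p\<in>?P. 1 / exp w)"
    by (rule sum_mono) (auto intro!: divide_left_mono mult_pos_pos simp: prime_gt_0_nat)
  also have "\<dots> = real (card ?P) / exp w" by simp
  also have "\<dots> \<le> (2 * \<delta> * (14 * (2 * w)) + 96) / w\<^sup>2"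
  proof -
    have "real (card ?P) * w\<^sup>2 \<le> (exp (w + \<delta>) - exp w) * (14 * (w + \<delta>)) + 32 * exp (w + \<delta>)"
      using brun_titchmarsh_count[of "exp w" "exp (w + \<delta>)"] w assms by simp
    also have "\<dots> = exp w * ((exp \<delta> - 1) * (14 * (w + \<delta>)) + 32 * exp \<delta>)"
      by (simp add: exp_add algebra_simps)
    also have "\<dots> \<le> exp w * (2 * \<delta> * (14 * (2 * w)) + 32 * 3)"
      using ed assms w by (intro mult_left_mono add_mono mult_mono) auto
    finally show ?thesis using w by (simp add: field_simps)
  qed
  also have "\<dots> \<le> (60 * \<delta> * w) / w\<^sup>2"
    using w wd assms by (intro divide_right_mono) (auto simp: algebra_simps)
  also have "\<dots> = 60 * \<delta> / w" using w by (simp add: power2_eq_square)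
  finally show ?thesis .
qed

section \<open>Reciprocal sums of primes\<close>

text \<open>The sum is the exponent of \<open>p\<close> in \<open>fact n\<close>. Only multiples of
  \<open>p\<close> contribute, which gives \<open>n div p\<close> plus the same exponent for
  \<open>n div p\<close>; strong induction sums the geometric series.\<close>

lemma sum_multiplicity_le:
  fixes p :: nat
  assumes "prime p"
  shows "real (\<Sum>k=1..n. multiplicity p k) \<le> real n / (real p - 1)"
proof (induction n rule: less_induct)
  case (less n)
  have p: "p \<ge> 2" using assms prime_ge_2_nat by blast
  show ?case
  proof (cases "n = 0")
    case False
    have "(\<Sum>k=1..n. multiplicity p k) = (\<Sum>k\<in>(*) p ` {1..n div p}. multiplicity p k)"
    proof (rule sum.mono_neutral_right)
      show "(*) p ` {1..n div p} \<subseteq> {1..n}"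
        using p by (auto simp: less_eq_div_iff_mult_less_eq mult.commute)
      show "\<forall>k\<in>{1..n} - (*) p ` {1..n div p}. multiplicity p k = 0"
      proof
        fix k assume k: "k \<in> {1..n} - (*) p ` {1..n div p}"
        have "\<not> p dvd k"
        proof
          assume "p dvd k"
          then obtain m where "k = p * m" by auto
          then show False using k p by (auto simp: less_eq_div_iff_mult_less_eq mult.commute)
        qed
        then show "multiplicity p k = 0" by (rule not_dvd_imp_multiplicity_0)
      qed
    qed simp
    also have "\<dots> = (\<Sum>k=1..n div p. multiplicity p (p * k))"
      using p by (subst sum.reindex) (auto intro!: inj_onI)
    also have "\<dots> = (\<Sum>k=1..n div p. Suc (multiplicity p k))"
      using p assms by (intro sum.cong) (auto simp: multiplicity_times_same)
    also have "\<dots> = n div p + (\<Sum>k=1..n div p. multiplicity p k)" by (simp only: sum_Suc card_atLeastAtMost)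
    finally have "real (\<Sum>k=1..n. multiplicity p k) \<le> real (n div p) + real (n div p) / (real p - 1)"
      using less.IH[of "n div p"] False p by simp
    also have "\<dots> = real (n div p) * (real p / (real p - 1))" using p by (simp add: field_simps)
    also have "\<dots> \<le> real n / real p * (real p / (real p - 1))"
      using p nat_div_bounds[of p n] by (intro mult_right_mono) auto
    finally show ?thesis using p by simp
  qed simp
qed

lemma sum_multiplicity_ge:
  fixes p :: nat
  assumes "prime p"
  shows "n div p \<le> (\<Sum>k=1..n. multiplicity p k)"
proof -
  have p: "p \<ge> 2" using assms prime_ge_2_nat by blast
  have "n div p = (\<Sum>k\<in>(*) p ` {1..n div p}. 1)"
    using p by (subst sum.reindex) (auto intro!: inj_onI)
  also have "\<dots> \<le> (\<Sum>k\<in>(*) p ` {1..n div p}. multiplicity p k)"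
    using assms p by (intro sum_mono) (auto simp: Suc_le_eq prime_multiplicity_gt_zero_iff multiplicity_times_same)
  also have "\<dots> \<le> (\<Sum>k=1..n. multiplicity p k)"
    using p by (intro sum_mono2) (auto simp: less_eq_div_iff_mult_less_eq mult.commute)
  finally show ?thesis .
qed

lemma ln_fact_eq_sum_primes:
  "ln (fact n) = (\<Sum>p | prime p \<and> p \<le> n. real (\<Sum>k=1..n. multiplicity p k) * ln (real p))"
proof -
  have "ln (fact n :: real) = (\<Sum>k=1..n. ln (real k))"
    unfolding fact_prod of_nat_prod by (rule ln_prod) auto
  also have "\<dots> = (\<Sum>k=1..n. \<Sum>p | prime p \<and> p \<le> n. real (multiplicity p k) * ln (real p))"
  proof (rule sum.cong[OF refl])
    fix k assume k: "k \<in> {1..n}"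
    have "k = (\<Prod>p\<in>prime_factors k. p ^ multiplicity p k)"
      using k by (intro prime_factorization_nat) auto
    then have "real k = real (\<Prod>p\<in>prime_factors k. p ^ multiplicity p k)" by (rule arg_cong)
    then have "real k = (\<Prod>p\<in>prime_factors k. real p ^ multiplicity p k)"
      by (simp only: of_nat_prod of_nat_power)
    then have "ln (real k) = ln (\<Prod>p\<in>prime_factors k. real p ^ multiplicity p k)" by simp
    also have "\<dots> = (\<Sum>p\<in>prime_factors k. ln (real p ^ multiplicity p k))"
      by (rule ln_prod) (auto simp: prime_gt_0_nat in_prime_factors_iff)
    also have "\<dots> = (\<Sum>p\<in>prime_factors k. real (multiplicity p k) * ln (real p))"
      by (intro sum.cong) (auto simp: ln_realpow prime_gt_0_nat in_prime_factors_iff)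
    also have "\<dots> = (\<Sum>p | prime p \<and> p \<le> n. real (multiplicity p k) * ln (real p))"
    proof (rule sum.mono_neutral_left)
      show "prime_factors k \<subseteq> {p. prime p \<and> p \<le> n}"
        using k by (auto simp: in_prime_factors_iff dest!: dvd_imp_le)
      show "\<forall>p\<in>{p. prime p \<and> p \<le> n} - prime_factors k. real (multiplicity p k) * ln (real p) = 0"
        using k by (auto simp: in_prime_factors_iff not_dvd_imp_multiplicity_0)
    qed auto
    finally show "ln (real k) = (\<Sum>p | prime p \<and> p \<le> n. real (multiplicity p k) * ln (real p))" .
  qed
  also have "\<dots> = (\<Sum>p | prime p \<and> p \<le> n. \<Sum>k=1..n. real (multiplicity p k) * ln (real p))"
    by (rule sum.swap)
  finally show ?thesis by (simp add: sum_distrib_right)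
qed

lemma ln_fact_ge: "real n * ln (real n) - real n \<le> ln (fact n)"
proof (induction n)
  case (Suc n)
  have "real n * (ln (real (Suc n)) - ln (real n)) \<le> 1"
  proof (cases "n = 0")
    case False
    then have "ln (real (Suc n)) - ln (real n) \<le> 1 / n"
      using ln_diff_le[of "real (Suc n)" "real n"] by simp
    then show ?thesis using False by (simp add: field_simps)
  qed simp
  then show ?case using Suc by (simp add: ln_mult algebra_simps del: of_nat_Suc) (simp add: algebra_simps)
qed simp

text \<open>A Mertens estimate with a lossy constant: the exponent of \<open>p\<close> in
  \<open>fact n\<close> is at most \<open>2 * n / p\<close> because
  \<open>p - 1 \<ge> p / 2\<close>, and \<open>ln (fact n)\<close> is at least
  \<open>n * ln n - n\<close>.\<close>

lemma sum_primes_ln_div_ge: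
  assumes "n > 0"
  shows "(\<Sum>p | prime p \<and> p \<le> n. ln (real p) / real p) \<ge> (ln (real n) - 1) / 2"
proof -
  have "n * ln (real n) - n \<le> (\<Sum>p | prime p \<and> p \<le> n. real (\<Sum>k=1..n. multiplicity p k) * ln (real p))"
    using ln_fact_ge[of n] by (simp only: ln_fact_eq_sum_primes)
  also have "\<dots> \<le> (\<Sum>p | prime p \<and> p \<le> n. 2 * n * (ln (real p) / real p))"
  proof (rule sum_mono)
    fix p assume p: "p \<in> {p. prime p \<and> p \<le> n}"
    then have p2: "p \<ge> 2" using prime_ge_2_nat by blast
    have "real (\<Sum>k=1..n. multiplicity p k) * ln (real p) \<le> (real n / (real p - 1)) * ln (real p)"
      using p p2 by (intro mult_right_mono sum_multiplicity_le) auto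
    also have "\<dots> \<le> (real n / (real p / 2)) * ln (real p)"
      using p2 by (intro mult_right_mono divide_left_mono) auto
    finally show "real (\<Sum>k=1..n. multiplicity p k) * ln (real p) \<le> 2 * n * (ln (real p) / real p)"
      by (simp add: mult.commute mult.left_commute)
  qed
  also have "\<dots> = 2 * n * (\<Sum>p | prime p \<and> p \<le> n. ln (real p) / real p)" by (simp only: sum_distrib_left)
  finally have "real n * (ln (real n) - 1) \<le> real n * (2 * (\<Sum>p | prime p \<and> p \<le> n. ln (real p) / real p))"
    by (simp add: algebra_simps)
  then show ?thesis using assms by simp
qed

text \<open>The companion estimate: for \<open>p \<le> n\<close> the exponent is at least
  \<open>n div p\<close>, hence at least half of \<open>n / p\<close>, and
  \<open>fact n \<le> n ^ n\<close>.\<close>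

lemma sum_primes_ln_div_le:
  assumes "n > 0"
  shows "(\<Sum>p | prime p \<and> p \<le> n. ln (real p) / real p) \<le> 2 * ln (real n)"
proof -
  have "n / 2 * (\<Sum>p | prime p \<and> p \<le> n. ln (real p) / real p) = (\<Sum>p | prime p \<and> p \<le> n. n / 2 * (ln (real p) / real p))"
    by (rule sum_distrib_left)
  also have "\<dots> \<le> (\<Sum>p | prime p \<and> p \<le> n. real (\<Sum>k=1..n. multiplicity p k) * ln (real p))"
  proof (rule sum_mono)
    fix p assume p: "p \<in> {p. prime p \<and> p \<le> n}"
    then have p2: "p \<ge> 2" using prime_ge_2_nat by blast
    have "1 \<le> n div p" using p p2 by (auto simp: Suc_le_eq div_greater_zero_iff)
    then have "real n / p \<le> 2 * real (n div p)" using nat_div_bounds(2)[of p n] p2 by linarith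
    also have "\<dots> \<le> 2 * real (\<Sum>k=1..n. multiplicity p k)"
      using sum_multiplicity_ge[of p n] p by (simp del: of_nat_sum)
    finally have "real n / p / 2 * ln p \<le> real (\<Sum>k=1..n. multiplicity p k) * ln (real p)"
      using p2 by (intro mult_right_mono) auto
    then show "n / 2 * (ln (real p) / real p) \<le> real (\<Sum>k=1..n. multiplicity p k) * ln (real p)"
      by (simp add: mult.commute)
  qed
  also have "\<dots> = ln (fact n)" by (rule ln_fact_eq_sum_primes[symmetric])
  also have "\<dots> \<le> ln (real n ^ n)"
    using assms fact_le_power[of n, where 'a = real] by (subst ln_le_cancel_iff) auto
  also have "\<dots> = n * ln (real n)" using assms by (simp add: ln_realpow)
  finally have "real n * (\<Sum>p | prime p \<and> p \<le> n. ln (real p) / real p) \<le> real n * (2 * ln (real n))" by simp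
  then show ?thesis using assms by simp
qed

lemma le_nat_floor_iff: "x \<ge> 0 \<Longrightarrow> p \<le> nat \<lfloor>x\<rfloor> \<longleftrightarrow> real p \<le> x" for p :: nat and x :: real
  by (metis le_nat_floor of_nat_floor of_nat_mono order_trans)

lemma real_le_nat_floor_add_one: "x \<le> real (nat \<lfloor>x\<rfloor>) + 1"
  by linarith

text \<open>The two Mertens constants 1/2 and 2 differ by a factor 4, so the exponents at the ends
  of the block must have a ratio above 4. With ratio 8 the difference of the estimates is at least
  \<open>2 * w - 1 \<ge> w\<close>, and dividing by \<open>ln p \<le> 8 * w\<close> leaves
  1/8.\<close>

lemma sum_inverse_primes_block:
  assumes "w \<ge> 1"
  shows "(\<Sum>p\<in>{p::nat. prime p \<and> exp w < real p \<and> real p \<le> exp (8 * w)}. 1 / real p) \<ge> 1 / 8"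
proof -
  define m where "m = nat \<lfloor>exp w\<rfloor>"
  define n where "n = nat \<lfloor>exp (8 * w)\<rfloor>"
  let ?P = "{p::nat. prime p \<and> exp w < real p \<and> real p \<le> exp (8 * w)}"
  let ?S = "\<lambda>n::nat. {p. prime p \<and> p \<le> n}"
  let ?T = "\<lambda>n::nat. \<Sum>p | prime p \<and> p \<le> n. ln (real p) / real p"
  have e: "exp w \<ge> 2" using exp_ge_add_one_self[of w] assms by linarith
  have e8: "exp (8 * w) \<ge> 2" using exp_ge_add_one_self[of "8 * w"] assms by linarith
  have m: "m > 0" "real m \<le> exp w" using e assms by (auto simp: m_def)
  have n: "n > 0" "exp (8 * w) \<le> real n + 1"
    using e8 assms real_le_nat_floor_add_one by (auto simp: n_def)
  have P: "?P = ?S n - ?S m"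
    unfolding m_def n_def by (auto simp: le_nat_floor_iff not_le)
  have sub: "?S m \<subseteq> ?S n"
    using assms unfolding m_def n_def by (auto simp: le_nat_floor_iff elim!: order_trans)
  have lm: "ln (real m) \<le> w" using m by (metis ln_exp ln_le_cancel_iff exp_gt_zero of_nat_0_less_iff)
  have ln: "ln (real n) \<ge> 8 * w - 1"
  proof -
    have "exp (8 * w) \<le> 2 * real n" using n e8 by linarith
    also have "\<dots> \<le> exp 1 * real n" using exp_ge_add_one_self[of 1] by (intro mult_right_mono) auto
    finally have "exp (8 * w - 1) \<le> real n" by (simp add: exp_diff field_simps)
    then show ?thesis using n by (metis exp_gt_zero ln_exp ln_le_cancel_iff of_nat_0_less_iff)
  qed
  have "2 * w - 1 \<le> (ln (real n) - 1) / 2 - 2 * ln (real m)"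
    using lm ln by (simp add: field_simps)
  also have "\<dots> \<le> ?T n - ?T m"
    using sum_primes_ln_div_ge[OF n(1)] sum_primes_ln_div_le[OF m(1)] by (rule diff_mono)
  also have "\<dots> = (\<Sum>p\<in>?P. ln (real p) / real p)"
    unfolding P by (rule sum_diff[symmetric]) (use sub in simp_all)
  also have "\<dots> \<le> (\<Sum>p\<in>?P. 8 * w * (1 / real p))"
  proof (rule sum_mono)
    fix p assume p: "p \<in> ?P"
    then have "ln (real p) \<le> ln (exp (8 * w))" by (intro ln_mono) (auto simp: prime_gt_0_nat)
    then have "ln (real p) \<le> 8 * w" by simp
    then show "ln (real p) / real p \<le> 8 * w * (1 / real p)" by (simp add: divide_right_mono)
  qed
  also have "\<dots> = 8 * w * (\<Sum>p\<in>?P. 1 / real p)" by (simp only: sum_distrib_left)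
  finally have "2 * w - 1 \<le> w * (8 * (\<Sum>p\<in>?P. 1 / real p))" by (simp only: mult_ac)
  moreover have "w * 1 \<le> 2 * w - 1" using assms by simp
  ultimately have "w * 1 \<le> w * (8 * (\<Sum>p\<in>?P. 1 / real p))" by (meson order_trans)
  then have "1 \<le> 8 * (\<Sum>p\<in>?P. 1 / real p)"
    by (rule mult_left_le_imp_le) (use assms in linarith)
  then show ?thesis by (simp add: field_simps)
qed

section \<open>Prime dilations of mean values along \<Omega>\<close>

text \<open>The argument is real so that it can be dilated to \<open>x / p\<close>, and the sum is
  divided by \<open>x\<close> itself rather than by the number of its terms, which keeps the
  dilation identity below exact.\<close>

definition omega_mean :: "(nat \<Rightarrow> complex) \<Rightarrow> real \<Rightarrow> complex" where
  "omega_mean a x = (\<Sum>n=1..nat \<lfloor>x\<rfloor>. a (big_omega n)) / of_real x"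

lemma big_omega_prime_mult:
  assumes "prime p" "m > 0"
  shows "big_omega (p * m) = Suc (big_omega m)"
  using assms by (simp add: big_omega_def prime_factorization_mult prime_factorization_prime)

text \<open>Between \<open>x\<close> and \<open>y\<close> there are at most \<open>y - x + 1\<close>
  new terms, and the normalization changes by \<open>1 / x - 1 / y\<close>. Each effect contributes
  \<open>1 - x / y \<le> ln (y / x)\<close>; the extra integer accounts for
  \<open>1 / x\<close>.\<close>

lemma omega_mean_lipschitz:
  assumes a: "\<And>k. norm (a k) \<le> 1" and x: "0 < x" "x \<le> y"
  shows "norm (omega_mean a x - omega_mean a y) \<le> 2 * ln (y / x) + 1 / x"
proof -
  define M where "M = nat \<lfloor>x\<rfloor>"
  define N where "N = nat \<lfloor>y\<rfloor>"
  define f where "f = (\<lambda>n. a (big_omega n))"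
  have f: "norm (sum f A) \<le> card A" if "finite A" for A
    using sum_norm_bound[of A f 1] a by (simp add: f_def)
  have y: "y > 0" using x by simp
  have MN: "M \<le> N" "real M \<le> x" "x \<le> real M + 1" "real N \<le> y"
    using x y real_le_nat_floor_add_one[of x] by (auto simp: M_def N_def intro: nat_mono floor_mono)
  have "{1..N} = {1..M} \<union> {M<..N}" using MN by auto
  then have "sum f {1..N} = sum f ({1..M} \<union> {M<..N})" by (rule arg_cong)
  also have "\<dots> = sum f {1..M} + sum f {M<..N}" by (rule sum.union_disjoint) auto
  finally have "omega_mean a x - omega_mean a y =
      sum f {1..M} * of_real (1 / x - 1 / y) - sum f {M<..N} / of_real y"
    using x y unfolding omega_mean_def M_def N_def f_def
    by (simp add: field_simps)
  also have "norm \<dots> \<le> norm (sum f {1..M}) * \<bar>1 / x - 1 / y\<bar> + norm (sum f {M<..N}) / y"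
    using y by (intro order_trans[OF norm_triangle_ineq4] add_mono) 
       (simp_all only: norm_mult norm_divide norm_of_real abs_of_pos order_refl)
  also have "\<dots> \<le> x * (1 / x - 1 / y) + (y - x + 1) / y"
  proof (intro add_mono mult_mono divide_right_mono)
    show "norm (sum f {1..M}) \<le> x" using f[of "{1..M}"] MN by simp
    show "\<bar>1 / x - 1 / y\<bar> \<le> 1 / x - 1 / y" using x by (simp add: frac_le)
    show "norm (sum f {M<..N}) \<le> y - x + 1" using f[of "{M<..N}"] MN by (simp add: of_nat_diff)
  qed (use x in auto)
  also have "\<dots> = 2 * (1 - x / y) + 1 / y" using x y by (simp add: field_simps)
  also have "\<dots> \<le> 2 * ln (y / x) + 1 / x"
  proof (intro add_mono mult_left_mono)
    have "ln (x / y) \<le> x / y - 1" using x by (intro ln_le_minus_one) auto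
    moreover have "ln (x / y) = - ln (y / x)" using x y by (simp add: ln_div)
    ultimately show "1 - x / y \<le> ln (y / x)" by simp
    show "1 / y \<le> 1 / x" using x by (intro divide_left_mono) auto
  qed auto
  finally show ?thesis .
qed

section \<open>Almost orthogonality of divisibility by primes and the Bessel inequality\<close>

definition prime_centred :: "nat \<Rightarrow> nat \<Rightarrow> real" where
  "prime_centred p n = (if p dvd n then real p else 0) - 1"

text \<open>Multiples \<open>n = p * m\<close> up to \<open>x\<close> correspond to \<open>m\<close>
  up to \<open>x / p\<close>, and \<open>big_omega n = Suc (big_omega m)\<close> also when
  \<open>p\<close> divides \<open>m\<close>. The difference of means is therefore exactly a
  correlation with \<open>prime_centred p\<close>.\<close>

lemma omega_mean_prime_diff:
  assumes p: "prime p" and x: "x > 0"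
  shows "omega_mean (\<lambda>k. a (Suc k)) (x / real p) - omega_mean a x
     = (\<Sum>n=1..nat \<lfloor>x\<rfloor>. of_real (prime_centred p n) * a (big_omega n)) / of_real x"
proof -
  have p0: "p > 0" using p prime_gt_0_nat by blast
  define N where "N = nat \<lfloor>x\<rfloor>"
  have N': "nat \<lfloor>x / real p\<rfloor> = N div p"
    using x floor_divide_real_eq_div[of "int p" x] by (simp add: N_def nat_div_distrib)
  have "(\<Sum>n=1..N. of_real (prime_centred p n) * a (big_omega n)) =
     (\<Sum>n=1..N. (if p dvd n then of_nat p * a (big_omega n) else 0) - a (big_omega n))"
    by (intro sum.cong) (auto simp: prime_centred_def algebra_simps)
  also have "\<dots> = (\<Sum>n=1..N. if p dvd n then of_nat p * a (big_omega n) else 0) - (\<Sum>n=1..N. a (big_omega n))"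
    by (simp add: sum_subtractf)
  also have "(\<Sum>n=1..N. if p dvd n then of_nat p * a (big_omega n) else 0)
      = (\<Sum>n\<in>(*) p ` {1..N div p}. of_nat p * a (big_omega n))"
    using p0 by (intro sum.mono_neutral_cong_right)
      (auto simp: less_eq_div_iff_mult_less_eq mult.commute elim!: dvdE)
  also have "\<dots> = (\<Sum>m=1..N div p. of_nat p * a (Suc (big_omega m)))"
    using p0 by (subst sum.reindex) (auto intro!: inj_onI sum.cong simp: big_omega_prime_mult[OF p])
  finally have "(\<Sum>n=1..N. of_real (prime_centred p n) * a (big_omega n)) / of_real x =
     (\<Sum>m=1..N div p. of_nat p * a (Suc (big_omega m))) / of_real x - (\<Sum>n=1..N. a (big_omega n)) / of_real x"
    by (simp add: diff_divide_distrib)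
  then show ?thesis
    using p0 x unfolding omega_mean_def N' by (simp add: N_def field_simps sum_distrib_left)
qed

lemma sum_dvd_eq: 
  fixes d N :: nat
  assumes "d > 0"
  shows "(\<Sum>n=1..N. if d dvd n then c else 0) = of_nat (N div d) * (c::real)"
proof -
  have "(\<Sum>n=1..N. if d dvd n then c else 0) = (\<Sum>n\<in>(*) d ` {1..N div d}. c)"
    using assms by (intro sum.mono_neutral_cong_right)
      (auto simp: less_eq_div_iff_mult_less_eq mult.commute elim!: dvdE)
  also have "\<dots> = (\<Sum>n=1..N div d. c)"
    using assms by (subst sum.reindex) (auto intro!: inj_onI)
  finally show ?thesis by simp
qed

lemma real_div_bounds:
  fixes d N :: nat
  assumes "d > 0"
  shows "real d * real (N div d) \<le> real N" "real N \<le> real d * real (N div d) + real d"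
  using nat_div_bounds[OF assms, of N] assms by (simp_all add: field_simps)

lemma prime_centred_correlation_diag:
  assumes p: "prime p"
  shows "\<bar>\<Sum>n=1..N. prime_centred p n * prime_centred p n\<bar> \<le> real p * real N"
proof -
  have p2: "p \<ge> 2" using p prime_ge_2_nat by blast
  have "(\<Sum>n=1..N. prime_centred p n * prime_centred p n) =
     (\<Sum>n=1..N. (if p dvd n then real p * real p - 2 * real p else 0) + 1)"
    by (intro sum.cong) (auto simp: prime_centred_def algebra_simps)
  also have "\<dots> = real (N div p) * (real p * real p - 2 * real p) + real N"
    using p2 by (simp add: sum.distrib sum_dvd_eq del: One_nat_def)
  also have "\<dots> = (real p * real (N div p)) * (real p - 2) + real N" by (simp add: algebra_simps)
  finally have eq: "(\<Sum>n=1..N. prime_centred p n * prime_centred p n) = \<dots>" .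
  have "(real p * real (N div p)) * (real p - 2) \<le> real N * (real p - 2)"
    using real_div_bounds[of p N] p2 by (intro mult_right_mono) auto
  also have "\<dots> + real N \<le> real p * real N" by (simp add: algebra_simps)
  finally have "(real p * real (N div p)) * (real p - 2) + real N \<le> real p * real N" by simp
  moreover have "0 \<le> (real p * real (N div p)) * (real p - 2) + real N"
    using p2 by (intro add_nonneg_nonneg mult_nonneg_nonneg) auto
  ultimately show ?thesis unfolding eq by simp
qed

text \<open>Divisibility by \<open>p\<close> and by \<open>q\<close> is independent up to rounding:
  the four main terms \<open>N\<close> cancel, and the remainders are bounded in terms of
  \<open>p\<close> and \<open>q\<close> alone, uniformly in \<open>N\<close>.\<close>

lemma prime_centred_correlation:
  assumes p: "prime p" and q: "prime q" and "p \<noteq> q"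
  shows "\<bar>\<Sum>n=1..N. prime_centred p n * prime_centred q n\<bar> \<le> 3 * (real p * real q)"
proof -
  have p2: "p \<ge> 2" "q \<ge> 2" using p q prime_ge_2_nat by auto
  have "p dvd n \<and> q dvd n \<longleftrightarrow> p * q dvd n" for n
    using assms primes_coprime[of p q] divides_mult[of p n q] by (auto dest: dvd_mult_left dvd_mult_right)
  then have "(\<Sum>n=1..N. prime_centred p n * prime_centred q n) =
     (\<Sum>n=1..N. (if p * q dvd n then real p * real q else 0) - (if p dvd n then real p else 0)
        - (if q dvd n then real q else 0) + 1)"
    by (intro sum.cong) (auto simp: prime_centred_def algebra_simps)
  also have "\<dots> = real (p * q) * real (N div (p * q)) - real p * real (N div p) - real q * real (N div q) + real N"
    using p2 by (simp add: sum.distrib sum_subtractf sum_dvd_eq del: One_nat_def)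
  finally have eq: "(\<Sum>n=1..N. prime_centred p n * prime_centred q n) = \<dots>" .
  have "real p \<le> real p * real q" "real q \<le> real p * real q"
    using p2 by auto
  moreover have "p * q > 0" using p2 by simp
  note real_div_bounds[OF this, of N, unfolded of_nat_mult]
  ultimately show ?thesis
    using real_div_bounds[of p N] real_div_bounds[of q N] p2
    unfolding eq abs_le_iff of_nat_mult by (intro conjI) linarith+
qed

lemma abs_prime_centred_le: "prime p \<Longrightarrow> \<bar>prime_centred p n\<bar> \<le> real p"
  using prime_ge_2_nat[of p] by (auto simp: prime_centred_def)

text \<open>A duality argument. Let \<open>S\<close> be the weighted sum of squared differences
  \<open>G p\<close>. Then \<open>x * S\<close> is the correlation of \<open>g\<close> with the
  combination \<open>V\<close> of the \<open>prime_centred p\<close> with coefficients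
  \<open>cnj (G p) / p\<close>, while almost orthogonality bounds the square sum of \<open>V\<close>
  by \<open>x * (S + 1)\<close>. This gives \<open>S \<le> (S + 1) / 4 + 1\<close>. The threshold
  for \<open>x\<close> depends on \<open>A\<close> only, not on \<open>a\<close>.\<close>

lemma omega_mean_prime_bessel:
  assumes A: "finite A" "\<And>p. p \<in> A \<Longrightarrow> prime p"
  obtains X where "\<And>x a. x \<ge> X \<Longrightarrow> (\<And>k. norm (a k) \<le> 1) \<Longrightarrow>
    (\<Sum>p\<in>A. 1 / real p * (norm (omega_mean a x - omega_mean (\<lambda>k. a (Suc k)) (x / real p)))\<^sup>2) \<le> 4"
proof
  define B where "B = (\<Sum>p\<in>A. real p)"
  fix x :: real and a :: "nat \<Rightarrow> complex"
  \<comment> \<open>The trivial bound \<open>norm (G p) \<le> p\<close> makes all off-diagonal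
    correlations together at most \<open>3 * B\<^sup>2\<close>, which this threshold keeps below
    \<open>x\<close>.\<close>
  assume x: "x \<ge> max 1 (3 * B\<^sup>2)" and a: "\<And>k. norm (a k) \<le> 1"
  define N where "N = nat \<lfloor>x\<rfloor>"
  define g where "g = (\<lambda>n. a (big_omega n))"
  define G where "G = (\<lambda>p. (\<Sum>n=1..N. of_real (prime_centred p n) * g n) / of_real x)"
  define S where "S = (\<Sum>p\<in>A. 1 / real p * (norm (G p))\<^sup>2)"
  define V where "V = (\<lambda>n. \<Sum>p\<in>A. cnj (G p) / of_nat p * of_real (prime_centred p n))"
  have x0: "x > 0" "x \<ge> 1" using x by auto
  have N: "real N \<le> x" using x0 by (simp add: N_def)
  have A0: "p > 0" if "p \<in> A" for p using A(2)[OF that] prime_gt_0_nat by blast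
  have G: "norm (omega_mean a x - omega_mean (\<lambda>k. a (Suc k)) (x / real p)) = norm (G p)" if "p \<in> A" for p
    using omega_mean_prime_diff[OF A(2)[OF that] x0(1), of a] by (subst norm_minus_commute) (simp add: G_def N_def g_def)
  have Gle: "norm (G p) \<le> real p" if "p \<in> A" for p
  proof -
    have "norm (\<Sum>n=1..N. of_real (prime_centred p n) * g n) \<le> (\<Sum>n=1..N. real p)"
    proof (rule order_trans[OF norm_sum], rule sum_mono)
      fix n
      have "\<bar>prime_centred p n\<bar> * norm (g n) \<le> real p * 1"
        using abs_prime_centred_le[OF A(2)[OF that]] a by (intro mult_mono) (auto simp: g_def)
      then show "norm (of_real (prime_centred p n) * g n) \<le> real p" by (simp add: norm_mult)
    qed
    also have "\<dots> \<le> real p * x" using N by (simp add: mult.commute mult_right_mono)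
    finally show ?thesis using x0 by (simp add: G_def norm_divide field_simps)
  qed
  have S1: "of_real S = (\<Sum>n=1..N. g n * V n) / of_real x"
  proof -
    have "(\<Sum>n=1..N. g n * V n) = (\<Sum>p\<in>A. \<Sum>n=1..N. cnj (G p) / of_nat p * (of_real (prime_centred p n) * g n))"
      unfolding V_def sum_distrib_left by (subst sum.swap) (simp add: mult_ac)
    also have "\<dots> = (\<Sum>p\<in>A. cnj (G p) / of_nat p * (\<Sum>n=1..N. of_real (prime_centred p n) * g n))"
      by (simp only: sum_distrib_left)
    also have "\<dots> = (\<Sum>p\<in>A. cnj (G p) / of_nat p * (of_real x * G p))"
      using x0 by (simp add: G_def)
    also have "\<dots> = (\<Sum>p\<in>A. of_real x * of_real (1 / real p * (norm (G p))\<^sup>2))"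
    proof (rule sum.cong[OF refl])
      fix p
      have "cnj (G p) * G p = of_real ((norm (G p))\<^sup>2)"
        by (simp only: complex_norm_square mult.commute)
      then show "cnj (G p) / of_nat p * (of_real x * G p) = of_real x * of_real (1 / real p * (norm (G p))\<^sup>2)"
        by (simp add: field_simps)
    qed
    also have "\<dots> = of_real x * of_real S"
      by (simp only: S_def sum_distrib_left of_real_sum)
    finally show ?thesis using x0 by simp
  qed
  have S2: "(\<Sum>n=1..N. (norm (V n))\<^sup>2) \<le> x * (S + 1)"
  proof -
    let ?c = "\<lambda>p. cnj (G p) / of_nat p"
    let ?R = "\<lambda>p q. \<Sum>n=1..N. prime_centred p n * prime_centred q n"
    have "of_real (\<Sum>n=1..N. (norm (V n))\<^sup>2) = (\<Sum>n=1..N. V n * cnj (V n))"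
      by (simp only: of_real_sum complex_norm_square)
    also have "\<dots> = (\<Sum>n=1..N. \<Sum>p\<in>A. \<Sum>q\<in>A. (?c p * cnj (?c q)) * of_real (prime_centred p n * prime_centred q n))"
      unfolding V_def cnj_sum sum_product by (intro sum.cong refl) simp
    also have "\<dots> = (\<Sum>p\<in>A. \<Sum>n=1..N. \<Sum>q\<in>A. (?c p * cnj (?c q)) * of_real (prime_centred p n * prime_centred q n))"
      by (rule sum.swap)
    also have "\<dots> = (\<Sum>p\<in>A. \<Sum>q\<in>A. \<Sum>n=1..N. (?c p * cnj (?c q)) * of_real (prime_centred p n * prime_centred q n))"
      by (intro sum.cong refl sum.swap)
    also have "\<dots> = (\<Sum>p\<in>A. \<Sum>q\<in>A. (?c p * cnj (?c q)) * of_real (?R p q))"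
      by (simp only: sum_distrib_left of_real_sum)
    finally have *: "complex_of_real (\<Sum>n=1..N. (norm (V n))\<^sup>2) = (\<Sum>p\<in>A. \<Sum>q\<in>A. (?c p * cnj (?c q)) * of_real (?R p q))" .
    have "(\<Sum>n=1..N. (norm (V n))\<^sup>2) = norm (complex_of_real (\<Sum>n=1..N. (norm (V n))\<^sup>2))"
      unfolding norm_of_real by (rule abs_of_nonneg[symmetric]) (simp add: sum_nonneg)
    also have "\<dots> = norm (\<Sum>p\<in>A. \<Sum>q\<in>A. (?c p * cnj (?c q)) * of_real (?R p q))"
      by (simp only: *)
    also have "\<dots> \<le> (\<Sum>p\<in>A. \<Sum>q\<in>A. norm (?c p) * norm (?c q) * \<bar>?R p q\<bar>)"
      by (intro order_trans[OF norm_sum] sum_mono) (simp only: norm_mult complex_mod_cnj norm_of_real order_refl)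
    also have "\<dots> \<le> (\<Sum>p\<in>A. \<Sum>q\<in>A. (if q = p then 1 / real p * (norm (G p))\<^sup>2 * x else 0) + 3 * (real p * real q))"
    proof (intro sum_mono)
      fix p q assume pq: "p \<in> A" "q \<in> A"
      show "norm (?c p) * norm (?c q) * \<bar>?R p q\<bar>
        \<le> (if q = p then 1 / real p * (norm (G p))\<^sup>2 * x else 0) + 3 * (real p * real q)"
      proof (cases "q = p")
        case True
        have "norm (?c p) * norm (?c p) * \<bar>?R p p\<bar> \<le> norm (?c p) * norm (?c p) * (real p * x)"
          using prime_centred_correlation_diag[OF A(2)[OF pq(1)], of N] N
          by (intro mult_left_mono order_trans[OF prime_centred_correlation_diag[OF A(2)[OF pq(1)]]]) auto
        also have "\<dots> = 1 / real p * (norm (G p))\<^sup>2 * x"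
          using A0[OF pq(1)] by (simp add: norm_divide power2_eq_square)
        finally have "norm (?c p) * norm (?c p) * \<bar>?R p p\<bar> \<le> 1 / real p * (norm (G p))\<^sup>2 * x" .
        then have "norm (?c p) * norm (?c p) * \<bar>?R p p\<bar> \<le> 1 / real p * (norm (G p))\<^sup>2 * x + 3 * (real p * real p)"
          by (rule add_increasing2[rotated]) simp
        then show ?thesis unfolding True by (simp only: if_True simp_thms)
      next
        case False
        have "norm (?c p) * norm (?c q) * \<bar>?R p q\<bar> \<le> norm (?c p) * norm (?c q) * (3 * (real p * real q))"
          using prime_centred_correlation[OF A(2)[OF pq(1)] A(2)[OF pq(2)]] False
          by (intro mult_left_mono) auto
        also have "\<dots> = 3 * (norm (G p) * norm (G q))"
          using A0[OF pq(1)] A0[OF pq(2)] by (simp add: norm_divide)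
        also have "\<dots> \<le> 3 * (real p * real q)"
          using Gle pq by (intro mult_left_mono mult_mono) auto
        finally show ?thesis using False by simp
      qed
    qed
    also have "\<dots> = S * x + 3 * B\<^sup>2"
    proof -
      have B2: "B\<^sup>2 = (\<Sum>p\<in>A. \<Sum>q\<in>A. real p * real q)"
        by (simp only: B_def power2_eq_square sum_product)
      show ?thesis
        using A(1) by (simp add: sum.distrib S_def B2 sum_distrib_left sum_distrib_right)
    qed
    also have "\<dots> \<le> x * (S + 1)" using x by (simp add: algebra_simps)
    finally show ?thesis .
  qed
  have "S \<ge> 0" unfolding S_def by (intro sum_nonneg) auto
  then have "S = norm (complex_of_real S)" by simp
  also have "\<dots> \<le> (\<Sum>n=1..N. norm (g n * V n)) / x"
    unfolding S1 using x0 by (simp add: norm_divide divide_right_mono norm_sum)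
  \<comment> \<open>Instead of Cauchy-Schwarz, \<open>v \<le> v\<^sup>2 / 4 + 1\<close>, so that
    \<open>S\<close> enters linearly with coefficient 1/4 and can be moved to the left.\<close>
  also have "(\<Sum>n=1..N. norm (g n * V n)) \<le> (\<Sum>n=1..N. (norm (V n))\<^sup>2 / 4 + 1)"
  proof (rule sum_mono)
    fix n
    have "norm (g n) * norm (V n) \<le> 1 * norm (V n)"
      using a by (intro mult_right_mono) (auto simp: g_def)
    moreover have "0 \<le> (norm (V n) / 2 - 1)\<^sup>2" by simp
    ultimately show "norm (g n * V n) \<le> (norm (V n))\<^sup>2 / 4 + 1"
      by (simp add: norm_mult power2_eq_square algebra_simps)
  qed
  also have "\<dots> = (\<Sum>n=1..N. (norm (V n))\<^sup>2) / 4 + real N" by (simp add: sum.distrib sum_divide_distrib)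
  also have "\<dots> \<le> x * (S + 1) / 4 + x" using S2 N by simp
  finally have "S \<le> (x * (S + 1) / 4 + x) / x" using x0 by (simp add: divide_right_mono)
  also have "\<dots> = (S + 1) / 4 + 1" using x0 by (simp add: field_simps)
  finally have "S \<le> 4" by (simp add: field_simps)
  then show "(\<Sum>p\<in>A. 1 / real p * (norm (omega_mean a x - omega_mean (\<lambda>k. a (Suc k)) (x / real p)))\<^sup>2) \<le> 4"
    using G by (simp add: S_def)
qed

section \<open>Almost-periods in the number of prime factors\<close>

text \<open>The blocks at \<open>8 ^ t * w\<close> are adjacent on the logarithmic scale, and each
  carries reciprocal mass at least 1/8.\<close>

definition prime_block :: "real \<Rightarrow> nat set" where
  "prime_block w = {p. prime p \<and> exp w < real p \<and> real p \<le> exp (8 * w)}"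

lemma finite_prime_block: "finite (prime_block w)"
  unfolding prime_block_def using finite_primes_between[of "\<lambda>p. exp w < real p"] by simp

lemma prime_block_disjoint:
  assumes "s \<noteq> t" "w > 0"
  shows "prime_block (8 ^ s * w) \<inter> prime_block (8 ^ t * w) = {}"
proof -
  have *: "prime_block (8 ^ s * w) \<inter> prime_block (8 ^ t * w) = {}" if "s < t" for s t
  proof -
    have "(8::real) ^ Suc s \<le> 8 ^ t" using that by (intro power_increasing) auto
    then have "8 * (8 ^ s * w) \<le> 8 ^ t * w" using assms by simp
    then show ?thesis
      unfolding prime_block_def by (auto simp del: exp_le_cancel_iff) (meson exp_le_cancel_iff leD le_less_trans order_trans)
  qed
  show ?thesis using assms(1) *[of s t] *[of t s] by (cases "s < t") (auto simp: Int_commute)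
qed

lemma sum_inverse_prime_block: "w \<ge> 1 \<Longrightarrow> (\<Sum>p\<in>prime_block w. 1 / real p) \<ge> 1 / 8"
  unfolding prime_block_def by (rule sum_inverse_primes_block)

lemma sum_inverse_primes_unbounded:
  obtains A :: "nat set" where "finite A" "\<And>p. p \<in> A \<Longrightarrow> prime p" "(\<Sum>p\<in>A. 1 / real p) > C"
proof -
  obtain r :: nat where r: "real r > 8 * C" using reals_Archimedean2 by blast
  let ?A = "\<Union>t<r. prime_block (8 ^ t * 1)"
  have "(\<Sum>p\<in>?A. 1 / real p) = (\<Sum>t<r. \<Sum>p\<in>prime_block (8 ^ t * 1). 1 / real p)"
    by (intro sum.UNION_disjoint) (auto simp: finite_prime_block prime_block_disjoint[where w = 1, simplified])
  also have "\<dots> \<ge> (\<Sum>t<r. 1 / 8)" by (intro sum_mono sum_inverse_prime_block) auto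
  finally have "(\<Sum>p\<in>?A. 1 / real p) > C" using r by simp
  then show ?thesis using that[of ?A] by (auto simp: finite_prime_block) (auto simp: prime_block_def)
qed

text \<open>Abstractly, \<open>F s x\<close> plays the role of the mean over \<open>n \<le> x\<close> of \<open>a (\<Omega>(n) + s)\<close>.\<close>

locale prime_averages =
  fixes F :: "nat \<Rightarrow> real \<Rightarrow> complex"
  assumes lipschitz: "\<And>s x y. 0 < x \<Longrightarrow> x \<le> y \<Longrightarrow> norm (F s x - F s y) \<le> 2 * ln (y / x) + 1 / x"
    and bessel: "\<And>A. finite A \<Longrightarrow> (\<And>p. p \<in> A \<Longrightarrow> prime p) \<Longrightarrow>
      \<exists>X. \<forall>x\<ge>X. \<forall>s. (\<Sum>p\<in>A. 1 / real p * (norm (F s x - F (Suc s) (x / real p)))\<^sup>2) \<le> 4"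
begin

text \<open>If every \<open>p\<close> of \<open>A\<close> failed at some shift
  \<open>s \<le> S\<close>, the Bessel sums added over these shifts would be at least
  \<open>e\<^sup>2\<close> times the reciprocal sum of \<open>A\<close>, exceeding
  \<open>4 * Suc S\<close>. The prime depends on \<open>x\<close>, but its bound \<open>M\<close>
  does not, and one prime serves all \<open>s \<le> S\<close>.\<close>

lemma good_prime:
  assumes "e > 0"
  shows "\<exists>M X. \<forall>x\<ge>X. \<exists>p\<in>{1..M}. \<forall>s\<le>S. norm (F s x - F (Suc s) (x / real p)) \<le> e"
proof -
  obtain A :: "nat set" where A: "finite A" "\<And>p. p \<in> A \<Longrightarrow> prime p" "(\<Sum>p\<in>A. 1 / real p) > 4 * real (Suc S) / e\<^sup>2"
    using sum_inverse_primes_unbounded[of "4 * real (Suc S) / e\<^sup>2"] by blast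
  obtain X where X: "\<And>x s. x \<ge> X \<Longrightarrow> (\<Sum>p\<in>A. 1 / real p * (norm (F s x - F (Suc s) (x / real p)))\<^sup>2) \<le> 4"
    using bessel[OF A(1,2)] by blast
  have "\<exists>p\<in>{1..Max A}. \<forall>s\<le>S. norm (F s x - F (Suc s) (x / real p)) \<le> e" if x: "x \<ge> X" for x
  proof (rule ccontr)
    assume neg: "\<not> ?thesis"
    have "e\<^sup>2 * (\<Sum>p\<in>A. 1 / real p) = (\<Sum>p\<in>A. e\<^sup>2 * (1 / real p))" by (rule sum_distrib_left)
    also have "\<dots> \<le> (\<Sum>p\<in>A. \<Sum>s\<le>S. 1 / real p * (norm (F s x - F (Suc s) (x / real p)))\<^sup>2)"
    proof (rule sum_mono)
      fix p assume p: "p \<in> A"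
      then have "p \<in> {1..Max A}" using A(1) A(2)[OF p] prime_gt_0_nat[of p] by auto
      then obtain s where s: "s \<le> S" "norm (F s x - F (Suc s) (x / real p)) > e"
        using neg by (meson not_le)
      have "e\<^sup>2 * (1 / real p) \<le> 1 / real p * (norm (F s x - F (Suc s) (x / real p)))\<^sup>2"
        using s assms by (simp add: divide_right_mono power_mono)
      also have "\<dots> \<le> (\<Sum>s\<le>S. 1 / real p * (norm (F s x - F (Suc s) (x / real p)))\<^sup>2)"
        using s by (intro member_le_sum[of s "{..S}"]) auto
      finally show "e\<^sup>2 * (1 / real p) \<le> \<dots>" .
    qed
    also have "\<dots> = (\<Sum>s\<le>S. \<Sum>p\<in>A. 1 / real p * (norm (F s x - F (Suc s) (x / real p)))\<^sup>2)"
      by (rule sum.swap)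
    also have "\<dots> \<le> (\<Sum>s\<le>S. 4)" by (intro sum_mono X x)
    also have "\<dots> = 4 * real (Suc S)" by simp
    finally show False using A(3) assms by (simp add: field_simps)
  qed
  then show ?thesis by blast
qed

text \<open>The prime is chosen first, at \<open>x\<close>, and the product for \<open>i\<close>
  afterwards, at \<open>x / p\<close> and for shifts starting from \<open>Suc s\<close>; hence the
  induction over all \<open>S\<close>. The threshold keeps \<open>x / p\<close> large for every
  admissible \<open>p\<close>.\<close>

lemma good_product:
  assumes "e > 0"
  shows "\<exists>M X. \<forall>x\<ge>X. \<exists>m\<in>{1..M}. \<forall>s\<le>S. norm (F s x - F (s + i) (x / real m)) \<le> e"
  using assms
proof (induction i arbitrary: e S)
  case 0
  then show ?case by (intro exI[of _ 1] exI[of _ 0]) auto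
next
  case (Suc i)
  obtain M1 X1 where 1: "\<And>x. x \<ge> X1 \<Longrightarrow> \<exists>p\<in>{1..M1}. \<forall>s\<le>S. norm (F s x - F (Suc s) (x / real p)) \<le> e / 2"
    using good_prime[of "e / 2" S] Suc.prems by auto
  obtain M2 X2 where 2: "\<And>x. x \<ge> X2 \<Longrightarrow> \<exists>m\<in>{1..M2}. \<forall>s\<le>Suc S. norm (F s x - F (s + i) (x / real m)) \<le> e / 2"
    using Suc.IH[of "e / 2" "Suc S"] Suc.prems by auto
  have "\<exists>m\<in>{1..M1 * M2}. \<forall>s\<le>S. norm (F s x - F (s + Suc i) (x / real m)) \<le> e"
    if x: "x \<ge> max X1 (\<bar>X2\<bar> * real M1)" for x
  proof -
    obtain p where p: "p \<in> {1..M1}" "\<And>s. s \<le> S \<Longrightarrow> norm (F s x - F (Suc s) (x / real p)) \<le> e / 2"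
      using 1[of x] x by auto
    have "X2 * real p \<le> \<bar>X2\<bar> * real M1" using p by (intro mult_mono) auto
    then have "X2 \<le> x / real p" using p x by (simp add: field_simps)
    then obtain m where m: "m \<in> {1..M2}" 
      "\<And>s. s \<le> Suc S \<Longrightarrow> norm (F s (x / real p) - F (s + i) (x / real p / real m)) \<le> e / 2"
      using 2 by blast
    have "p * m \<in> {1..M1 * M2}" using p m by (auto intro: mult_le_mono)
    moreover have "norm (F s x - F (s + Suc i) (x / real (p * m))) \<le> e" if "s \<le> S" for s
      using norm_triangle_mono[OF p(2)[OF that] m(2)[of "Suc s"]] that by simp
    ultimately show ?thesis by blast
  qed
  then show ?case by blast
qed

lemma good_products:
  assumes "e > 0"
  shows "\<exists>M>0. \<exists>X. \<forall>i\<le>K. \<forall>x\<ge>X. \<exists>m\<in>{1..M::nat}. \<forall>s\<le>S. norm (F s x - F (s + i) (x / real m)) \<le> e"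
proof -
  obtain M X where MX: "\<And>i x. x \<ge> X i \<Longrightarrow> \<exists>m\<in>{1..M i::nat}. \<forall>s\<le>S. norm (F s x - F (s + i) (x / real m)) \<le> e"
    using good_product[OF assms, of S] by metis
  have "\<exists>m\<in>{1..Max (M ` {..K})}. \<forall>s\<le>S. norm (F s x - F (s + i) (x / real m)) \<le> e"
    if "i \<le> K" "x \<ge> Max (X ` {..K})" for i x
  proof -
    have "X i \<le> x" using that by (intro order_trans[OF Max_ge that(2)]) auto
    then obtain m where "m \<in> {1..M i}" "\<forall>s\<le>S. norm (F s x - F (s + i) (x / real m)) \<le> e" using MX by blast
    moreover have "M i \<le> Max (M ` {..K})" using that by (intro Max_ge) auto
    ultimately show ?thesis by (intro bexI[of _ m]) auto
  qed
  moreover have "Max (M ` {..K}) > 0"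
  proof -
    have "M 0 \<ge> 1" using MX[of 0 "X 0"] by force
    moreover have "M 0 \<le> Max (M ` {..K})" by (intro Max_ge) auto
    ultimately show ?thesis by linarith
  qed
  ultimately show ?thesis by blast
qed

end

text \<open>Cells are intervals of length \<delta> for \<open>L + ln p\<close>, where
  \<open>L\<close> will be the logarithm of the small factor. In terms of \<open>ln p\<close> the
  cell starts at \<open>w > V - \<delta>\<close>; the summand 1 in the bound for \<open>V\<close>
  pays for this \<delta>, and \<open>w \<ge> V / 2\<close> turns 60 into 120.\<close>

lemma cell_mass:
  fixes \<delta> V L c :: real
  assumes "0 < \<delta>" "\<delta> \<le> 1" "V \<ge> 96 / \<delta> + 1"
    and P: "\<And>p. p \<in> P \<Longrightarrow> prime p \<and> exp V < real p \<and> c - \<delta> < L + ln (real p) \<and> L + ln (real p) \<le> c"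
  shows "(\<Sum>p\<in>P. 1 / real p) \<le> 120 * \<delta> / V"
proof (cases "P = {}")
  case True
  have "96 / \<delta> > 0" using assms(1) by simp
  then have "V > 0" using assms(3) by linarith
  then show ?thesis using True assms(1) by simp
next
  case False
  then obtain p0 where p0: "p0 \<in> P" by blast
  define w where "w = c - \<delta> - L"
  have "V < ln (real p0)" using P[OF p0] by (metis exp_gt_zero exp_less_cancel_iff exp_ln less_trans)
  then have wV: "w > V - \<delta>" using P[OF p0] by (simp add: w_def)
  have "96 / \<delta> \<ge> 96" using assms(1,2) by (simp add: field_simps)
  then have V: "V \<ge> 96" "w \<ge> V / 2" using assms wV by auto
  have sub: "P \<subseteq> {p::nat. prime p \<and> exp w < real p \<and> real p \<le> exp (w + \<delta>)}"
  proof
    fix p assume p: "p \<in> P"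
    then have "real p > 0" using P[OF p] prime_gt_0_nat[of p] by simp
    moreover have "w < ln (real p)" "ln (real p) \<le> w + \<delta>" using P[OF p] by (auto simp: w_def)
    ultimately show "p \<in> {p::nat. prime p \<and> exp w < real p \<and> real p \<le> exp (w + \<delta>)}"
      using P[OF p] by (metis (mono_tags, lifting) exp_le_cancel_iff exp_less_cancel_iff exp_ln mem_Collect_eq)
  qed
  have "(\<Sum>p\<in>P. 1 / real p) \<le> (\<Sum>p\<in>{p::nat. prime p \<and> exp w < real p \<and> real p \<le> exp (w + \<delta>)}. 1 / real p)"
    by (rule sum_mono2[OF finite_primes_between sub]) auto
  also have "\<dots> \<le> 60 * \<delta> / w"
    using assms wV by (intro brun_titchmarsh) auto
  also have "\<dots> \<le> 60 * \<delta> / (V / 2)" using V assms(1) by (intro divide_left_mono) auto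
  finally show ?thesis by simp
qed

text \<open>A mass of 1/16 is spread over cells of mass at most \<open>120 * \<delta> / V\<close>
  each, and 1920 = 16 * 120.\<close>

lemma card_cells_ge:
  fixes \<delta> V L :: real
  assumes \<delta>: "0 < \<delta>" "\<delta> \<le> 1" "V \<ge> 96 / \<delta> + 1"
    and P: "finite P" "\<And>p. p \<in> P \<Longrightarrow> prime p \<and> exp V < real p" "(\<Sum>p\<in>P. 1 / real p) \<ge> 1 / 16"
  shows "real (card ((\<lambda>p. \<lceil>(L + ln (real p)) / \<delta>\<rceil>) ` P)) \<ge> V / (1920 * \<delta>)"
proof -
  define cell where "cell = (\<lambda>p::nat. \<lceil>(L + ln (real p)) / \<delta>\<rceil>)"
  have "96 / \<delta> > 0" using \<delta>(1) by simp
  then have V: "V > 0" using \<delta>(3) by linarith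
  have "1 / 16 \<le> (\<Sum>c\<in>cell ` P. \<Sum>p | p \<in> P \<and> cell p = c. 1 / real p)"
    using P(1,3) by (subst sum.image_gen[symmetric]) auto
  also have "\<dots> \<le> (\<Sum>c\<in>cell ` P. 120 * \<delta> / V)"
  proof (rule sum_mono)
    fix c
    show "(\<Sum>p | p \<in> P \<and> cell p = c. 1 / real p) \<le> 120 * \<delta> / V"
    proof (rule cell_mass[OF \<delta>, where L = L and c = "real_of_int c * \<delta>"], goal_cases)
      case (1 p)
      then have "real_of_int c - 1 < (L + ln (real p)) / \<delta>" "(L + ln (real p)) / \<delta> \<le> real_of_int c"
        using ceiling_correct[of "(L + ln (real p)) / \<delta>"] by (auto simp: cell_def)
      then show ?case using 1 P(2) \<delta>(1) by (simp add: field_simps)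
    qed
  qed
  also have "\<dots> = real (card (cell ` P)) * (120 * \<delta> / V)" by simp
  finally show ?thesis using V \<delta>(1) by (simp add: cell_def field_simps)
qed


lemma exists_intersecting_pair:
  fixes C :: "nat \<Rightarrow> 'a set"
  assumes "finite U" "\<And>i. i \<le> K \<Longrightarrow> C i \<subseteq> U" "\<And>i. i \<le> K \<Longrightarrow> real (card (C i)) \<ge> b"
    "real (card U) < real (Suc K) * b"
  obtains i j where "i < j" "j \<le> K" "C i \<inter> C j \<noteq> {}"
proof -
  have "\<exists>i j. i < j \<and> j \<le> K \<and> C i \<inter> C j \<noteq> {}"
  proof (rule ccontr)
    assume "\<not> ?thesis"
    then have disj: "\<forall>i\<in>{..K}. \<forall>j\<in>{..K}. i \<noteq> j \<longrightarrow> C i \<inter> C j = {}"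
      by (metis Int_commute atMost_iff linorder_neq_iff)
    have fin: "\<forall>i\<in>{..K}. finite (C i)" by (auto intro: finite_subset[OF assms(2) assms(1)])
    have "real (Suc K) * b = (\<Sum>i\<le>K. b)" by simp
    also have "\<dots> \<le> (\<Sum>i\<le>K. real (card (C i)))" using assms(3) by (intro sum_mono) auto
    also have "\<dots> = real (card (\<Union>i\<le>K. C i))"
      using disj fin by (subst card_UN_disjoint) auto
    also have "\<dots> \<le> real (card U)" using assms(1,2) by (intro of_nat_mono card_mono) auto
    finally show False using assms(4) by simp
  qed
  then show ?thesis using that by blast
qed

lemma exists_small_block:
  fixes f :: "nat \<Rightarrow> real"
  assumes "(\<Sum>t<r. f t) \<le> B" "real r * c > B"
  obtains t where "t < r" "f t < c"
proof -
  have "\<exists>t<r. f t < c"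
  proof (rule ccontr)
    assume "\<not> ?thesis"
    then have "(\<Sum>t<r. c) \<le> (\<Sum>t<r. f t)" by (intro sum_mono) (meson lessThan_iff not_less)
    then show False using assms by simp
  qed
  then show ?thesis using that by blast
qed

text \<open>The Bessel inequality for the union of \<open>r\<close> blocks bounds the total mass of
  bad primes, summed over all \<open>i\<close> and \<open>s\<close>, independently of
  \<open>r\<close>. Some block therefore has bad mass at most 1/16 for all \<open>i\<close> at once,
  out of at least 1/8. A common block is essential, since the cells of different \<open>i\<close>
  are to be compared. Here \<open>m i\<close> stands for the argument
  \<open>x / m\<^sub>i\<close>.\<close>

lemma (in prime_averages) good_block:
  fixes K S :: nat
  assumes "e > 0" "W \<ge> 1"
  shows "\<exists>r X. \<forall>m. (\<forall>i\<le>K. m i > X) \<longrightarrow> (\<exists>t<r. \<forall>i\<le>K.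
    (\<Sum>p | p \<in> prime_block (8 ^ t * W) \<and> (\<forall>s\<le>S. norm (F s (m i) - F (Suc s) (m i / real p)) \<le> e). 1 / real p) \<ge> 1 / 16)"
proof -
  \<comment> \<open>64 = 4 * 16: the Bessel bound 4 for each pair of \<open>i\<close> and
    \<open>s\<close>, against the target \<open>e\<^sup>2 / 16\<close> for a single block.\<close>
  obtain r :: nat where r: "real r > 64 * real (Suc K) * real (Suc S) / e\<^sup>2" using reals_Archimedean2 by blast
  let ?B = "\<lambda>t. prime_block (8 ^ t * W)"
  let ?A = "\<Union>t<r. ?B t"
  have A: "finite ?A" "\<And>p. p \<in> ?A \<Longrightarrow> prime p" by (auto simp: finite_prime_block) (auto simp: prime_block_def)
  obtain X where X: "\<And>x s. x \<ge> X \<Longrightarrow> (\<Sum>p\<in>?A. 1 / real p * (norm (F s x - F (Suc s) (x / real p)))\<^sup>2) \<le> 4"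
    using bessel[OF A] by blast
  have "\<exists>t<r. \<forall>i\<le>K. (\<Sum>p | p \<in> ?B t \<and> (\<forall>s\<le>S. norm (F s (m i) - F (Suc s) (m i / real p)) \<le> e). 1 / real p) \<ge> 1 / 16"
    if m: "\<And>i. i \<le> K \<Longrightarrow> m i > X" for m
  proof -
    define D where "D = (\<lambda>i s p. 1 / real p * (norm (F s (m i) - F (Suc s) (m i / real p)))\<^sup>2)"
    have D0: "D i s p \<ge> 0" for i s p by (simp add: D_def)
    have "(\<Sum>t<r. \<Sum>i\<le>K. \<Sum>s\<le>S. \<Sum>p\<in>?B t. D i s p) = (\<Sum>i\<le>K. \<Sum>t<r. \<Sum>s\<le>S. \<Sum>p\<in>?B t. D i s p)"
      by (rule sum.swap)
    also have "\<dots> = (\<Sum>i\<le>K. \<Sum>s\<le>S. \<Sum>t<r. \<Sum>p\<in>?B t. D i s p)"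
      by (intro sum.cong refl sum.swap)
    also have "\<dots> = (\<Sum>i\<le>K. \<Sum>s\<le>S. \<Sum>p\<in>?A. D i s p)"
      using assms by (intro sum.cong refl sum.UNION_disjoint[symmetric]) 
        (auto simp: finite_prime_block prime_block_disjoint)
    also have "\<dots> \<le> (\<Sum>i\<le>K. \<Sum>s\<le>S. 4)"
      using m unfolding D_def by (intro sum_mono X) (auto intro: less_imp_le)
    finally have "(\<Sum>t<r. \<Sum>i\<le>K. \<Sum>s\<le>S. \<Sum>p\<in>?B t. D i s p) \<le> 4 * real (Suc K) * real (Suc S)"
      by (simp add: algebra_simps)
    moreover have "real r * (e\<^sup>2 / 16) > 4 * real (Suc K) * real (Suc S)" using r assms by (simp add: field_simps)
    ultimately obtain t where t: "t < r" "(\<Sum>i\<le>K. \<Sum>s\<le>S. \<Sum>p\<in>?B t. D i s p) < e\<^sup>2 / 16"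
      by (rule exists_small_block)
    have "(\<Sum>p | p \<in> ?B t \<and> (\<forall>s\<le>S. norm (F s (m i) - F (Suc s) (m i / real p)) \<le> e). 1 / real p) \<ge> 1 / 16"
      if i: "i \<le> K" for i
    proof -
      let ?good = "\<lambda>p. \<forall>s\<le>S. norm (F s (m i) - F (Suc s) (m i / real p)) \<le> e"
      have "e\<^sup>2 * (\<Sum>p | p \<in> ?B t \<and> \<not> ?good p. 1 / real p) = (\<Sum>p | p \<in> ?B t \<and> \<not> ?good p. e\<^sup>2 * (1 / real p))"
        by (rule sum_distrib_left)
      also have "\<dots> \<le> (\<Sum>p | p \<in> ?B t \<and> \<not> ?good p. \<Sum>s\<le>S. D i s p)"
      proof (rule sum_mono)
        fix p assume "p \<in> {p. p \<in> ?B t \<and> \<not> ?good p}"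
        then obtain s where s: "s \<le> S" "norm (F s (m i) - F (Suc s) (m i / real p)) > e"
          by (auto simp: not_le)
        have "e\<^sup>2 * (1 / real p) \<le> D i s p"
          using s assms by (simp add: D_def divide_right_mono power_mono)
        also have "\<dots> \<le> (\<Sum>s\<le>S. D i s p)"
          using s D0 by (intro member_le_sum[of s "{..S}"]) auto
        finally show "e\<^sup>2 * (1 / real p) \<le> (\<Sum>s\<le>S. D i s p)" .
      qed
      also have "\<dots> \<le> (\<Sum>p\<in>?B t. \<Sum>s\<le>S. D i s p)"
        by (rule sum_mono2) (auto simp: finite_prime_block D0 intro!: sum_nonneg)
      also have "\<dots> = (\<Sum>s\<le>S. \<Sum>p\<in>?B t. D i s p)" by (rule sum.swap)
      also have "\<dots> \<le> (\<Sum>i\<le>K. \<Sum>s\<le>S. \<Sum>p\<in>?B t. D i s p)"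
        using i by (intro member_le_sum[of i "{..K}" "\<lambda>i. \<Sum>s\<le>S. \<Sum>p\<in>?B t. D i s p"]) (auto intro!: sum_nonneg D0)
      also have "\<dots> \<le> e\<^sup>2 * (1 / 16)" using t by simp
      finally have bad: "(\<Sum>p | p \<in> ?B t \<and> \<not> ?good p. 1 / real p) \<le> 1 / 16"
        using assms by (subst (asm) mult_le_cancel_left_pos) auto
      have "1 / 8 \<le> (\<Sum>p\<in>?B t. 1 / real p)"
        using assms mult_mono[of 1 "8 ^ t" 1 W] by (intro sum_inverse_prime_block) auto
      also have "\<dots> = (\<Sum>p | p \<in> ?B t \<and> ?good p. 1 / real p) + (\<Sum>p | p \<in> ?B t \<and> \<not> ?good p. 1 / real p)"
        by (subst sum.union_disjoint[symmetric]) (auto simp: finite_prime_block intro!: sum.cong)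
      finally show ?thesis using bad by linarith
    qed
    then show ?thesis using t(1) by blast
  qed
  then show ?thesis by blast
qed

lemma ceiling_eq_imp_close:
  fixes a b :: real
  assumes "\<lceil>a\<rceil> = \<lceil>b\<rceil>"
  shows "\<bar>a - b\<bar> \<le> 1"
proof -
  have "of_int \<lceil>a\<rceil> - 1 < a \<and> a \<le> of_int \<lceil>a\<rceil>" by (rule ceiling_correct)
  moreover have "of_int \<lceil>a\<rceil> - 1 < b \<and> b \<le> of_int \<lceil>a\<rceil>"
    unfolding assms by (rule ceiling_correct)
  ultimately show ?thesis by linarith
qed

text \<open>If \<open>m\<^sub>i * p\<close> and \<open>m\<^sub>j * q\<close> share a cell, five
  approximations join \<open>F s x\<close> to \<open>F (s + d) x\<close> with
  \<open>d = j - i\<close>: down to \<open>x / m\<^sub>j\<close>, on to \<open>z\<close> by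
  \<open>q\<close>, across to \<open>y\<close>, back by \<open>p\<close> to
  \<open>x / m\<^sub>i\<close>, and up to \<open>x\<close>. The shifts met are \<open>s\<close>,
  \<open>s + j\<close>, \<open>Suc (s + j)\<close> twice, \<open>s + j\<close> and
  \<open>s + d\<close>. The range of \<open>d\<close> must not depend on \<open>e\<close>.\<close>

lemma (in prime_averages) near_period:
  assumes e: "e > 0"
  shows "\<exists>X. \<forall>x\<ge>X. \<exists>d\<in>{1..19200}. \<forall>s\<le>S. norm (F s x - F (s + d) x) \<le> e"
proof -
  \<comment> \<open>19200 = 10 * 1920. There are at most
    \<open>9 * V / \<delta> + 1 \<le> 10 * V / \<delta>\<close> cells, and \<open>K + 1\<close>
    indices occupying at least \<open>V / (1920 * \<delta>)\<close> each cannot be disjoint.\<close>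
  define K :: nat where "K = 19200"
  define e' where "e' = e / 5"
  \<comment> \<open>Within a cell the logarithmic part of the Lipschitz bound is then at most
    \<open>e' / 2\<close>; the other half is left for the term \<open>1 / u\<close>.\<close>
  define \<delta> where "\<delta> = min 1 (e' / 4)"
  have e': "e' > 0" and \<delta>: "0 < \<delta>" "\<delta> \<le> 1" "2 * \<delta> \<le> e' / 2"
    using e by (auto simp: e'_def \<delta>_def)
  obtain M X1 where M: "M > 0" and
    MX: "\<And>i x. i \<le> K \<Longrightarrow> x \<ge> X1 \<Longrightarrow> \<exists>m\<in>{1..M::nat}. \<forall>s\<le>S + K. norm (F s x - F (s + i) (x / real m)) \<le> e'"
    using good_products[OF e', of K "S + K"] by blast
  \<comment> \<open>The first entry is the condition for the prime bound in a cell. The second makes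
    \<open>ln (m i) \<le> V\<close> for every block used, so that \<open>ln (m i) + ln p\<close>
    stays below \<open>9 * V\<close>.\<close>
  define W where "W = max (96 / \<delta> + 1) (ln (real M))"
  have W1: "96 / \<delta> + 1 \<ge> 1" using \<delta> by simp
  have W: "W \<ge> 1" "W \<ge> 96 / \<delta> + 1" "W \<ge> ln (real M)"
    unfolding W_def using max.coboundedI1[OF W1] by simp_all
  obtain r X2 where r: "\<And>m. (\<forall>i\<le>K. m i > X2) \<Longrightarrow> \<exists>t<r. \<forall>i\<le>K.
    (\<Sum>p | p \<in> prime_block (8 ^ t * W) \<and> (\<forall>s\<le>S + 2 * K. norm (F s (m i) - F (Suc s) (m i / real p)) \<le> e'). 1 / real p) \<ge> 1 / 16"
    using good_block[OF e' W(1), of K "S + 2 * K"] by blast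
  \<comment> \<open>\<open>Z\<close> dominates every product \<open>m i * p\<close> from any of the
    \<open>r\<close> blocks; \<open>x \<ge> Z * (2 / e')\<close> then makes the final arguments
    \<open>y\<close> and \<open>z\<close> at least \<open>2 / e'\<close>.\<close>
  define Z where "Z = real M * exp (8 * (8 ^ r * W))"
  define X where "X = max (max X1 1) (max (real M * (\<bar>X2\<bar> + 1)) (Z * (2 / e')))"
  have "\<exists>d\<in>{1..19200}. \<forall>s\<le>S. norm (F s x - F (s + d) x) \<le> e" if x: "x \<ge> X" for x
  proof -
    have x0: "x > 0" using x by (auto simp: X_def)
    obtain m where m: "\<And>i. i \<le> K \<Longrightarrow> m i \<in> {1..M}"
      "\<And>i s. i \<le> K \<Longrightarrow> s \<le> S + K \<Longrightarrow> norm (F s x - F (s + i) (x / real (m i))) \<le> e'"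
    proof -
      have "X1 \<le> x" using x by (simp add: X_def)
      then have "\<forall>i. \<exists>m. i \<le> K \<longrightarrow> m \<in> {1..M} \<and> (\<forall>s\<le>S + K. norm (F s x - F (s + i) (x / real m)) \<le> e')"
        using MX[of _ x] by blast
      then show ?thesis using that by metis
    qed
    have m0: "real (m i) > 0" "real (m i) \<le> real M" if "i \<le> K" for i using m(1)[OF that] by auto
    have "\<forall>i\<le>K. x / real (m i) > X2"
    proof (intro allI impI)
      fix i assume i: "i \<le> K"
      have "real (m i) * X2 < real M * (\<bar>X2\<bar> + 1)"
      proof (rule le_less_trans)
        have "X2 * real (m i) \<le> \<bar>X2\<bar> * real M" using m0[OF i] by (intro mult_mono) auto
        then show "real (m i) * X2 \<le> real M * \<bar>X2\<bar>" by (simp only: mult.commute)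
      qed (use M in auto)
      then show "x / real (m i) > X2" using m0[OF i] x by (auto simp: X_def field_simps)
    qed
    from r[OF this] obtain t where t: "t < r" and
      mass: "\<And>i. i \<le> K \<Longrightarrow> (\<Sum>p | p \<in> prime_block (8 ^ t * W) \<and>
        (\<forall>s\<le>S + 2 * K. norm (F s (x / real (m i)) - F (Suc s) (x / real (m i) / real p)) \<le> e'). 1 / real p) \<ge> 1 / 16"
      by blast
    define V where "V = 8 ^ t * W"
    define P where "P = (\<lambda>i. {p. p \<in> prime_block V \<and>
        (\<forall>s\<le>S + 2 * K. norm (F s (x / real (m i)) - F (Suc s) (x / real (m i) / real p)) \<le> e')})"
    define cell where "cell = (\<lambda>i p. \<lceil>(ln (real (m i)) + ln (real p)) / \<delta>\<rceil>)"
    have WV: "W \<le> V" using W(1) mult_mono[of 1 "8 ^ t" W W] by (simp add: V_def)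
    have P: "prime p" "exp V < real p" "real p \<le> exp (8 * V)" "real p > 0" if "p \<in> P i" for p i
      using that prime_gt_0_nat[of p] by (auto simp: P_def prime_block_def)
    define U where "U = {1..\<lceil>9 * V / \<delta>\<rceil>}"
    have sub: "cell i ` P i \<subseteq> U" if i: "i \<le> K" for i
    proof
      fix c assume "c \<in> cell i ` P i"
      then obtain p where p: "p \<in> P i" "c = cell i p" by blast
      have lm: "0 \<le> ln (real (m i))" "ln (real (m i)) \<le> V"
        using m(1)[OF i] W(3) WV by (auto intro: order_trans[of _ "ln (real M)"])
      have lp: "V < ln (real p)" using P(2,4)[OF p(1)] by (metis exp_less_cancel_iff exp_ln)
      have lp': "ln (real p) \<le> 8 * V" using P(3,4)[OF p(1)] by (metis exp_le_cancel_iff exp_ln)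
      have "(ln (real (m i)) + ln (real p)) / \<delta> \<le> 9 * V / \<delta>"
        using lm lp' \<delta> by (intro divide_right_mono) auto
      moreover have "(ln (real (m i)) + ln (real p)) / \<delta> > 0"
        using lm lp WV W(1) \<delta> by (intro divide_pos_pos) auto
      ultimately have "0 < \<lceil>(ln (real (m i)) + ln (real p)) / \<delta>\<rceil>"
        "\<lceil>(ln (real (m i)) + ln (real p)) / \<delta>\<rceil> \<le> \<lceil>9 * V / \<delta>\<rceil>"
        by (simp_all only: zero_less_ceiling ceiling_mono)
      then show "c \<in> U" unfolding p(2) cell_def U_def by simp
    qed
    have large: "real (card (cell i ` P i)) \<ge> V / (1920 * \<delta>)" if i: "i \<le> K" for i
      unfolding cell_def
    proof (rule card_cells_ge[OF \<delta>(1,2)])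
      show "96 / \<delta> + 1 \<le> V" using W(2) WV by simp
      show "finite (P i)" by (rule finite_subset[OF _ finite_prime_block[of V]]) (auto simp: P_def)
      show "1 / 16 \<le> (\<Sum>p\<in>P i. 1 / real p)" using mass[OF i] by (simp add: P_def V_def)
    qed (use P in auto)
    have few: "real (card U) < real (Suc K) * (V / (1920 * \<delta>))"
    proof -
      define Y where "Y = V / \<delta>"
      have "real (card U) \<le> 9 * Y + 1"
        using \<delta> WV W(1) by (simp add: U_def Y_def)
      also have "1 \<le> Y" using \<delta> WV W(1) by (simp add: Y_def)
      then have "9 * Y + 1 < 19201 / 1920 * Y" by (simp add: field_simps)
      also have "\<dots> = real (Suc K) * (V / (1920 * \<delta>))" by (simp add: K_def Y_def)
      finally show ?thesis .
    qed
    have "finite U" by (simp add: U_def)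
    then obtain i j where ij: "i < j" "j \<le> K" "cell i ` P i \<inter> cell j ` P j \<noteq> {}"
      by (rule exists_intersecting_pair[OF _ sub large few])
    then obtain p q where pq: "p \<in> P i" "q \<in> P j" "cell i p = cell j q" by auto
    have iK: "i \<le> K" using ij by simp
    define y where "y = x / real (m i) / real p"
    define z where "z = x / real (m j) / real q"
    have big: "u \<ge> 2 / e' \<and> u > 0" if "u = x / real (m k) / real p'" "k \<le> K" "p' \<in> P k" for u k p'
    proof -
      have "(8::real) ^ t \<le> 8 ^ r" using t by (intro power_increasing) auto
      then have "V \<le> 8 ^ r * W" using W(1) by (simp add: V_def mult_right_mono)
      then have "real (m k) * real p' \<le> Z"
        using P[OF that(3)] m0[OF that(2)] unfolding Z_def
        by (intro mult_mono) (auto intro: order_trans[of "real p'" "exp (8 * V)"])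
      then have "real (m k) * real p' * (2 / e') \<le> Z * (2 / e')"
        using e' by (intro mult_right_mono) auto
      also have "\<dots> \<le> X" unfolding X_def by (rule max.coboundedI2[OF max.coboundedI2[OF order_refl]])
      also note x
      finally have "2 / e' * (real (m k) * real p') \<le> x" by (simp only: mult_ac)
      moreover have "real (m k) * real p' > 0" using P(4)[OF that(3)] m0[OF that(2)] by simp
      ultimately show ?thesis
        using x0 unfolding that(1) divide_divide_eq_left by (simp only: pos_le_divide_eq divide_pos_pos simp_thms)
    qed
    have close: "norm (F s u - F s v) \<le> e'"
      if "u \<le> v" "u \<ge> 2 / e' \<and> u > 0" "ln (v / u) \<le> \<delta>" for u v s
    proof -
      have "1 / u \<le> e' / 2" using that(2) e' by (simp add: field_simps)
      then show ?thesis using lipschitz[of u v s] that \<delta>(3) by linarith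
    qed
    have yz: "norm (F s y - F s z) \<le> e'" for s
    proof -
      have yz0: "y \<ge> 2 / e' \<and> y > 0" "z \<ge> 2 / e' \<and> z > 0"
        using big[OF y_def iK pq(1)] big[OF z_def ij(2) pq(2)] by auto
      have ly: "ln y = ln x - (ln (real (m i)) + ln (real p))"
        using x0 m0[OF iK] P(4)[OF pq(1)] by (simp add: y_def ln_div ln_mult)
      have lz: "ln z = ln x - (ln (real (m j)) + ln (real q))"
        using x0 m0[OF ij(2)] P(4)[OF pq(2)] by (simp add: z_def ln_div ln_mult)
      have "\<bar>(ln (real (m i)) + ln (real p)) / \<delta> - (ln (real (m j)) + ln (real q)) / \<delta>\<bar> \<le> 1"
        using pq(3) unfolding cell_def by (rule ceiling_eq_imp_close)
      then have d: "\<bar>ln y - ln z\<bar> \<le> \<delta>"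
        unfolding ly lz diff_divide_distrib[symmetric] using \<delta> by (simp add: abs_le_iff field_simps)
      show ?thesis
      proof (cases "y \<le> z")
        case True
        then show ?thesis using close[of y z s] yz0 d by (simp add: ln_div)
      next
        case False
        then show ?thesis using close[of z y s] yz0 d by (simp add: ln_div norm_minus_commute)
      qed
    qed
    define d where "d = j - i"
    have dij: "d + i = j" "d \<le> K" "d \<in> {1..19200}" using ij by (auto simp: d_def K_def)
    have "norm (F s x - F (s + d) x) \<le> e" if s: "s \<le> S" for s
    proof -
      have 1: "norm (F s x - F (s + j) (x / real (m j))) \<le> e'"
        using m(2)[OF ij(2), of s] s by simp
      have 2: "norm (F (s + j) (x / real (m j)) - F (Suc (s + j)) z) \<le> e'"
        using pq(2) s ij by (simp add: P_def z_def)
      have 3: "norm (F (Suc (s + j)) z - F (Suc (s + j)) y) \<le> e'"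
        using yz by (simp add: norm_minus_commute)
      have "s + d \<le> S + K" using s dij by simp
      from m(2)[OF iK this]
      have 4: "norm (F (s + j) (x / real (m i)) - F (s + d) x) \<le> e'"
        by (simp add: norm_minus_commute add.assoc dij)
      have 5: "norm (F (Suc (s + j)) y - F (s + j) (x / real (m i))) \<le> e'"
        using pq(1) s ij by (simp add: P_def y_def norm_minus_commute)
      have "F s x - F (s + d) x = (F s x - F (s + j) (x / real (m j))) +
        ((F (s + j) (x / real (m j)) - F (Suc (s + j)) z) + ((F (Suc (s + j)) z - F (Suc (s + j)) y) +
        ((F (Suc (s + j)) y - F (s + j) (x / real (m i))) + (F (s + j) (x / real (m i)) - F (s + d) x))))"
        by simp
      also have "norm \<dots> \<le> e' + (e' + (e' + (e' + e')))"
        by (intro norm_triangle_mono 1 2 3 4 5)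
      finally show ?thesis by (simp add: e'_def)
    qed
    then show ?thesis using dij(3) by blast
  qed
  then show ?thesis by blast
qed

text \<open>Whatever \<open>d\<close> occurs at \<open>x\<close>, it divides \<open>D\<close>, and
  at most \<open>D\<close> steps of length \<open>d\<close> lead from 0 to \<open>D\<close>. As
  \<open>D\<close> is fixed before the precision, each step may be required to cost at most
  \<open>e / (2 * D)\<close>; taking \<open>S = D\<close> covers all intermediate shifts.\<close>

lemma (in prime_averages) period:
  shows "((\<lambda>x. F 0 x - F (fact 19200) x) \<longlongrightarrow> 0) at_top"
proof (rule tendstoI)
  fix e :: real assume e: "e > 0"
  define D :: nat where "D = fact 19200"
  have D: "D > 0" by (simp only: D_def fact_gt_zero)
  obtain X where X: "\<And>x. x \<ge> X \<Longrightarrow> \<exists>d\<in>{1..19200}. \<forall>s\<le>D. norm (F s x - F (s + d) x) \<le> e / (2 * real D)"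
    using near_period[of "e / (2 * real D)" D] e D by auto
  have "norm (F 0 x - F D x) < e" if x: "x \<ge> X" for x
  proof -
    obtain d where d: "1 \<le> d" "d \<le> 19200" "\<And>s. s \<le> D \<Longrightarrow> norm (F s x - F (s + d) x) \<le> e / (2 * real D)"
      using X[OF x] by auto
    have "d dvd D" unfolding D_def using d by (intro dvd_fact)
    then obtain k where k: "D = d * k" by blast
    have "norm (F 0 x - F (d * l) x) \<le> real l * (e / (2 * real D))" if "l \<le> k" for l
      using that
    proof (induction l)
      case (Suc l)
      have "d * l \<le> D" using Suc k by simp
      from norm_triangle_mono[OF Suc.IH d(3)[OF this]] Suc.prems
      show ?case by (simp add: algebra_simps add_divide_distrib)
    qed simp
    from this[of k] have "norm (F 0 x - F D x) \<le> real k * (e / (2 * real D))" by (simp add: k)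
    also have "\<dots> \<le> real D * (e / (2 * real D))"
    proof (rule mult_right_mono)
      have "k \<le> D" using d by (simp add: k)
      then show "real k \<le> real D" by (rule of_nat_mono)
    qed (use e in simp)
    also have "\<dots> < e" using D e by (simp add: field_simps)
    finally show ?thesis .
  qed
  then show "\<forall>\<^sub>F x in at_top. dist (F 0 x - F (fact 19200) x) 0 < e"
    unfolding D_def eventually_at_top_linorder dist_norm by auto
qed

section \<open>Uniform cancellation of polynomial phases\<close>

definition e_unit :: "real \<Rightarrow> complex" where
  "e_unit t = cis (2 * pi * t)"

lemma norm_e_unit [simp]: "norm (e_unit t) = 1"
  by (simp add: e_unit_def)

lemma e_unit_add: "e_unit (s + t) = e_unit s * e_unit t"
  by (simp add: e_unit_def cis_mult algebra_simps)

lemma e_unit_diff: "e_unit (s - t) = e_unit s * cnj (e_unit t)"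
  by (simp add: e_unit_def cis_cnj cis_mult algebra_simps)

lemma e_unit_uminus: "e_unit (- t) = cnj (e_unit t)"
  by (simp add: e_unit_def cis_cnj)

lemma e_unit_Ints: "t \<in> \<int> \<Longrightarrow> e_unit t = 1"
  by (auto simp: e_unit_def complex_eq_iff cos_int_2pin sin_int_2pin elim!: Ints_cases)

lemma e_unit_0 [simp]: "e_unit 0 = 1"
  by (simp add: e_unit_def)

lemma e_unit_add_Ints: "t \<in> \<int> \<Longrightarrow> e_unit (s + t) = e_unit s"
  by (simp add: e_unit_add e_unit_Ints)

lemma e_unit_of_nat_mult: "e_unit (real n * t) = e_unit t ^ n"
  by (induction n) (simp_all add: e_unit_add algebra_simps)

lemma e_unit_eq_1_imp_Ints:
  assumes "e_unit t = 1"
  shows "t \<in> \<int>"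
proof -
  have "cos (2 * pi * t) = 1" using assms by (auto simp: e_unit_def complex_eq_iff)
  then obtain n :: int where "2 * pi * t = of_int n * 2 * pi" using cos_one_2pi_int by blast
  then show ?thesis by simp
qed

lemma norm_geometric_sum_le:
  fixes z :: complex
  assumes "norm z = 1" "z \<noteq> 1"
  shows "norm (\<Sum>j<H. z ^ j) \<le> 2 / norm (1 - z)"
proof -
  have "(\<Sum>j<H. z ^ j) = (1 - z ^ H) / (1 - z)" using assms(2) by (simp add: sum_gp_strict)
  moreover have "norm (1 - z ^ H) \<le> 2"
    using norm_triangle_ineq4[of 1 "z ^ H"] assms(1) by (simp add: norm_power)
  ultimately show ?thesis by (simp add: norm_divide divide_right_mono)
qed

text \<open>Uniformity in the starting point \<open>m\<close> is the point: \<open>m\<close> will be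
  the value \<open>big_omega n\<close>, over which there is no control.\<close>

definition uniform_cancel :: "(nat \<Rightarrow> complex) \<Rightarrow> nat \<Rightarrow> bool" where
  "uniform_cancel a D \<longleftrightarrow> (\<forall>\<epsilon>>0. \<exists>H0. \<forall>H\<ge>H0. \<forall>m. norm (\<Sum>j<H. a (m + D * j)) \<le> \<epsilon> * real H)"

lemma uniform_cancel_linear:
  assumes "c * real D \<notin> \<int>"
  shows "uniform_cancel (\<lambda>m. e_unit (c * real m + d)) D"
  unfolding uniform_cancel_def
proof (intro allI impI)
  fix \<epsilon> :: real assume \<epsilon>: "\<epsilon> > 0"
  define z where "z = e_unit (c * real D)"
  have z: "norm z = 1" "z \<noteq> 1" using assms e_unit_eq_1_imp_Ints by (auto simp: z_def)
  define B where "B = 2 / norm (1 - z)"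
  have "norm (\<Sum>j<H. e_unit (c * real (m + D * j) + d)) \<le> \<epsilon> * real H" if H: "H \<ge> nat \<lceil>B / \<epsilon>\<rceil>" for H m
  proof -
    have "(\<Sum>j<H. e_unit (c * real (m + D * j) + d)) = (\<Sum>j<H. e_unit (c * real m + d) * z ^ j)"
    proof (rule sum.cong[OF refl])
      fix j
      have "c * real (m + D * j) + d = (c * real m + d) + real j * (c * real D)"
        by (simp add: algebra_simps)
      then show "e_unit (c * real (m + D * j) + d) = e_unit (c * real m + d) * z ^ j"
        by (simp only: e_unit_add e_unit_of_nat_mult z_def)
    qed
    also have "\<dots> = e_unit (c * real m + d) * (\<Sum>j<H. z ^ j)" by (simp only: sum_distrib_left)
    also have "norm \<dots> \<le> B" using norm_geometric_sum_le[OF z] by (simp add: norm_mult B_def)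
    also have "B / \<epsilon> \<le> real H" using H by (simp add: nat_le_iff ceiling_le_iff)
    then have "B \<le> \<epsilon> * real H" using \<epsilon> by (simp add: field_simps)
    finally show ?thesis .
  qed
  then show "\<exists>H0. \<forall>H\<ge>H0. \<forall>m. norm (\<Sum>j<H. e_unit (c * real (m + D * j) + d)) \<le> \<epsilon> * real H" by blast
qed

text \<open>A progression of difference \<open>D\<close> splits into \<open>q\<close> progressions
  of difference \<open>q * D\<close>, up to at most \<open>q\<close> leftover terms. This permits
  refining the difference until rational coefficients become harmless.\<close>

lemma uniform_cancel_mult_step:
  assumes a: "\<And>m. norm (a m) \<le> 1" and q: "q > 0" and u: "uniform_cancel a (q * D)"
  shows "uniform_cancel a D"
  unfolding uniform_cancel_def
proof (intro allI impI)
  fix \<epsilon> :: real assume \<epsilon>: "\<epsilon> > 0"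
  obtain H0 where H0: "\<And>H m. H \<ge> H0 \<Longrightarrow> norm (\<Sum>j<H. a (m + q * D * j)) \<le> (\<epsilon> / 2) * real H"
    using u \<epsilon> unfolding uniform_cancel_def by (meson half_gt_zero)
  have "norm (\<Sum>j<H. a (m + D * j)) \<le> \<epsilon> * real H" if H: "H \<ge> max (q * H0) (nat \<lceil>2 * real q / \<epsilon>\<rceil>)" for H m
  proof -
    define K where "K = H div q"
    have K: "K \<ge> H0" using H q by (simp add: K_def less_eq_div_iff_mult_less_eq mult.commute)
    have KH: "K * q \<le> H" "H - K * q \<le> q" 
      using q by (auto simp: K_def minus_div_mult_eq_mod intro: less_imp_le)
    define f where "f = (\<lambda>j. a (m + D * j))"
    have "{..<H} = {..<K * q} \<union> {K * q..<H}" using KH by auto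
    then have "sum f {..<H} = sum f ({..<K * q} \<union> {K * q..<H})" by (rule arg_cong)
    also have "\<dots> = sum f {..<K * q} + sum f {K * q..<H}" by (rule sum.union_disjoint) auto
    also have "sum f {..<K * q} = (\<Sum>i<K. \<Sum>r<q. f (r + i * q))"
    proof -
      have "sum f {i * q..<i * q + q} = (\<Sum>r<q. f (r + i * q))" for i
        using sum.shift_bounds_nat_ivl[of f 0 "i * q" q] by (simp add: atLeast0LessThan add.commute)
      then show ?thesis by (simp only: sum.nat_group[symmetric])
    qed
    also have "\<dots> = (\<Sum>r<q. \<Sum>i<K. f (r + i * q))" by (rule sum.swap)
    finally have "norm (sum f {..<H}) \<le> norm (\<Sum>r<q. \<Sum>i<K. f (r + i * q)) + norm (sum f {K * q..<H})"
      by (simp add: norm_triangle_ineq)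
    also have "norm (\<Sum>r<q. \<Sum>i<K. f (r + i * q)) \<le> (\<Sum>r<q. \<epsilon> / 2 * real K)"
    proof (rule order_trans[OF norm_sum], rule sum_mono)
      fix r
      have "(\<Sum>i<K. f (r + i * q)) = (\<Sum>i<K. a ((m + D * r) + q * D * i))"
        by (intro sum.cong refl) (simp add: f_def algebra_simps)
      then show "norm (\<Sum>i<K. f (r + i * q)) \<le> \<epsilon> / 2 * real K" using H0[OF K] by simp
    qed
    also have "\<dots> = \<epsilon> / 2 * real (K * q)" by simp
    also have "\<dots> \<le> \<epsilon> / 2 * real H" using KH \<epsilon> by (intro mult_left_mono of_nat_mono) auto
    also have "norm (sum f {K * q..<H}) \<le> real q"
    proof -
      have "norm (sum f {K * q..<H}) \<le> real (card {K * q..<H}) * 1"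
        by (intro sum_norm_bound) (simp add: f_def a)
      also have "\<dots> \<le> real q" using of_nat_mono[OF KH(2), where 'a = real] by simp
      finally show ?thesis .
    qed
    also have "real q \<le> \<epsilon> / 2 * real H"
    proof -
      have "2 * real q / \<epsilon> \<le> real H" using H by (simp add: nat_le_iff ceiling_le_iff)
      then show ?thesis using \<epsilon> by (simp add: field_simps)
    qed
    finally show ?thesis by (simp add: f_def)
  qed
  then show "\<exists>H0. \<forall>H\<ge>H0. \<forall>m. norm (\<Sum>j<H. a (m + D * j)) \<le> \<epsilon> * real H" by blast
qed

lemma sum_shift_diff:
  fixes f :: "nat \<Rightarrow> complex"
  assumes "\<And>j. norm (f j) \<le> 1"
  shows "norm ((\<Sum>j<H. f j) - (\<Sum>j<H. f (j + r))) \<le> 2 * real r"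
proof -
  have "(\<Sum>j<H. f (j + r)) = sum f {r..<H + r}"
    using sum.shift_bounds_nat_ivl[of f 0 r H] by (simp add: atLeast0LessThan)
  moreover have "sum f {..<H + r} = sum f {..<r} + sum f {r..<H + r}"
    by (subst sum.union_disjoint[symmetric]) (auto intro!: sum.cong)
  moreover have "sum f {..<H + r} = sum f {..<H} + sum f {H..<H + r}"
    by (subst sum.union_disjoint[symmetric]) (auto intro!: sum.cong)
  ultimately have "(\<Sum>j<H. f j) - (\<Sum>j<H. f (j + r)) = sum f {..<r} - sum f {H..<H + r}"
    by (simp add: algebra_simps)
  also have "norm \<dots> \<le> norm (sum f {..<r}) + norm (sum f {H..<H + r})" by (rule norm_triangle_ineq4)
  also have "\<dots> \<le> real r + real r"
    using sum_norm_bound[of "{..<r}" f 1] sum_norm_bound[of "{H..<H + r}" f 1] assms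
    by (intro add_mono) auto
  finally show ?thesis by simp
qed

text \<open>Van der Corput's inequality: compare the sum with the average of its shifts by
  \<open>r < R\<close>, and expand the square of the window sums \<open>T j\<close>. The diagonal
  gives \<open>R * H\<close>, and each other pair of shifts a correlation that cancels by
  hypothesis. Since those estimates hold for every starting point, so does the result.\<close>

lemma uniform_cancel_van_der_Corput:
  assumes a: "\<And>m. norm (a m) \<le> 1"
    and u: "\<And>h. h > 0 \<Longrightarrow> uniform_cancel (\<lambda>m. a (m + D * h) * cnj (a m)) D"
  shows "uniform_cancel a D"
  unfolding uniform_cancel_def
proof (intro allI impI)
  fix \<epsilon> :: real assume \<epsilon>: "\<epsilon> > 0"
  \<comment> \<open>With \<open>R > 1 / \<eta>\<close> the diagonal is no larger than the
    off-diagonal bound, so the square sum is at most \<open>R\<^sup>2 * 2 * \<eta> * H\<close>. This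
    choice of \<eta> makes the window sums cost \<open>3 / 4 * \<epsilon> * H\<close>; the last
    quarter pays for the shifts.\<close>
  define \<eta> where "\<eta> = \<epsilon>\<^sup>2 / 4"
  have \<eta>: "\<eta> > 0" using \<epsilon> by (simp add: \<eta>_def)
  obtain R :: nat where R: "real R > 1 / \<eta>" using reals_Archimedean2 by blast
  have "1 / \<eta> > 0" using \<eta> by simp
  then have "real R > 0" using R by linarith
  then have R0: "R > 0" by simp
  have "\<forall>h. \<exists>H0. h > 0 \<longrightarrow> (\<forall>H\<ge>H0. \<forall>m. norm (\<Sum>j<H. a (m + D * j + D * h) * cnj (a (m + D * j))) \<le> \<eta> * real H)"
    using u \<eta> unfolding uniform_cancel_def by blast
  then obtain H0 where H0: "\<And>h H m. h > 0 \<Longrightarrow> H \<ge> H0 h \<Longrightarrow>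
      norm (\<Sum>j<H. a (m + D * j + D * h) * cnj (a (m + D * j))) \<le> \<eta> * real H"
    by metis
  define H1 where "H1 = Max (H0 ` {..R}) + nat \<lceil>8 * real R / \<epsilon>\<rceil>"
  have "norm (\<Sum>j<H. a (m + D * j)) \<le> \<epsilon> * real H" if H: "H \<ge> H1" for H m
  proof -
    define f where "f = (\<lambda>j. a (m + D * j))"
    have f: "norm (f j) \<le> 1" for j using a by (simp add: f_def)
    define T where "T = (\<lambda>j. \<Sum>r<R. f (j + r))"
    have corr: "norm (\<Sum>j<H. f (j + r) * cnj (f (j + s))) \<le> \<eta> * real H" if rs: "s < r" "r < R" for r s
    proof -
      have "H0 (r - s) \<le> Max (H0 ` {..R})" using rs by (intro Max_ge) auto
      then have "H0 (r - s) \<le> H" using H by (simp add: H1_def)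
      from H0[OF _ this, of "m + D * s"] rs
      have "norm (\<Sum>j<H. a (m + D * s + D * j + D * (r - s)) * cnj (a (m + D * s + D * j))) \<le> \<eta> * real H" by simp
      also have "(\<Sum>j<H. a (m + D * s + D * j + D * (r - s)) * cnj (a (m + D * s + D * j))) =
        (\<Sum>j<H. f (j + r) * cnj (f (j + s)))"
      proof (intro sum.cong refl)
        fix j
        have "m + D * s + D * j + D * (r - s) = m + D * (j + r)"
          using rs by (simp add: algebra_simps diff_mult_distrib2)
        moreover have "m + D * s + D * j = m + D * (j + s)" by (simp add: algebra_simps)
        ultimately show "a (m + D * s + D * j + D * (r - s)) * cnj (a (m + D * s + D * j)) = f (j + r) * cnj (f (j + s))"
          by (simp only: f_def)
      qed
      finally show ?thesis .
    qed
    have corr': "norm (\<Sum>j<H. f (j + r) * cnj (f (j + s))) \<le> (if r = s then real H else 0) + \<eta> * real H"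
      if rs: "s < R" "r < R" for r s
    proof -
      consider "s < r" | "r < s" | "r = s" by linarith
      then show ?thesis
      proof cases
        case 1
        then show ?thesis using corr rs by simp
      next
        case 2
        have "(\<Sum>j<H. f (j + r) * cnj (f (j + s))) = cnj (\<Sum>j<H. f (j + s) * cnj (f (j + r)))"
          by (simp add: mult.commute)
        then show ?thesis using corr[OF 2 rs(1)] 2 by (simp only: complex_mod_cnj) simp
      next
        case 3
        have "norm (f (j + s) * cnj (f (j + s))) \<le> 1" for j
          using f[of "j + s"] by (simp add: norm_mult mult_le_one)
        then have "norm (\<Sum>j<H. f (j + r) * cnj (f (j + s))) \<le> real H"
          using sum_norm_bound[of "{..<H}" "\<lambda>j. f (j + s) * cnj (f (j + s))" 1] 3 by simp
        then show ?thesis using \<eta> 3 by (simp add: add_increasing2)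
      qed
    qed
    have "complex_of_real (\<Sum>j<H. (norm (T j))\<^sup>2) = (\<Sum>j<H. T j * cnj (T j))"
      by (simp only: of_real_sum complex_norm_square)
    also have "\<dots> = (\<Sum>j<H. \<Sum>r<R. \<Sum>s<R. f (j + r) * cnj (f (j + s)))"
      by (simp add: T_def sum_product)
    also have "\<dots> = (\<Sum>r<R. \<Sum>j<H. \<Sum>s<R. f (j + r) * cnj (f (j + s)))" by (rule sum.swap)
    also have "\<dots> = (\<Sum>r<R. \<Sum>s<R. \<Sum>j<H. f (j + r) * cnj (f (j + s)))" by (intro sum.cong refl sum.swap)
    finally have *: "complex_of_real (\<Sum>j<H. (norm (T j))\<^sup>2) = (\<Sum>r<R. \<Sum>s<R. \<Sum>j<H. f (j + r) * cnj (f (j + s)))" .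
    have "(\<Sum>j<H. (norm (T j))\<^sup>2) = norm (complex_of_real (\<Sum>j<H. (norm (T j))\<^sup>2))"
      unfolding norm_of_real by (rule abs_of_nonneg[symmetric]) (simp add: sum_nonneg)
    also have "\<dots> \<le> (\<Sum>r<R. \<Sum>s<R. norm (\<Sum>j<H. f (j + r) * cnj (f (j + s))))"
      unfolding * by (intro order_trans[OF norm_sum] sum_mono norm_sum)
    also have "\<dots> \<le> (\<Sum>r<R. \<Sum>s<R. (if r = s then real H else 0) + \<eta> * real H)"
      by (intro sum_mono corr') auto
    also have "\<dots> = real R * real H + (real R)\<^sup>2 * (\<eta> * real H)"
      by (simp add: sum.distrib power2_eq_square algebra_simps)
    also have "\<dots> \<le> (real R)\<^sup>2 * (2 * \<eta> * real H)"
    proof -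
      have "real R * 1 \<le> real R * (real R * \<eta>)" using R \<eta> by (intro mult_left_mono) (auto simp: field_simps)
      then have "real R * real H \<le> (real R)\<^sup>2 * \<eta> * real H"
        by (intro mult_right_mono) (auto simp: power2_eq_square mult.assoc)
      then show ?thesis by (simp add: algebra_simps)
    qed
    finally have sq: "(\<Sum>j<H. (norm (T j))\<^sup>2) \<le> (real R)\<^sup>2 * (2 * \<eta> * real H)" .
    have "(\<Sum>j<H. norm (T j)) \<le> (\<Sum>j<H. (norm (T j))\<^sup>2 / (2 * (\<epsilon> * real R)) + \<epsilon> * real R / 2)"
    proof (rule sum_mono)
      fix j
      have "0 \<le> (norm (T j) - \<epsilon> * real R)\<^sup>2" by simp
      then have "2 * (\<epsilon> * real R) * norm (T j) \<le> (norm (T j))\<^sup>2 + (\<epsilon> * real R) * (\<epsilon> * real R)"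
        by (simp add: power2_eq_square algebra_simps)
      then show "norm (T j) \<le> (norm (T j))\<^sup>2 / (2 * (\<epsilon> * real R)) + \<epsilon> * real R / 2"
        using \<epsilon> R0 by (simp add: field_simps)
    qed
    also have "\<dots> = (\<Sum>j<H. (norm (T j))\<^sup>2) / (2 * (\<epsilon> * real R)) + real H * (\<epsilon> * real R / 2)"
      by (simp add: sum.distrib sum_divide_distrib)
    also have "\<dots> \<le> (real R)\<^sup>2 * (2 * \<eta> * real H) / (2 * (\<epsilon> * real R)) + real H * (\<epsilon> * real R / 2)"
      using \<epsilon> R0 by (intro add_right_mono divide_right_mono sq) auto
    also have "\<dots> = real R * (3 / 4 * \<epsilon> * real H)"
      using \<epsilon> R0 by (simp add: \<eta>_def field_simps power2_eq_square)
    finally have T: "(\<Sum>j<H. norm (T j)) \<le> real R * (3 / 4 * \<epsilon> * real H)" .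
    have "of_nat R * (\<Sum>j<H. f j) = (\<Sum>r<R. (\<Sum>j<H. f j) - (\<Sum>j<H. f (j + r))) + (\<Sum>r<R. \<Sum>j<H. f (j + r))"
      by (simp add: sum_subtractf)
    also have "(\<Sum>r<R. \<Sum>j<H. f (j + r)) = (\<Sum>j<H. T j)" unfolding T_def by (rule sum.swap)
    finally have eq: "of_nat R * (\<Sum>j<H. f j) = (\<Sum>r<R. (\<Sum>j<H. f j) - (\<Sum>j<H. f (j + r))) + (\<Sum>j<H. T j)" .
    have "real R * norm (\<Sum>j<H. f j) = norm (of_nat R * (\<Sum>j<H. f j))" by (simp add: norm_mult)
    also have "\<dots> \<le> (\<Sum>r<R. norm ((\<Sum>j<H. f j) - (\<Sum>j<H. f (j + r)))) + (\<Sum>j<H. norm (T j))"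
      unfolding eq by (intro order_trans[OF norm_triangle_ineq] add_mono norm_sum)
    also have "\<dots> \<le> (\<Sum>r<R. 2 * real R) + real R * (3 / 4 * \<epsilon> * real H)"
      by (intro add_mono T sum_mono order_trans[OF sum_shift_diff[OF f]]) auto
    also have "\<dots> = real R * (2 * real R + 3 / 4 * \<epsilon> * real H)" by (simp add: algebra_simps)
    finally have "norm (\<Sum>j<H. f j) \<le> 2 * real R + 3 / 4 * \<epsilon> * real H" using R0 by simp
    also have "2 * real R \<le> 1 / 4 * \<epsilon> * real H"
    proof -
      have "nat \<lceil>8 * real R / \<epsilon>\<rceil> \<le> H" using H unfolding H1_def by (rule add_leD2)
      then have "real (nat \<lceil>8 * real R / \<epsilon>\<rceil>) \<le> real H" by (rule of_nat_mono)
      with real_nat_ceiling_ge have "8 * real R / \<epsilon> \<le> real H" by (rule order_trans)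
      then show ?thesis using \<epsilon> by (simp add: field_simps)
    qed
    finally show ?thesis by (simp add: f_def)
  qed
  then show "\<exists>H0. \<forall>H\<ge>H0. \<forall>m. norm (\<Sum>j<H. a (m + D * j)) \<le> \<epsilon> * real H" by blast
qed

section \<open>Weyl differencing\<close>

lemma polynomial_difference:
  fixes c :: "nat \<Rightarrow> real"
  shows "\<exists>c'. (\<forall>m. (\<Sum>i\<le>Suc n. c i * real (m + h) ^ i) - (\<Sum>i\<le>Suc n. c i * real m ^ i)
      = (\<Sum>i\<le>n. c' i * real m ^ i)) \<and> c' n = c (Suc n) * real (Suc n * h)"
proof -
  define b where "b = (\<lambda>i k. c i * (real (i choose k) * real h ^ (i - k)))"
  let ?c' = "\<lambda>k. \<Sum>i\<in>{k<..Suc n}. b i k"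
  have 1: "?c' n = c (Suc n) * real (Suc n * h)"
  proof -
    have "{n<..Suc n} = {Suc n}" by auto
    then show ?thesis by (simp add: b_def algebra_simps)
  qed
  have 2: "(\<Sum>i\<le>Suc n. c i * real (m + h) ^ i) - (\<Sum>i\<le>Suc n. c i * real m ^ i) = (\<Sum>k\<le>n. ?c' k * real m ^ k)" for m
  proof -
    have "(\<Sum>i\<le>Suc n. c i * real (m + h) ^ i) - (\<Sum>i\<le>Suc n. c i * real m ^ i)
      = (\<Sum>i\<le>Suc n. \<Sum>k<i. b i k * real m ^ k)"
      unfolding sum_subtractf[symmetric]
    proof (rule sum.cong[OF refl])
      fix i
      have "real (m + h) ^ i = (\<Sum>k\<le>i. real (i choose k) * real m ^ k * real h ^ (i - k))"
        unfolding of_nat_add by (rule binomial_ring)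
      then have "c i * real (m + h) ^ i = (\<Sum>k\<le>i. b i k * real m ^ k)"
        by (simp only: b_def sum_distrib_left mult_ac)
      also have "\<dots> = (\<Sum>k<i. b i k * real m ^ k) + c i * real m ^ i"
        unfolding lessThan_Suc_atMost[symmetric] sum.lessThan_Suc by (simp add: b_def)
      finally show "c i * real (m + h) ^ i - c i * real m ^ i = (\<Sum>k<i. b i k * real m ^ k)" by simp
    qed
    also have "\<dots> = (\<Sum>k\<le>n. \<Sum>i\<in>{k<..Suc n}. b i k * real m ^ k)"
      unfolding sum.Sigma[OF finite_atMost ballI[OF finite_lessThan]] sum.Sigma[OF finite_atMost ballI[OF finite_greaterThanAtMost]]
      by (rule sum.reindex_bij_witness[of _ "\<lambda>(k, i). (i, k)" "\<lambda>(i, k). (k, i)"]) auto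
    finally show ?thesis by (simp only: sum_distrib_right)
  qed
  show ?thesis using 1 2 by (intro exI[of _ ?c'] conjI allI)
qed

lemma irrational_mult_nat:
  fixes c :: real
  assumes "c \<notin> \<rat>" "k > 0"
  shows "c * real k \<notin> \<rat>"
proof
  assume "c * real k \<in> \<rat>"
  then have "c * real k / real k \<in> \<rat>" by (intro Rats_divide Rats_of_nat)
  then show False using assms by simp
qed

text \<open>Differencing by \<open>D * h\<close> lowers the degree by one and multiplies the leading
  coefficient by the positive integer \<open>Suc (Suc n) * (D * h)\<close>, so it stays irrational.
  The induction ends with a geometric sum.\<close>

lemma uniform_cancel_irrational_lead:
  assumes "c (Suc n) \<notin> \<rat>" "D > 0"
  shows "uniform_cancel (\<lambda>m. e_unit (\<Sum>i\<le>Suc n. c i * real m ^ i)) D"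
  using assms
proof (induction n arbitrary: c)
  case 0
  have "c 1 * real D \<notin> \<int>" using irrational_mult_nat[of "c 1" D] 0 Ints_subset_Rats by auto
  from uniform_cancel_linear[OF this, of "c 0"] show ?case by (simp add: add.commute)
next
  case (Suc n)
  show ?case
  proof (rule uniform_cancel_van_der_Corput)
    fix h :: nat assume h: "h > 0"
    obtain c' where c': "\<And>m. (\<Sum>i\<le>Suc (Suc n). c i * real (m + D * h) ^ i) - (\<Sum>i\<le>Suc (Suc n). c i * real m ^ i)
      = (\<Sum>i\<le>Suc n. c' i * real m ^ i)" "c' (Suc n) = c (Suc (Suc n)) * real (Suc (Suc n) * (D * h))"
      using polynomial_difference[where c = c and n = "Suc n" and h = "D * h"] by blast
    have "c' (Suc n) \<notin> \<rat>"
      unfolding c'(2) using Suc.prems h by (intro irrational_mult_nat) auto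
    from Suc.IH[of c', OF this Suc.prems(2)]
    show "uniform_cancel (\<lambda>m. e_unit (\<Sum>i\<le>Suc (Suc n). c i * real (m + D * h) ^ i) *
      cnj (e_unit (\<Sum>i\<le>Suc (Suc n). c i * real m ^ i))) D"
      unfolding e_unit_diff[symmetric] c' .
  qed simp
qed

lemma common_denominator:
  assumes "finite I" "\<And>i. i \<in> I \<Longrightarrow> (c i :: real) \<in> \<rat>"
  obtains q :: nat where "q > 0" "\<And>i. i \<in> I \<Longrightarrow> real q * c i \<in> \<int>"
proof -
  have "\<exists>q::nat. q > 0 \<and> (\<forall>i\<in>I. real q * c i \<in> \<int>)"
    using assms
  proof (induction I)
    case empty
    then show ?case by (intro exI[of _ 1]) auto
  next
    case (insert j I)
    then obtain q :: nat where q: "q > 0" "\<forall>i\<in>I. real q * c i \<in> \<int>" by auto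
    have "c j \<in> \<rat>" using insert.prems by simp
    then obtain a b :: int where ab: "b > 0" "c j = of_int a / of_int b"
      by (rule Rats_cases') 
    have j: "real (nat b) * c j \<in> \<int>" using ab by simp
    have "real (nat b * q) * c j \<in> \<int>"
      using Ints_mult[OF Ints_of_nat[of q] j] by (simp add: mult_ac)
    moreover have "real (nat b * q) * c i \<in> \<int>" if "i \<in> I" for i
      using Ints_mult[OF Ints_of_nat[of "nat b"], of "real q * c i"] q(2) that by (simp add: mult_ac)
    moreover have "nat b * q > 0" using ab q by simp
    ultimately show ?case by blast
  qed
  then show ?thesis using that by blast
qed

lemma rational_polynomial_periodic:
  fixes c :: "nat \<Rightarrow> real"
  assumes "\<And>i. i \<in> I \<Longrightarrow> real q * c i \<in> \<int>"
  shows "(\<Sum>i\<in>I. c i * real (m + q * y) ^ i) - (\<Sum>i\<in>I. c i * real m ^ i) \<in> \<int>"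
  unfolding sum_subtractf[symmetric]
proof (rule Ints_sum)
  fix i assume i: "i \<in> I"
  obtain t where "int (m + q * y) ^ i - int m ^ i = (int (m + q * y) - int m) * t"
  proof (cases i)
    case 0
    then show ?thesis using that[of 0] by simp
  next
    case (Suc n)
    then show ?thesis using diff_power_eq_sum that by blast
  qed
  then have "of_int (int (m + q * y) ^ i - int m ^ i) = (of_int ((int (m + q * y) - int m) * t) :: real)" by simp
  then have "real (m + q * y) ^ i - real m ^ i = real q * real y * of_int t" by simp
  then have "c i * real (m + q * y) ^ i - c i * real m ^ i = (real q * c i) * (real y * of_int t)"
    by (simp only: right_diff_distrib[symmetric]) (simp add: mult_ac)
  then show "c i * real (m + q * y) ^ i - c i * real m ^ i \<in> \<int>"
    using assms[OF i] by (simp add: Ints_mult)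
qed

text \<open>The coefficients above the last irrational one are rational. Along differences divisible
  by a common denominator \<open>q\<close> their part of the polynomial is constant modulo 1 and
  factors out, leaving a polynomial with irrational leading coefficient.\<close>

lemma uniform_cancel_polynomial:
  fixes c :: "nat \<Rightarrow> real"
  assumes irr: "\<exists>i\<in>{1..n}. c i \<notin> \<rat>" and D: "D > 0"
  shows "uniform_cancel (\<lambda>m. e_unit (\<Sum>i\<le>n. c i * real m ^ i)) D"
proof -
  define J where "J = {i\<in>{1..n}. c i \<notin> \<rat>}"
  have J: "finite J" "J \<noteq> {}" using irr by (auto simp: J_def)
  define j where "j = Max J"
  have "j \<in> J" using J by (simp add: j_def)
  then obtain k where k: "j = Suc k" "Suc k \<le> n" "c (Suc k) \<notin> \<rat>" by (cases j) (auto simp: J_def)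
  have "c i \<in> \<rat>" if "i \<in> {Suc k<..n}" for i
  proof (rule ccontr)
    assume "c i \<notin> \<rat>"
    then have "i \<in> J" using that by (auto simp: J_def)
    then have "i \<le> j" using J by (simp add: j_def)
    then show False using that k by simp
  qed
  then obtain q :: nat where q: "q > 0" "\<And>i. i \<in> {Suc k<..n} \<Longrightarrow> real q * c i \<in> \<int>"
    using common_denominator[of "{Suc k<..n}" c] by blast
  let ?P = "\<lambda>m::nat. \<Sum>i\<le>n. c i * real m ^ i"
  let ?B = "\<lambda>m::nat. \<Sum>i\<le>Suc k. c i * real m ^ i"
  let ?T = "\<lambda>m::nat. \<Sum>i\<in>{Suc k<..n}. c i * real m ^ i"
  have split: "?P m = ?B m + ?T m" for m
  proof -
    have "{..n} = {..Suc k} \<union> {Suc k<..n}" using k by auto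
    then have "?P m = (\<Sum>i\<in>{..Suc k} \<union> {Suc k<..n}. c i * real m ^ i)" by (rule arg_cong)
    also have "\<dots> = ?B m + ?T m" by (rule sum.union_disjoint) auto
    finally show ?thesis .
  qed
  have "uniform_cancel (\<lambda>m. e_unit (?P m)) (q * D)"
    unfolding uniform_cancel_def
  proof (intro allI impI)
    fix \<epsilon> :: real assume \<epsilon>: "\<epsilon> > 0"
    have "uniform_cancel (\<lambda>m. e_unit (?B m)) (q * D)"
      using k(3) q D by (intro uniform_cancel_irrational_lead) auto
    then obtain H0 where H0: "\<And>H m. H \<ge> H0 \<Longrightarrow> norm (\<Sum>j<H. e_unit (?B (m + q * D * j))) \<le> \<epsilon> * real H"
      using \<epsilon> unfolding uniform_cancel_def by meson
    have "norm (\<Sum>j<H. e_unit (?P (m + q * D * j))) \<le> \<epsilon> * real H" if H: "H \<ge> H0" for H m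
    proof -
      have "e_unit (?P (m + q * D * j)) = e_unit (?T m) * e_unit (?B (m + q * D * j))" for j
      proof -
        have "?T (m + q * (D * j)) - ?T m \<in> \<int>"
          by (rule rational_polynomial_periodic) (use q in auto)
        then have "e_unit (?T m + (?T (m + q * D * j) - ?T m)) = e_unit (?T m)"
          by (intro e_unit_add_Ints) (simp add: mult.assoc)
        then have "e_unit (?T (m + q * D * j)) = e_unit (?T m)" by simp
        then show ?thesis unfolding split e_unit_add by (simp only: mult.commute)
      qed
      then have "(\<Sum>j<H. e_unit (?P (m + q * D * j))) = e_unit (?T m) * (\<Sum>j<H. e_unit (?B (m + q * D * j)))"
        by (simp only: sum_distrib_left)
      then show ?thesis using H0[OF H] by (simp add: norm_mult)
    qed
    then show "\<exists>H0. \<forall>H\<ge>H0. \<forall>m. norm (\<Sum>j<H. e_unit (?P (m + q * D * j))) \<le> \<epsilon> * real H" by blast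
  qed
  note cancel = this
  show ?thesis
    by (rule uniform_cancel_mult_step[OF _ q(1) cancel]) (simp only: norm_e_unit order_refl)
qed

section \<open>Weyl's criterion\<close>

definition fejer :: "nat \<Rightarrow> real \<Rightarrow> real" where
  "fejer H u = (norm (\<Sum>j<H. e_unit (real j * u)))\<^sup>2 / real H"

lemma fejer_nonneg: "fejer H u \<ge> 0"
  by (simp add: fejer_def)

text \<open>Separating \<open>s\<close> from \<open>t\<close> reduces means of the kernel over a
  sequence to its Weyl sums.\<close>

lemma fejer_expand:
  "complex_of_real (fejer H (t - s)) =
     (\<Sum>j<H. \<Sum>k<H. e_unit (- ((real j - real k) * s)) * e_unit ((real j - real k) * t)) / of_nat H"
proof -
  have "complex_of_real ((norm (\<Sum>j<H. e_unit (real j * (t - s))))\<^sup>2)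
     = (\<Sum>j<H. \<Sum>k<H. e_unit (real j * (t - s)) * cnj (e_unit (real k * (t - s))))"
    unfolding complex_norm_square cnj_sum sum_product ..
  also have "\<dots> = (\<Sum>j<H. \<Sum>k<H. e_unit (- ((real j - real k) * s)) * e_unit ((real j - real k) * t))"
    unfolding e_unit_diff[symmetric] e_unit_add[symmetric] by (simp add: algebra_simps)
  finally show ?thesis by (simp add: fejer_def)
qed

lemma sum_e_unit_grid:
  assumes "H > 0" "\<bar>d\<bar> < int H" "d \<noteq> 0"
  shows "(\<Sum>k<H. e_unit (of_int d * (real k / real H))) = 0"
proof -
  define z where "z = e_unit (of_int d / real H)"
  have "z \<noteq> 1"
  proof
    assume "z = 1"
    then have "of_int d / real H \<in> \<int>" by (simp add: z_def e_unit_eq_1_imp_Ints)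
    then obtain n where n: "of_int d / real H = of_int n" by (auto elim: Ints_cases)
    then have "real_of_int d = real_of_int (n * int H)" using assms(1) by (simp add: field_simps)
    then have d: "d = n * int H" by (simp only: of_int_eq_iff)
    then have "\<bar>n\<bar> * int H < 1 * int H" using assms(2) by (simp add: abs_mult)
    then have "n = 0" using assms(1) by (subst (asm) mult_less_cancel_right) auto
    then show False using d assms(3) by simp
  qed
  moreover have "z ^ H = 1"
  proof -
    have "real H * (of_int d / real H) = of_int d" using assms(1) by simp
    then show ?thesis unfolding z_def e_unit_of_nat_mult[symmetric] by (simp add: e_unit_Ints)
  qed
  moreover have "e_unit (of_int d * (real k / real H)) = z ^ k" for k
    unfolding z_def e_unit_of_nat_mult[symmetric] by (simp add: mult.commute)
  ultimately show ?thesis by (simp add: sum_gp_strict)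
qed

text \<open>The frequencies \<open>j - k\<close> are below \<open>H\<close> in absolute value, so
  summing over the \<open>H\<close> grid points kills all but the diagonal. Divided by
  \<open>H\<close>, the translates of the kernel form an exact partition of unity.\<close>

lemma sum_fejer_grid:
  assumes "H > 0"
  shows "(\<Sum>k<H. fejer H (t - real k / real H)) = real H"
proof -
  have "complex_of_real (\<Sum>l<H. fejer H (t - real l / real H)) =
    (\<Sum>l<H. \<Sum>j<H. \<Sum>k<H. e_unit (- ((real j - real k) * (real l / real H))) * e_unit ((real j - real k) * t)) / of_nat H"
    unfolding of_real_sum fejer_expand by (simp add: sum_divide_distrib)
  also have "(\<Sum>l<H. \<Sum>j<H. \<Sum>k<H. e_unit (- ((real j - real k) * (real l / real H))) * e_unit ((real j - real k) * t))
    = (\<Sum>j<H. \<Sum>l<H. \<Sum>k<H. e_unit (- ((real j - real k) * (real l / real H))) * e_unit ((real j - real k) * t))"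
    by (rule sum.swap)
  also have "\<dots> = (\<Sum>j<H. \<Sum>k<H. \<Sum>l<H. e_unit (- ((real j - real k) * (real l / real H))) * e_unit ((real j - real k) * t))"
    by (intro sum.cong refl sum.swap)
  also have "\<dots> = (\<Sum>j<H. \<Sum>k<H. if k = j then of_nat H else 0)"
  proof (intro sum.cong refl)
    fix j k assume jk: "j \<in> {..<H}" "k \<in> {..<H}"
    show "(\<Sum>l<H. e_unit (- ((real j - real k) * (real l / real H))) * e_unit ((real j - real k) * t)) =
      (if k = j then of_nat H else 0)"
    proof (cases "k = j")
      case False
      have "- ((real j - real k) * (real l / real H)) = of_int (int k - int j) * (real l / real H)" for l
        by (simp only: of_int_diff of_int_of_nat_eq minus_mult_left minus_diff_eq)
      then have "(\<Sum>l<H. e_unit (- ((real j - real k) * (real l / real H)))) = 0"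
        using sum_e_unit_grid[of H "int k - int j"] assms jk False by (simp only:) auto
      then show ?thesis using False by (simp add: sum_distrib_right[symmetric])
    qed simp
  qed
  also have "\<dots> = of_nat H * of_nat H" by simp
  finally have "complex_of_real (\<Sum>l<H. fejer H (t - real l / real H)) = of_real (real H)"
    using assms by simp
  then show ?thesis by (simp only: of_real_eq_iff)
qed

text \<open>Here \<open>u\<close> keeps distance \<delta> from the integers, so
  \<open>norm (1 - e_unit u) = 2 * \<bar>sin (pi * u)\<bar>\<close> is at least
  \<open>2 * sin (pi * \<delta>)\<close>. The geometric sum is thus bounded independently of
  \<open>H\<close>.\<close>

lemma fejer_le:
  assumes "H > 0" "0 < \<delta>" "\<delta> \<le> 1 / 2" "\<delta> \<le> \<bar>u\<bar>" "\<bar>u\<bar> \<le> 1 - \<delta>"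
  shows "fejer H u \<le> 1 / (real H * (sin (pi * \<delta>))\<^sup>2)"
proof -
  define z where "z = e_unit u"
  have sd: "sin (pi * \<delta>) > 0" using assms by (intro sin_gt_zero) (auto simp: field_simps)
  have "0 < pi * \<delta>" using assms by simp
  then have pd: "- (pi / 2) \<le> pi * \<delta>" using pi_half_gt_zero by linarith
  have su: "sin (pi * \<delta>) \<le> sin (pi * \<bar>u\<bar>)"
  proof (cases "\<bar>u\<bar> \<le> 1 / 2")
    case True
    then show ?thesis using assms by (intro sin_monotone_2pi_le pd) (auto simp: field_simps)
  next
    case False
    have "pi * \<delta> \<le> pi * (1 - \<bar>u\<bar>)"
      using assms(5) by (intro mult_left_mono) simp_all
    moreover have "pi * (1 - \<bar>u\<bar>) \<le> pi * (1 / 2)"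
      using False by (intro mult_left_mono) simp_all
    ultimately have "sin (pi * \<delta>) \<le> sin (pi * (1 - \<bar>u\<bar>))"
      by (intro sin_monotone_2pi_le pd) auto
    also have "\<dots> = sin (pi * \<bar>u\<bar>)" by (simp add: right_diff_distrib)
    finally show ?thesis .
  qed
  have "1 - z = e_unit (u / 2) * (e_unit (- (u / 2)) - e_unit (u / 2))"
    by (simp add: z_def right_diff_distrib flip: e_unit_add)
  also have "e_unit (- (u / 2)) - e_unit (u / 2) = - (2 * \<i> * of_real (sin (pi * u)))"
    by (simp add: e_unit_def complex_eq_iff)
  finally have "norm (1 - z) = 2 * \<bar>sin (pi * u)\<bar>" by (simp add: norm_mult)
  also have "\<bar>sin (pi * u)\<bar> = \<bar>sin (pi * \<bar>u\<bar>)\<bar>" by (simp add: abs_if)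
  finally have nz: "norm (1 - z) \<ge> 2 * sin (pi * \<delta>)" using su by linarith
  then have z1: "z \<noteq> 1" using sd by auto
  have "norm (\<Sum>j<H. z ^ j) \<le> 2 / norm (1 - z)"
    by (rule norm_geometric_sum_le[OF _ z1]) (simp add: z_def)
  also have "\<dots> \<le> 2 / (2 * sin (pi * \<delta>))"
    using nz sd z1 by (intro divide_left_mono) auto
  finally have "norm (\<Sum>j<H. z ^ j) \<le> 1 / sin (pi * \<delta>)" by simp
  then have "(norm (\<Sum>j<H. z ^ j))\<^sup>2 \<le> (1 / sin (pi * \<delta>))\<^sup>2" by (intro power_mono) auto
  then have "(norm (\<Sum>j<H. z ^ j))\<^sup>2 / real H \<le> (1 / sin (pi * \<delta>))\<^sup>2 / real H"
    by (rule divide_right_mono) simp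
  then show ?thesis
    unfolding fejer_def e_unit_of_nat_mult z_def by (simp add: power_divide mult.commute)
qed

lemma card_grid_le:
  fixes \<alpha> \<beta> :: real
  assumes "H > 0" "\<alpha> \<le> \<beta>"
  shows "real (card {k. k < H \<and> \<alpha> \<le> real k / real H \<and> real k / real H \<le> \<beta>}) \<le> (\<beta> - \<alpha>) * real H + 1"
proof -
  let ?S = "{k. k < H \<and> \<alpha> \<le> real k / real H \<and> real k / real H \<le> \<beta>}"
  have "int ` ?S \<subseteq> {\<lceil>\<alpha> * real H\<rceil>..\<lfloor>\<beta> * real H\<rfloor>}"
    using assms(1) by (auto simp: ceiling_le_iff le_floor_iff field_simps)
  then have "card (int ` ?S) \<le> card {\<lceil>\<alpha> * real H\<rceil>..\<lfloor>\<beta> * real H\<rfloor>}" by (intro card_mono) auto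
  then have "card ?S \<le> nat (\<lfloor>\<beta> * real H\<rfloor> - \<lceil>\<alpha> * real H\<rceil> + 1)" by (simp add: card_image)
  then have "real (card ?S) \<le> real (nat (\<lfloor>\<beta> * real H\<rfloor> - \<lceil>\<alpha> * real H\<rceil> + 1))" by (rule of_nat_mono)
  also have "\<dots> \<le> max 0 (of_int (\<lfloor>\<beta> * real H\<rfloor> - \<lceil>\<alpha> * real H\<rceil> + 1))" by simp
  also have "\<dots> \<le> \<beta> * real H - \<alpha> * real H + 1"
  proof (rule max.boundedI)
    have "\<alpha> * real H \<le> \<beta> * real H" using assms by (intro mult_right_mono) auto
    then show "0 \<le> \<beta> * real H - \<alpha> * real H + 1" by simp
    have "of_int \<lfloor>\<beta> * real H\<rfloor> \<le> \<beta> * real H" "\<alpha> * real H \<le> of_int \<lceil>\<alpha> * real H\<rceil>"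
      by (rule of_int_floor_le, rule le_of_int_ceiling)
    then show "real_of_int (\<lfloor>\<beta> * real H\<rfloor> - \<lceil>\<alpha> * real H\<rceil> + 1) \<le> \<beta> * real H - \<alpha> * real H + 1"
      by (simp add: diff_mono)
  qed
  finally show ?thesis by (simp add: algebra_simps)
qed

text \<open>The kernel is a trigonometric polynomial with constant term 1. Positive frequencies
  average to 0 by hypothesis, negative ones by conjugation.\<close>

lemma fejer_mean_tendsto:
  fixes x :: "nat \<Rightarrow> real"
  assumes weyl: "\<And>h::nat. h > 0 \<Longrightarrow> (\<lambda>N. (\<Sum>n=1..N. e_unit (real h * x n)) / of_nat N) \<longlonglongrightarrow> 0"
    and H: "H > 0"
  shows "(\<lambda>N. (\<Sum>n=1..N. fejer H (x n - s)) / real N) \<longlonglongrightarrow> 1"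
proof -
  define c where "c = (\<lambda>j k N. (\<Sum>n=1..N. e_unit ((real j - real k) * x n)) / of_nat N)"
  have c: "c j k \<longlonglongrightarrow> (if k = j then 1 else 0)" for j k
  proof -
    consider "k < j" | "j < k" | "k = j" by linarith
    then show ?thesis
    proof cases
      case 1
      then show ?thesis using weyl[of "j - k"] by (simp add: c_def of_nat_diff)
    next
      case 2
      have "e_unit ((real j - real k) * t) = cnj (e_unit (real (k - j) * t))" for t
        using 2 by (simp add: e_unit_uminus[symmetric] of_nat_diff algebra_simps)
      then have "c j k = (\<lambda>N. cnj ((\<Sum>n=1..N. e_unit (real (k - j) * x n)) / of_nat N))"
        by (simp add: c_def)
      moreover have "\<dots> \<longlonglongrightarrow> cnj 0" using 2 by (intro tendsto_cnj weyl) simp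
      ultimately show ?thesis using 2 by simp
    next
      case 3
      have "\<forall>\<^sub>F N in sequentially. c j k N = 1"
        using eventually_gt_at_top[of 0] by eventually_elim (simp add: c_def 3)
      then show ?thesis using 3 by (simp add: tendsto_eventually)
    qed
  qed
  have "complex_of_real ((\<Sum>n=1..N. fejer H (x n - s)) / real N) =
    (\<Sum>j<H. \<Sum>k<H. e_unit (- ((real j - real k) * s)) * c j k N) / of_nat H" for N
  proof -
    have "complex_of_real (\<Sum>n=1..N. fejer H (x n - s)) =
      (\<Sum>n=1..N. \<Sum>j<H. \<Sum>k<H. e_unit (- ((real j - real k) * s)) * e_unit ((real j - real k) * x n)) / of_nat H"
      unfolding of_real_sum fejer_expand by (simp add: sum_divide_distrib)
    also have "(\<Sum>n=1..N. \<Sum>j<H. \<Sum>k<H. e_unit (- ((real j - real k) * s)) * e_unit ((real j - real k) * x n))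
      = (\<Sum>j<H. \<Sum>n=1..N. \<Sum>k<H. e_unit (- ((real j - real k) * s)) * e_unit ((real j - real k) * x n))"
      by (rule sum.swap)
    also have "\<dots> = (\<Sum>j<H. \<Sum>k<H. \<Sum>n=1..N. e_unit (- ((real j - real k) * s)) * e_unit ((real j - real k) * x n))"
      by (intro sum.cong refl sum.swap)
    also have "\<dots> = (\<Sum>j<H. \<Sum>k<H. e_unit (- ((real j - real k) * s)) * (\<Sum>n=1..N. e_unit ((real j - real k) * x n)))"
      by (simp only: sum_distrib_left)
    finally have "complex_of_real ((\<Sum>n=1..N. fejer H (x n - s)) / real N) =
      (\<Sum>j<H. \<Sum>k<H. e_unit (- ((real j - real k) * s)) * (\<Sum>n=1..N. e_unit ((real j - real k) * x n))) / of_nat H / of_nat N"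
      by (simp only: of_real_divide of_real_of_nat_eq)
    also have "\<dots> = (\<Sum>j<H. \<Sum>k<H. e_unit (- ((real j - real k) * s)) * (\<Sum>n=1..N. e_unit ((real j - real k) * x n))) / of_nat N / of_nat H"
      by (simp only: divide_divide_eq_left mult.commute)
    also have "(\<Sum>j<H. \<Sum>k<H. e_unit (- ((real j - real k) * s)) * (\<Sum>n=1..N. e_unit ((real j - real k) * x n))) / of_nat N
      = (\<Sum>j<H. \<Sum>k<H. e_unit (- ((real j - real k) * s)) * c j k N)"
      by (subst sum_divide_distrib, intro sum.cong refl, subst sum_divide_distrib, intro sum.cong refl)
        (simp only: c_def times_divide_eq_right)
    finally show ?thesis .
  qed
  moreover have "(\<lambda>N. (\<Sum>j<H. \<Sum>k<H. e_unit (- ((real j - real k) * s)) * c j k N) / of_nat H) \<longlonglongrightarrow>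
     (\<Sum>j<H. \<Sum>k<H. e_unit (- ((real j - real k) * s)) * (if k = j then 1 else 0)) / of_nat H"
    by (intro tendsto_intros c) (use H in simp)
  moreover have "(\<Sum>j<H. \<Sum>k<H. e_unit (- ((real j - real k) * s)) * (if k = j then 1 else 0)) / of_nat H = complex_of_real 1"
  proof -
    have "(\<Sum>j<H. \<Sum>k<H. e_unit (- ((real j - real k) * s)) * (if k = j then 1 else 0)) = (\<Sum>j<H. 1)"
      by (intro sum.cong refl) (simp add: if_distrib cong: if_cong)
    then show ?thesis using H by simp
  qed
  ultimately have "(\<lambda>N. complex_of_real ((\<Sum>n=1..N. fejer H (x n - s)) / real N)) \<longlonglongrightarrow> complex_of_real 1"
    by simp
  then show ?thesis by (simp only: tendsto_of_real_iff)
qed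

text \<open>The indicator of \<open>{a..<b}\<close> is majorized, up to a factor close to 1, by the mean of Fejer kernels
  centred at the points of a grid near the interval. Upper bounds suffice for the criterion, since
  they apply to the complementary intervals as well.\<close>

lemma frac_count_upper:
  fixes x :: "nat \<Rightarrow> real"
  assumes weyl: "\<And>h::nat. h > 0 \<Longrightarrow> (\<lambda>N. (\<Sum>n=1..N. e_unit (real h * x n)) / of_nat N) \<longlonglongrightarrow> 0"
    and ab: "0 \<le> a" "a \<le> b" "b \<le> 1" and \<epsilon>: "\<epsilon> > 0"
  shows "\<forall>\<^sub>F N in sequentially. real (card {n \<in> {1..N}. frac (x n) \<in> {a..<b}}) / real N < b - a + \<epsilon>"
proof -
  define \<delta> where "\<delta> = min (1 / 2) (\<epsilon> / 32)"
  have \<delta>: "0 < \<delta>" "\<delta> \<le> 1 / 2" "32 * \<delta> \<le> \<epsilon>" using \<epsilon> by (auto simp: \<delta>_def)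
  have sd: "sin (pi * \<delta>) > 0" using \<delta> by (intro sin_gt_zero) (auto simp: field_simps)
  \<comment> \<open>The first summand lets \<open>\<delta> * H\<close> absorb the rounding in three
    counts of grid points; the second pushes the kernel below \<delta> at distance \<delta> from the
    integers.\<close>
  define \<kappa> where "\<kappa> = 3 / \<delta> + 1 / (\<delta> * (sin (pi * \<delta>))\<^sup>2)"
  obtain H :: nat where H: "real H > \<kappa>" using reals_Archimedean2 by blast
  have "3 / \<delta> > 0" "1 / (\<delta> * (sin (pi * \<delta>))\<^sup>2) > 0" using \<delta> sd by auto
  then have H': "real H > 3 / \<delta>" "real H > 1 / (\<delta> * (sin (pi * \<delta>))\<^sup>2)" "real H > 0"
    using H[unfolded \<kappa>_def] by linarith+
  have H0: "H > 0" "3 \<le> \<delta> * real H" "1 / (real H * (sin (pi * \<delta>))\<^sup>2) \<le> \<delta>"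
    using H' \<delta> sd by (auto simp: field_simps)
  \<comment> \<open>The kernel has period 1, so it also peaks when \<open>frac t\<close> and a grid
    point lie near opposite ends of the unit interval. Adding all grid points within \<delta> of 0
    or 1 excludes this.\<close>
  define A where "A = {k. k < H \<and> (a - \<delta> \<le> real k / real H \<and> real k / real H \<le> b + \<delta>)} \<union>
     {k. k < H \<and> (0 \<le> real k / real H \<and> real k / real H \<le> \<delta>)} \<union>
     {k. k < H \<and> (1 - \<delta> \<le> real k / real H \<and> real k / real H \<le> 1)}"
  have A: "A \<subseteq> {..<H}" "finite A" by (auto simp: A_def)
  have cA: "real (card A) \<le> real H * (b - a + 5 * \<delta>)"
  proof -
    have "real (card A) \<le> ((b + \<delta> - (a - \<delta>)) * real H + 1) + ((\<delta> - 0) * real H + 1) + ((1 - (1 - \<delta>)) * real H + 1)"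
      unfolding A_def using ab \<delta> H0(1)
      by (intro order_trans[OF of_nat_mono[OF card_Un_le]] order_trans[OF eq_refl[OF of_nat_add]] add_mono card_grid_le) auto
    then show ?thesis using H0(2) by (simp add: algebra_simps)
  qed
  define \<Phi> where "\<Phi> = (\<lambda>t. (\<Sum>k\<in>A. fejer H (t - real k / real H)) / real H)"
  have \<Phi>0: "\<Phi> t \<ge> 0" for t unfolding \<Phi>_def by (intro divide_nonneg_nonneg sum_nonneg fejer_nonneg) auto
  have fejer_frac: "fejer H (t - s) = fejer H (frac t - s)" for t s
  proof -
    have "e_unit (real j * (t - s)) = e_unit (real j * (frac t - s))" for j
    proof -
      have "real j * (t - s) = real j * (frac t - s) + real j * of_int \<lfloor>t\<rfloor>"
        by (simp add: frac_def algebra_simps)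
      then show ?thesis using e_unit_add_Ints[of "real j * of_int \<lfloor>t\<rfloor>"] by (simp add: Ints_mult)
    qed
    then show ?thesis by (simp add: fejer_def)
  qed
  have \<Phi>1: "\<Phi> t \<ge> 1 - \<delta>" if t: "frac t \<in> {a..<b}" for t
  proof -
    have "real H = (\<Sum>k<H. fejer H (frac t - real k / real H))"
      using sum_fejer_grid[OF H0(1)] by simp
    also have "\<dots> = (\<Sum>k\<in>{..<H} - A. fejer H (frac t - real k / real H)) + (\<Sum>k\<in>A. fejer H (frac t - real k / real H))"
      by (rule sum.subset_diff[OF A(1)]) simp
    also have "(\<Sum>k\<in>{..<H} - A. fejer H (frac t - real k / real H)) \<le> (\<Sum>k\<in>{..<H} - A. \<delta>)"
    proof (rule sum_mono)
      fix k assume k: "k \<in> {..<H} - A"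
      then have kH: "0 \<le> real k / real H" "real k / real H \<le> 1" by auto
      then have k1: "\<delta> < real k / real H" "real k / real H < 1 - \<delta>" using k by (auto simp: A_def)
      have k2: "real k / real H < a - \<delta> \<or> b + \<delta> < real k / real H" using k by (auto simp: A_def)
      have "fejer H (frac t - real k / real H) \<le> 1 / (real H * (sin (pi * \<delta>))\<^sup>2)"
      proof (rule fejer_le[OF H0(1) \<delta>(1,2)])
        show "\<delta> \<le> \<bar>frac t - real k / real H\<bar>" using k2 t by auto
        show "\<bar>frac t - real k / real H\<bar> \<le> 1 - \<delta>"
          using k1 frac_ge_0[of t] frac_lt_1[of t] unfolding abs_le_iff by (intro conjI) linarith+
      qed
      then show "fejer H (frac t - real k / real H) \<le> \<delta>" using H0(3) by linarith
    qed
    also have "\<dots> = real (card ({..<H} - A)) * \<delta>" by simp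
    also have "\<dots> \<le> real H * \<delta>"
      using card_mono[of "{..<H}" "{..<H} - A"] \<delta> by (intro mult_right_mono of_nat_mono) auto
    finally have "real H * (1 - \<delta>) \<le> (\<Sum>k\<in>A. fejer H (t - real k / real H))"
      by (simp add: algebra_simps fejer_frac[of t])
    then show ?thesis using H0(1) by (simp add: \<Phi>_def field_simps)
  qed
  have lim: "(\<lambda>N. (\<Sum>n=1..N. \<Phi> (x n)) / real N) \<longlonglongrightarrow> (\<Sum>k\<in>A. 1) / real H"
  proof -
    have "(\<lambda>N. (\<Sum>k\<in>A. (\<Sum>n=1..N. fejer H (x n - real k / real H)) / real N) / real H) \<longlonglongrightarrow> (\<Sum>k\<in>A. 1) / real H"
      using H0(1) by (intro tendsto_divide tendsto_sum fejer_mean_tendsto weyl tendsto_const) auto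
    moreover have "(\<Sum>k\<in>A. (\<Sum>n=1..N. fejer H (x n - real k / real H)) / real N) / real H = (\<Sum>n=1..N. \<Phi> (x n)) / real N" for N
      unfolding \<Phi>_def sum_divide_distrib by (subst sum.swap) (simp add: mult.commute)
    ultimately show ?thesis by simp
  qed
  have "(\<Sum>k\<in>A. 1) / real H \<le> b - a + 5 * \<delta>"
    using cA H0(1) by (simp add: field_simps)
  also have "\<dots> < b - a + 6 * \<delta>" using \<delta> by simp
  finally have "\<forall>\<^sub>F N in sequentially. (\<Sum>n=1..N. \<Phi> (x n)) / real N < b - a + 6 * \<delta>"
    using lim by (rule order_tendstoD(2)[rotated])
  then show ?thesis using eventually_gt_at_top[of 0]
  proof eventually_elim
    case (elim N)
    let ?S = "{n \<in> {1..N}. frac (x n) \<in> {a..<b}}"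
    have "real (card ?S) * (1 - \<delta>) = (\<Sum>n\<in>?S. 1 - \<delta>)" by simp
    also have "\<dots> \<le> (\<Sum>n\<in>?S. \<Phi> (x n))" by (intro sum_mono \<Phi>1) auto
    also have "\<dots> \<le> (\<Sum>n=1..N. \<Phi> (x n))" by (intro sum_mono2 \<Phi>0) auto
    finally have "real (card ?S) * (1 - \<delta>) / real N \<le> (\<Sum>n=1..N. \<Phi> (x n)) / real N"
      by (rule divide_right_mono) simp
    then have 1: "real (card ?S) / real N * (1 - \<delta>) < b - a + 6 * \<delta>" using elim(1) by simp
    have "(b - a + 6 * \<delta>) \<le> (b - a + \<epsilon>) * (1 - \<delta>)"
    proof -
      have "(b - a) * \<delta> \<le> 1 * \<delta>" using ab \<delta> by (intro mult_right_mono) auto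
      moreover have "\<epsilon> * \<delta> \<le> \<epsilon> * (1 / 2)" using \<epsilon> \<delta> by (intro mult_left_mono) auto
      moreover have "(b - a + \<epsilon>) * (1 - \<delta>) = (b - a) + \<epsilon> - (b - a) * \<delta> - \<epsilon> * \<delta>" by (simp add: algebra_simps)
      ultimately show ?thesis using \<delta> by linarith
    qed
    with 1 have "real (card ?S) / real N * (1 - \<delta>) < (b - a + \<epsilon>) * (1 - \<delta>)" by linarith
    then show ?case using \<delta> by (subst (asm) mult_less_cancel_right_pos) auto
  qed
qed

lemma weyl_criterion:
  assumes weyl: "\<And>h::nat. h > 0 \<Longrightarrow> (\<lambda>N. (\<Sum>n=1..N. e_unit (real h * x n)) / of_nat N) \<longlonglongrightarrow> 0"
  shows "uniformly_distributed_mod_1 x"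
  unfolding uniformly_distributed_mod_1_def
proof (intro allI impI)
  fix a b :: real assume ab: "0 \<le> a \<and> a < b \<and> b \<le> 1"
  define C where "C = (\<lambda>a b N. real (card {n \<in> {1..N}. frac (x n) \<in> {a..<b}}) / real N)"
  \<comment> \<open>Empty intervals are allowed: a complementary piece degenerates when
    \<open>a = 0\<close> or \<open>b = 1\<close>.\<close>
  have upper: "\<forall>\<^sub>F N in sequentially. C a b N < b - a + \<epsilon>" if "0 \<le> a" "a \<le> b" "b \<le> 1" "\<epsilon> > 0" for a b \<epsilon>
    unfolding C_def by (rule frac_count_upper[OF weyl that])
  have tot: "C 0 a N + C a b N + C b 1 N = 1" if "N > 0" for N
  proof -
    let ?S = "\<lambda>a b. {n \<in> {1..N}. frac (x n) \<in> {a..<b}}"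
    have "{1..N} = (?S 0 a \<union> ?S a b) \<union> ?S b 1"
      using ab frac_ge_0 frac_lt_1 by auto
    then have "card {1..N} = card ((?S 0 a \<union> ?S a b) \<union> ?S b 1)" by (rule arg_cong)
    also have "\<dots> = card (?S 0 a \<union> ?S a b) + card (?S b 1)"
      using ab by (intro card_Un_disjoint) auto
    also have "card (?S 0 a \<union> ?S a b) = card (?S 0 a) + card (?S a b)"
      using ab by (intro card_Un_disjoint) auto
    finally have "real N = real (card (?S 0 a)) + real (card (?S a b)) + real (card (?S b 1))" by simp
    then show ?thesis using that by (simp add: C_def add_divide_distrib[symmetric])
  qed
  have "C a b \<longlonglongrightarrow> b - a"
  proof (rule tendstoI)
    fix \<epsilon> :: real assume \<epsilon>: "\<epsilon> > 0"
    have "\<forall>\<^sub>F N in sequentially. C 0 a N < a - 0 + \<epsilon> / 2" "\<forall>\<^sub>F N in sequentially. C b 1 N < 1 - b + \<epsilon> / 2"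
      "\<forall>\<^sub>F N in sequentially. C a b N < b - a + \<epsilon>"
      using ab \<epsilon> by (intro upper; simp)+
    then show "\<forall>\<^sub>F N in sequentially. dist (C a b N) (b - a) < \<epsilon>" using eventually_gt_at_top[of 0]
    proof eventually_elim
      case (elim N)
      have "C a b N > b - a - \<epsilon>" using elim tot[of N] by simp
      then show ?case using elim by (simp add: dist_real_def abs_less_iff)
    qed
  qed
  then show "(\<lambda>N. real (card {n \<in> {1..N}. frac (x n) \<in> {a..<b}}) / real N) \<longlonglongrightarrow> b - a"
    by (simp add: C_def)
qed

section \<open>Conclusion\<close>

text \<open>One threshold serves all shifts \<open>s\<close>, because the Bessel threshold is
  uniform over sequences bounded by 1.\<close>

lemma prime_averages_omega_mean:
  assumes "\<And>k. norm (a k) \<le> 1"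
  shows "prime_averages (\<lambda>s. omega_mean (\<lambda>k. a (k + s)))"
proof
  fix s and x y :: real
  assume "0 < x" "x \<le> y"
  then show "norm (omega_mean (\<lambda>k. a (k + s)) x - omega_mean (\<lambda>k. a (k + s)) y) \<le> 2 * ln (y / x) + 1 / x"
    by (intro omega_mean_lipschitz assms)
next
  fix A :: "nat set"
  assume A: "finite A" "\<And>p. p \<in> A \<Longrightarrow> prime p"
  obtain X where X: "\<And>x a. x \<ge> X \<Longrightarrow> (\<And>k. norm (a k) \<le> 1) \<Longrightarrow>
    (\<Sum>p\<in>A. 1 / real p * (norm (omega_mean a x - omega_mean (\<lambda>k. a (Suc k)) (x / real p)))\<^sup>2) \<le> 4"
    using omega_mean_prime_bessel[OF A] by blast
  have "(\<Sum>p\<in>A. 1 / real p * (norm (omega_mean (\<lambda>k. a (k + s)) x - omega_mean (\<lambda>k. a (k + Suc s)) (x / real p)))\<^sup>2) \<le> 4"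
    if "x \<ge> X" for x s
    using X[OF that, of "\<lambda>k. a (k + s)"] assms by simp
  then show "\<exists>X. \<forall>x\<ge>X. \<forall>s. (\<Sum>p\<in>A. 1 / real p *
      (norm (omega_mean (\<lambda>k. a (k + s)) x - omega_mean (\<lambda>k. a (k + Suc s)) (x / real p)))\<^sup>2) \<le> 4"
    by blast
qed

text \<open>The period is a common multiple of all the almost-periods found by the pigeonhole principle,
  which may depend on the scale \<open>x\<close>.\<close>

lemma omega_mean_period:
  obtains D :: nat where "D > 0" "\<And>a. (\<And>k. norm (a k) \<le> 1) \<Longrightarrow>
    ((\<lambda>x. omega_mean a x - omega_mean (\<lambda>k. a (k + D)) x) \<longlongrightarrow> 0) at_top"
proof
  show "(fact 19200 :: nat) > 0" by (rule fact_gt_zero)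
  fix a :: "nat \<Rightarrow> complex"
  assume "\<And>k. norm (a k) \<le> 1"
  then interpret prime_averages "\<lambda>s. omega_mean (\<lambda>k. a (k + s))"
    by (rule prime_averages_omega_mean)
  show "((\<lambda>x. omega_mean a x - omega_mean (\<lambda>k. a (k + fact 19200)) x) \<longlongrightarrow> 0) at_top"
    using period by (simp only: add_0_right)
qed

lemma norm_omega_mean_le:
  assumes "\<And>k. norm (a k) \<le> C" "x > 0"
  shows "norm (omega_mean a x) \<le> C"
proof -
  have C: "C \<ge> 0" using assms(1)[of 0] norm_ge_zero order_trans by blast
  have "norm (\<Sum>n=1..nat \<lfloor>x\<rfloor>. a (big_omega n)) \<le> real (card {1..nat \<lfloor>x\<rfloor>}) * C"
    using assms(1) by (intro sum_norm_bound)
  also have "\<dots> \<le> x * C" using assms(2) C by (intro mult_right_mono) auto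
  finally show ?thesis using assms(2) by (simp add: omega_mean_def norm_divide field_simps)
qed

text \<open>The mean is asymptotically the average of its shifts by \<open>D * j\<close> for
  \<open>j < H\<close>. That average is the mean over \<open>n\<close> of sums of \<open>a\<close>
  along progressions starting at \<open>big_omega n\<close>, small whatever the starting points
  are.\<close>

lemma omega_mean_tendsto_0:
  assumes a: "\<And>k. norm (a k) \<le> 1" and u: "\<And>D. D > 0 \<Longrightarrow> uniform_cancel a D"
  shows "(omega_mean a \<longlongrightarrow> 0) at_top"
proof -
  obtain D :: nat where D: "D > 0" "\<And>a. (\<And>k. norm (a k) \<le> 1) \<Longrightarrow>
    ((\<lambda>x. omega_mean a x - omega_mean (\<lambda>k. a (k + D)) x) \<longlongrightarrow> 0) at_top"
    using omega_mean_period by blast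
  have shift: "((\<lambda>x. omega_mean a x - omega_mean (\<lambda>k. a (k + D * j)) x) \<longlongrightarrow> 0) at_top" for j
  proof (induction j)
    case (Suc j)
    have "((\<lambda>x. omega_mean (\<lambda>k. a (k + D * j)) x - omega_mean (\<lambda>k. a ((k + D) + D * j)) x) \<longlongrightarrow> 0) at_top"
      using D(2)[of "\<lambda>k. a (k + D * j)"] a by simp
    from tendsto_add[OF Suc.IH this] show ?case by (simp add: algebra_simps)
  qed simp
  show ?thesis
  proof (rule tendstoI)
    fix \<epsilon> :: real assume \<epsilon>: "\<epsilon> > 0"
    obtain H0 where H0: "\<And>H m. H \<ge> H0 \<Longrightarrow> norm (\<Sum>j<H. a (m + D * j)) \<le> \<epsilon> / 2 * real H"
      using u[OF D(1)] \<epsilon> unfolding uniform_cancel_def by (meson half_gt_zero)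
    define H where "H = Suc H0"
    have H: "H > 0" "H \<ge> H0" by (auto simp: H_def)
    have eq: "of_nat H * omega_mean a x = (\<Sum>j<H. omega_mean a x - omega_mean (\<lambda>k. a (k + D * j)) x)
       + omega_mean (\<lambda>k. \<Sum>j<H. a (k + D * j)) x" for x
    proof -
      have "omega_mean (\<lambda>k. \<Sum>j<H. a (k + D * j)) x = (\<Sum>j<H. omega_mean (\<lambda>k. a (k + D * j)) x)"
        unfolding omega_mean_def sum_divide_distrib[symmetric] by (subst sum.swap) (rule refl)
      then show ?thesis by (simp add: sum_subtractf)
    qed
    have "((\<lambda>x. \<Sum>j<H. omega_mean a x - omega_mean (\<lambda>k. a (k + D * j)) x) \<longlongrightarrow> (\<Sum>j<H. 0)) at_top"
      by (intro tendsto_sum shift)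
    moreover have "\<epsilon> / 2 * real H > 0" using \<epsilon> H(1) by simp
    ultimately have "\<forall>\<^sub>F x in at_top. dist (\<Sum>j<H. omega_mean a x - omega_mean (\<lambda>k. a (k + D * j)) x) 0 < \<epsilon> / 2 * real H"
      unfolding sum.neutral_const by (rule tendstoD)
    then have "\<forall>\<^sub>F x in at_top. norm (\<Sum>j<H. omega_mean a x - omega_mean (\<lambda>k. a (k + D * j)) x) < \<epsilon> / 2 * real H"
      by (simp only: dist_norm diff_0_right)
    then show "\<forall>\<^sub>F x in at_top. dist (omega_mean a x) 0 < \<epsilon>"
      using eventually_gt_at_top[of 0]
    proof eventually_elim
      case (elim x)
      have "real H * norm (omega_mean a x) = norm (of_nat H * omega_mean a x)" by (simp add: norm_mult)
      also have "\<dots> \<le> norm (\<Sum>j<H. omega_mean a x - omega_mean (\<lambda>k. a (k + D * j)) x)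
        + norm (omega_mean (\<lambda>k. \<Sum>j<H. a (k + D * j)) x)"
        unfolding eq by (rule norm_triangle_ineq)
      also have "\<dots> < \<epsilon> / 2 * real H + \<epsilon> / 2 * real H"
        using elim H0[OF H(2)] by (intro add_less_le_mono norm_omega_mean_le) auto
      also have "\<dots> = real H * \<epsilon>" by simp
      finally show ?case using H(1) by (simp add: dist_norm)
    qed
  qed
qed

lemma uniformly_distributed_polynomial_big_omega:
  fixes Q :: "real poly"
  assumes "\<exists>i\<in>{1..degree Q}. coeff Q i \<notin> \<rat>"
  shows "uniformly_distributed_mod_1 (\<lambda>n. poly Q (real (big_omega n)))"
proof (rule weyl_criterion)
  fix h :: nat assume h: "h > 0"
  define a where "a = (\<lambda>m. e_unit (\<Sum>i\<le>degree Q. (real h * coeff Q i) * real m ^ i))"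
  have a: "a m = e_unit (real h * poly Q (real m))" for m
    by (simp add: a_def poly_altdef sum_distrib_left mult.assoc)
  have irr: "\<exists>i\<in>{1..degree Q}. real h * coeff Q i \<notin> \<rat>"
    using assms irrational_mult_nat[OF _ h] mult.commute[of "real h"] by metis
  have "uniform_cancel a D" if "D > 0" for D
    unfolding a_def by (rule uniform_cancel_polynomial[OF irr that])
  then have "(omega_mean a \<longlongrightarrow> 0) at_top"
    by (intro omega_mean_tendsto_0) (simp_all only: a norm_e_unit order_refl)
  then have "(\<lambda>N. omega_mean a (real N)) \<longlonglongrightarrow> 0"
    by (rule filterlim_compose) (rule filterlim_real_sequentially)
  then show "(\<lambda>N. (\<Sum>n=1..N. e_unit (real h * poly Q (real (big_omega n)))) / of_nat N) \<longlonglongrightarrow> 0"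
    by (simp add: omega_mean_def a)
qed

section \<open>Failure of uniform distribution for rational coefficients\<close>

lemma frac_add_int: "frac (x + of_int k) = frac (x :: real)"
  by (simp add: frac_def)

text \<open>The fractional parts lie among the points \<open>(w + i) / q\<close>, of which only
  \<open>w / q\<close> can be below \<open>1 / q\<close>. Hence one of the two halves of the
  interval from 0 to \<open>1 / q\<close> is never visited; \<open>a\<close> is its left
  end.\<close>

lemma not_uniformly_distributed_if_multiple_const:
  assumes q: "(q::nat) > 0" and w: "\<And>n. frac (real q * x n) = w"
  shows "\<not> uniformly_distributed_mod_1 x"
proof
  assume u: "uniformly_distributed_mod_1 x"
  define a where "a = (if w < 1 / 2 then 1 / (2 * real q) else 0)"
  have ab: "0 \<le> a" "a < a + 1 / (2 * real q)" "a + 1 / (2 * real q) \<le> 1"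
    using q by (auto simp: a_def field_simps)
  have "frac (x n) \<notin> {a..<a + 1 / (2 * real q)}" for n
  proof
    assume *: "frac (x n) \<in> {a..<a + 1 / (2 * real q)}"
    have qa: "real q * a \<le> real q * frac (x n)" "real q * frac (x n) < real q * (a + 1 / (2 * real q))"
      using * q by auto
    have r: "real q * frac (x n) \<ge> 0 \<and> real q * frac (x n) < 1"
      using qa q by (auto simp: a_def distrib_left split: if_splits)
    have "real q * x n = real q * frac (x n) + of_int (int q * \<lfloor>x n\<rfloor>)"
      by (simp add: frac_def algebra_simps)
    then have "frac (real q * x n) = frac (real q * frac (x n))" by (simp only: frac_add_int)
    also have "\<dots> = real q * frac (x n)" using r by (simp add: frac_eq)
    finally have "real q * frac (x n) = w" by (simp add: w)
    then show False using qa q by (auto simp: a_def distrib_left split: if_splits)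
  qed
  then have "(\<lambda>N. real (card {n \<in> {1..N}. frac (x n) \<in> {a..<a + 1 / (2 * real q)}}) / real N) = (\<lambda>N. 0)"
    by auto
  moreover have "(\<lambda>N. real (card {n \<in> {1..N}. frac (x n) \<in> {a..<a + 1 / (2 * real q)}}) / real N)
      \<longlonglongrightarrow> a + 1 / (2 * real q) - a"
    using u ab unfolding uniformly_distributed_mod_1_def by blast
  ultimately have "(\<lambda>N. 0::real) \<longlonglongrightarrow> 1 / (2 * real q)" by simp
  then show False using q by (simp add: LIMSEQ_const_iff)
qed

text \<open>A common denominator \<open>q\<close> of the nonconstant coefficients makes
  \<open>q * Q m\<close> congruent to \<open>q * coeff Q 0\<close> modulo 1; an irrational constant
  term only affects the common value.\<close>

lemma not_uniformly_distributed_rational_polynomial: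
  fixes Q :: "real poly"
  assumes "\<forall>i\<in>{1..degree Q}. coeff Q i \<in> \<rat>"
  shows "\<not> uniformly_distributed_mod_1 (\<lambda>n. poly Q (real (f n)))"
proof -
  obtain q :: nat where q: "q > 0" "\<And>i. i \<in> {1..degree Q} \<Longrightarrow> real q * coeff Q i \<in> \<int>"
    using common_denominator[of "{1..degree Q}" "coeff Q"] assms by blast
  have "frac (real q * poly Q (real m)) = frac (real q * coeff Q 0)" for m :: nat
  proof -
    have "{..degree Q} = insert 0 {1..degree Q}" by auto
    then have "poly Q (real m) = coeff Q 0 + (\<Sum>i=1..degree Q. coeff Q i * real m ^ i)"
      unfolding poly_altdef by (simp only:) simp
    then have "real q * poly Q (real m) = real q * coeff Q 0 + (\<Sum>i=1..degree Q. (real q * coeff Q i) * real m ^ i)"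
      by (simp add: distrib_left sum_distrib_left mult.assoc)
    moreover have "(\<Sum>i=1..degree Q. (real q * coeff Q i) * real m ^ i) \<in> \<int>"
    proof (rule Ints_sum)
      fix i assume "i \<in> {1..degree Q}"
      then show "(real q * coeff Q i) * real m ^ i \<in> \<int>"
        by (intro Ints_mult[OF q(2)] Ints_power Ints_of_nat)
    qed
    ultimately show ?thesis by (auto elim!: Ints_cases simp: frac_add_int)
  qed
  then show ?thesis by (intro not_uniformly_distributed_if_multiple_const[OF q(1)])
qed

theorem corollary1p5:
  fixes Q :: "real poly"
  shows "uniformly_distributed_mod_1 (\<lambda>n. poly Q (real (big_omega n))) \<longleftrightarrow>
           (\<exists>i\<in>{1..degree Q}. coeff Q i \<notin> \<rat>)"
  using uniformly_distributed_polynomial_big_omega not_uniformly_distributed_rational_polynomial by blast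

end
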